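(* Let $M$ be an abelian group with torsion subgroup $\mathrm t(M)$. Then $M$ is $\sharp$-Mittag-Leffler, where $\sharp$ is the class of absolutely pure abelian groups, if and only if $M/\mathrm t(M)$ is $\aleph_1$-free.
   Context: An abelian group is absolutely pure if it is a pure subgroup of every abelian group containing it (over $\mathbb Z$ this is the same as divisible, and as injective). $M$ is $\sharp$-Mittag-Leffler if for every family $(N_i)_{i\in I}$ of absolutely pure abelian groups the canonical map $(\prod_I N_i)\otimes_{\mathbb Z} M\to\prod_I(N_i\otimes_{\mathbb Z} M)$ is injective. An abelian group is $\aleph_1$-free if every countably generated subgroup is free. *)

theory Defs
  imports "HOL-Algebra.Algebra" "HOL-Library.Countable_Set"
begin

text \<open>
  Abelian groups are multiplicative \<^locale>\<open>comm_group\<close>s over explicit carriers, so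
  the multiple \<open>n \<cdot> x\<close> is written \<open>x [^] n\<close>.
\<close>

subsection \<open>Torsion subgroup and $\aleph_1$-freeness\<close>

definition torsion_subgroup :: "('a, 'x) monoid_scheme \<Rightarrow> 'a set" where
  "torsion_subgroup G = {x \<in> carrier G. \<exists>n::nat. n > 0 \<and> x [^]\<^bsub>G\<^esub> n = \<one>\<^bsub>G\<^esub>}"

text \<open>A basis is a subset of the group, so index sets of the element type of \<open>G\<close> suffice.\<close>

definition free_abelian :: "('a, 'x) monoid_scheme \<Rightarrow> bool" where
  "free_abelian G \<longleftrightarrow> (\<exists>S :: 'a set. G \<cong> free_Abelian_group S)"

definition aleph1_free :: "('a, 'x) monoid_scheme \<Rightarrow> bool" where
  "aleph1_free G \<longleftrightarrow> comm_group G \<and>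
     (\<forall>S \<subseteq> carrier G. countable S \<longrightarrow> free_abelian (subgroup_generated G S))"

subsection \<open>Purity and absolute purity\<close>

definition pure_subgroup :: "'a set \<Rightarrow> ('a, 'x) monoid_scheme \<Rightarrow> bool" where
  "pure_subgroup H B \<longleftrightarrow> subgroup H B \<and>
     (\<forall>n::nat. (\<lambda>b. b [^]\<^bsub>B\<^esub> n) ` carrier B \<inter> H = (\<lambda>h. h [^]\<^bsub>B\<^esub> n) ` H)"

text \<open>
  An abelian group containing \<open>A\<close> is rendered as an abelian group \<open>B\<close> with an injective
  homomorphism \<open>A \<rightarrow> B\<close>. HOL cannot quantify over the element type of \<open>B\<close> inside a definition; the
  type \<open>('a \<times> int) set\<close> chosen here is no restriction, by \<open>absolutely_pure_iff_divisible\<close> and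
  \<open>absolutely_pure_any_type\<close> below.
\<close>

definition absolutely_pure :: "('a, 'x) monoid_scheme \<Rightarrow> bool" where
  "absolutely_pure A \<longleftrightarrow> comm_group A \<and>
     (\<forall>(B :: ('a \<times> int) set monoid) f.
        comm_group B \<and> f \<in> mon A B \<longrightarrow> pure_subgroup (f ` carrier A) B)"

lemma pure_subgroup_image_divisible:
  assumes A: "comm_group A" and B: "comm_group B" and f: "f \<in> mon A B"
    and div: "\<forall>n::nat. n > 0 \<longrightarrow> (\<forall>a \<in> carrier A. \<exists>c \<in> carrier A. c [^]\<^bsub>A\<^esub> n = a)"
  shows "pure_subgroup (f ` carrier A) B"
proof -
  interpret A: comm_group A by (rule A)
  interpret B: comm_group B by (rule B)
  interpret f: group_hom A B f
    using f by unfold_locales (auto simp: mon_def)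
  have sub: "subgroup (f ` carrier A) B"
    by (rule f.img_is_subgroup)
  have "(\<lambda>b. b [^]\<^bsub>B\<^esub> n) ` carrier B \<inter> f ` carrier A = (\<lambda>h. h [^]\<^bsub>B\<^esub> n) ` f ` carrier A"
    for n :: nat
  proof
    show "(\<lambda>b. b [^]\<^bsub>B\<^esub> n) ` carrier B \<inter> f ` carrier A \<subseteq> (\<lambda>h. h [^]\<^bsub>B\<^esub> n) ` f ` carrier A"
    proof
      fix x assume x: "x \<in> (\<lambda>b. b [^]\<^bsub>B\<^esub> n) ` carrier B \<inter> f ` carrier A"
      then obtain a where a: "a \<in> carrier A" "x = f a" by auto
      show "x \<in> (\<lambda>h. h [^]\<^bsub>B\<^esub> n) ` f ` carrier A"
      proof (cases "n = 0")
        case True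
        then show ?thesis using x a by auto
      next
        case False
        then obtain c where c: "c \<in> carrier A" "c [^]\<^bsub>A\<^esub> n = a" using div a by auto
        then have "x = f c [^]\<^bsub>B\<^esub> n" using a by (metis f.hom_nat_pow)
        then show ?thesis using c by auto
      qed
    qed
    show "(\<lambda>h. h [^]\<^bsub>B\<^esub> n) ` f ` carrier A \<subseteq> (\<lambda>b. b [^]\<^bsub>B\<^esub> n) ` carrier B \<inter> f ` carrier A"
      by (auto simp flip: f.hom_nat_pow)
  qed
  then show ?thesis using sub by (simp add: pure_subgroup_def)
qed

lemma absolutely_pure_imp_divisible:
  fixes A :: "('a, 'x) monoid_scheme" and n :: nat
  assumes ap: "absolutely_pure A" and n: "n > 0" and a: "a \<in> carrier A"
  shows "\<exists>c \<in> carrier A. c [^]\<^bsub>A\<^esub> n = a"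
proof -
  interpret A: comm_group A using ap by (simp add: absolutely_pure_def)
  define G where "G = A \<times>\<times> integer_group"
  have grpG: "group G" unfolding G_def by (intro DirProd_group A.is_group group_integer_group)
  interpret G: comm_group G
  proof (rule group.group_comm_groupI[OF grpG])
    fix x y assume "x \<in> carrier G" "y \<in> carrier G"
    then show "x \<otimes>\<^bsub>G\<^esub> y = y \<otimes>\<^bsub>G\<^esub> x"
      by (cases x; cases y) (auto simp: G_def A.m_comm)
  qed
  have powG: "(x, k) [^]\<^bsub>G\<^esub> m = (x [^]\<^bsub>A\<^esub> m, int m * k)" for x k and m :: nat
    by (induction m) (auto simp: G_def algebra_simps)
  define K where "K = range (\<lambda>k::int. (a [^]\<^bsub>A\<^esub> k, - (int n * k)))"
  have "subgroup K G"
  proof (rule G.subgroupI)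
    show "K \<subseteq> carrier G" using a by (auto simp: K_def G_def)
    show "K \<noteq> {}" by (auto simp: K_def)
    fix x assume "x \<in> K"
    then obtain k where k: "x = (a [^]\<^bsub>A\<^esub> k, - (int n * k))" by (auto simp: K_def)
    have "inv\<^bsub>G\<^esub> x = (a [^]\<^bsub>A\<^esub> (-k), - (int n * (-k)))"
      unfolding k G_def using a
      by (subst inv_DirProd) (auto simp: A.is_group A.int_pow_neg)
    then show "inv\<^bsub>G\<^esub> x \<in> K" unfolding K_def by blast
    fix y assume "y \<in> K"
    then obtain l where l: "y = (a [^]\<^bsub>A\<^esub> l, - (int n * l))" by (auto simp: K_def)
    have "x \<otimes>\<^bsub>G\<^esub> y = (a [^]\<^bsub>A\<^esub> (k + l), - (int n * (k + l)))"
      unfolding k l G_def using a by (simp add: A.int_pow_mult algebra_simps)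
    then show "x \<otimes>\<^bsub>G\<^esub> y \<in> K" unfolding K_def by blast
  qed
  then interpret K: normal K G by (rule G.subgroup_imp_normal)
  define B where "B = G Mod K"
  have commB: "comm_group B" unfolding B_def
    using \<open>subgroup K G\<close> by (simp add: G.abelian_FactGroup)
  define f where "f = (\<lambda>x. K #>\<^bsub>G\<^esub> (x, 0::int))"
  have fhom: "f \<in> hom A B"
  proof (rule homI)
    fix x assume "x \<in> carrier A"
    then show "f x \<in> carrier B"
      by (auto simp: f_def B_def FactGroup_def RCOSETS_def G_def)
  next
    fix x y assume "x \<in> carrier A" "y \<in> carrier A"
    then show "f (x \<otimes>\<^bsub>A\<^esub> y) = f x \<otimes>\<^bsub>B\<^esub> f y"
      by (auto simp: f_def B_def FactGroup_def G_def K.rcos_sum[unfolded G_def])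
  qed
  have coset_eq: "K #>\<^bsub>G\<^esub> u = K #>\<^bsub>G\<^esub> v \<longleftrightarrow> u \<otimes>\<^bsub>G\<^esub> inv\<^bsub>G\<^esub> v \<in> K"
    if "u \<in> carrier G" "v \<in> carrier G" for u v
  proof
    assume "K #>\<^bsub>G\<^esub> u = K #>\<^bsub>G\<^esub> v"
    then have "u \<in> K #>\<^bsub>G\<^esub> v" using G.rcos_self[OF that(1) \<open>subgroup K G\<close>] by simp
    then obtain k where "k \<in> K" "u = k \<otimes>\<^bsub>G\<^esub> v" by (auto simp: r_coset_def)
    then show "u \<otimes>\<^bsub>G\<^esub> inv\<^bsub>G\<^esub> v \<in> K" using that
      by (simp add: G.m_assoc K.mem_carrier)
  next
    assume "u \<otimes>\<^bsub>G\<^esub> inv\<^bsub>G\<^esub> v \<in> K"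
    then have "(u \<otimes>\<^bsub>G\<^esub> inv\<^bsub>G\<^esub> v) \<otimes>\<^bsub>G\<^esub> v \<in> K #>\<^bsub>G\<^esub> v" by (auto simp: r_coset_def)
    then have "u \<in> K #>\<^bsub>G\<^esub> v" using that by (simp add: G.m_assoc)
    then show "K #>\<^bsub>G\<^esub> u = K #>\<^bsub>G\<^esub> v"
      using G.repr_independence[OF _ _ \<open>subgroup K G\<close>] that by metis
  qed
  have invG: "inv\<^bsub>G\<^esub> (x, k) = (inv\<^bsub>A\<^esub> x, - k)" if "x \<in> carrier A" for x k
    unfolding G_def using that by (subst inv_DirProd) (auto simp: A.is_group)
  have inj: "inj_on f (carrier A)"
  proof (rule inj_onI)
    fix x y assume xy: "x \<in> carrier A" "y \<in> carrier A" and eq: "f x = f y"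
    then have "(x, 0) \<otimes>\<^bsub>G\<^esub> inv\<^bsub>G\<^esub> (y, 0) \<in> K"
      using coset_eq[of "(x,0)" "(y,0)"] by (simp add: f_def G_def)
    then have "(x \<otimes>\<^bsub>A\<^esub> inv\<^bsub>A\<^esub> y, 0::int) \<in> K" using xy by (simp add: invG, simp add: G_def)
    then have "x \<otimes>\<^bsub>A\<^esub> inv\<^bsub>A\<^esub> y = \<one>\<^bsub>A\<^esub>" using n by (auto simp: K_def)
    then show "x = y" using xy by (metis A.inv_closed A.inv_equality A.inv_inv)
  qed
  have pure: "pure_subgroup (f ` carrier A) B"
    using ap commB fhom inj unfolding absolutely_pure_def mon_def by blast
  have powB: "(K #>\<^bsub>G\<^esub> u) [^]\<^bsub>B\<^esub> m = K #>\<^bsub>G\<^esub> (u [^]\<^bsub>G\<^esub> m)" if "u \<in> carrier G" for u and m :: nat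
    unfolding B_def using K.FactGroup_pow[OF that] by simp
  let ?b = "K #>\<^bsub>G\<^esub> (\<one>\<^bsub>A\<^esub>, 1::int)"
  have bB: "?b \<in> carrier B" by (auto simp: B_def FactGroup_def RCOSETS_def G_def)
  have "?b [^]\<^bsub>B\<^esub> n = K #>\<^bsub>G\<^esub> (\<one>\<^bsub>A\<^esub>, int n)"
    by (subst powB) (auto simp: powG, auto simp: G_def)
  also have "\<dots> = f a"
  proof -
    have "(a [^]\<^bsub>A\<^esub> (-1::int), - (int n * (-1))) \<in> K" unfolding K_def by blast
    then have "(\<one>\<^bsub>A\<^esub>, int n) \<otimes>\<^bsub>G\<^esub> inv\<^bsub>G\<^esub> (a, 0) \<in> K"
      using a by (simp add: invG, simp add: G_def A.int_pow_neg)
    then show ?thesis using coset_eq[of "(\<one>\<^bsub>A\<^esub>, int n)" "(a, 0)"] a by (simp add: f_def G_def)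
  qed
  finally have "f a \<in> (\<lambda>b. b [^]\<^bsub>B\<^esub> n) ` carrier B \<inter> f ` carrier A"
    using a bB by (metis (mono_tags, lifting) IntI image_eqI)
  then have "f a \<in> (\<lambda>h. h [^]\<^bsub>B\<^esub> n) ` f ` carrier A"
    using pure unfolding pure_subgroup_def by blast
  then obtain c where c: "c \<in> carrier A" "f a = f c [^]\<^bsub>B\<^esub> n" by auto
  have "f c [^]\<^bsub>B\<^esub> n = f (c [^]\<^bsub>A\<^esub> n)"
    unfolding f_def using c by (subst powB) (auto simp: powG, auto simp: G_def)
  then have "a = c [^]\<^bsub>A\<^esub> n" using inj c a by (metis inj_onD A.nat_pow_closed)
  then show ?thesis using c by blast
qed

lemma absolutely_pure_iff_divisible:
  "absolutely_pure A \<longleftrightarrow> comm_group A \<and>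
     (\<forall>n::nat. n > 0 \<longrightarrow> (\<forall>a \<in> carrier A. \<exists>c \<in> carrier A. c [^]\<^bsub>A\<^esub> n = a))"
  using absolutely_pure_imp_divisible[of A] pure_subgroup_image_divisible[of A]
  unfolding absolutely_pure_def by blast

lemma absolutely_pure_any_type:
  assumes "absolutely_pure A" "comm_group B" "f \<in> mon A B"
  shows "pure_subgroup (f ` carrier A) B"
  using assms pure_subgroup_image_divisible[of A B f] by (auto simp: absolutely_pure_iff_divisible)

subsection \<open>Tensor product over the integers\<close>

definition bilinearity_relators ::
    "('a, 'x) monoid_scheme \<Rightarrow> ('b, 'y) monoid_scheme \<Rightarrow> ('a \<times> 'b \<Rightarrow>\<^sub>0 int) set" where
  "bilinearity_relators A B =
     {frag_of (a \<otimes>\<^bsub>A\<^esub> a', b) - frag_of (a, b) - frag_of (a', b) | a a' b.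
        a \<in> carrier A \<and> a' \<in> carrier A \<and> b \<in> carrier B} \<union>
     {frag_of (a, b \<otimes>\<^bsub>B\<^esub> b') - frag_of (a, b) - frag_of (a, b') | a b b'.
        a \<in> carrier A \<and> b \<in> carrier B \<and> b' \<in> carrier B}"

definition tensor_relations ::
    "('a, 'x) monoid_scheme \<Rightarrow> ('b, 'y) monoid_scheme \<Rightarrow> ('a \<times> 'b \<Rightarrow>\<^sub>0 int) set" where
  "tensor_relations A B =
     generate (free_Abelian_group (carrier A \<times> carrier B)) (bilinearity_relators A B)"

definition tensor_product ::
    "('a, 'x) monoid_scheme \<Rightarrow> ('b, 'y) monoid_scheme \<Rightarrow> ('a \<times> 'b \<Rightarrow>\<^sub>0 int) set monoid" where
  "tensor_product A B = free_Abelian_group (carrier A \<times> carrier B) Mod tensor_relations A B"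

definition tensor_class ::
    "('a, 'x) monoid_scheme \<Rightarrow> ('b, 'y) monoid_scheme \<Rightarrow> ('a \<times> 'b \<Rightarrow>\<^sub>0 int) \<Rightarrow> ('a \<times> 'b \<Rightarrow>\<^sub>0 int) set"
  where "tensor_class A B u =
    tensor_relations A B #>\<^bsub>free_Abelian_group (carrier A \<times> carrier B)\<^esub> u"

text \<open>
  The map \<open>f \<otimes> g\<close> into \<open>A' \<otimes> B'\<close>: for homomorphisms \<open>f\<close> and \<open>g\<close>, all elements of
  a coset have the same image class, see \<open>tensor_map_class\<close>.
\<close>

definition tensor_map ::
    "('c, 'x) monoid_scheme \<Rightarrow> ('d, 'y) monoid_scheme \<Rightarrow> ('a \<Rightarrow> 'c) \<Rightarrow> ('b \<Rightarrow> 'd) \<Rightarrow>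
     ('a \<times> 'b \<Rightarrow>\<^sub>0 int) set \<Rightarrow> ('c \<times> 'd \<Rightarrow>\<^sub>0 int) set" where
  "tensor_map A' B' f g T = the_elem
     ((\<lambda>u. tensor_class A' B' (frag_extend (\<lambda>(a, b). frag_of (f a, g b)) u)) ` T)"

text \<open>The canonical map \<open>(\<Prod>i\<in>I. N i) \<otimes> M \<rightarrow> (\<Prod>i\<in>I. N i \<otimes> M)\<close>, with components
  (\<open>i\<close>-th projection) \<open>\<otimes>\<close> \<open>M\<close>.\<close>

definition product_tensor_map ::
    "'i set \<Rightarrow> ('i \<Rightarrow> ('n, 'x) monoid_scheme) \<Rightarrow> ('m, 'y) monoid_scheme \<Rightarrow>
     (('i \<Rightarrow> 'n) \<times> 'm \<Rightarrow>\<^sub>0 int) set \<Rightarrow> 'i \<Rightarrow> ('n \<times> 'm \<Rightarrow>\<^sub>0 int) set" where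
  "product_tensor_map I N M T = (\<lambda>i\<in>I. tensor_map (N i) M (\<lambda>x. x i) id T)"

lemma subgroup_tensor_relations:
  fixes A :: "('a, 'x) monoid_scheme" and B :: "('b, 'y) monoid_scheme"
  assumes "group A" "group B"
  shows "subgroup (tensor_relations A B) (free_Abelian_group (carrier A \<times> carrier B))"
proof -
  interpret A: group A by fact
  interpret B: group B by fact
  have keys: "Poly_Mapping.keys (frag_of x - frag_of y - frag_of z) \<subseteq> S"
    if "x \<in> S" "y \<in> S" "z \<in> S" for x y z :: "'a \<times> 'b" and S
  proof -
    have "Poly_Mapping.keys (frag_of x - frag_of y) \<subseteq> S"
      using that keys_diff[of "frag_of x" "frag_of y"] by auto
    then show ?thesis
      using that keys_diff[of "frag_of x - frag_of y" "frag_of z"] by auto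
  qed
  have "bilinearity_relators A B \<subseteq> carrier (free_Abelian_group (carrier A \<times> carrier B))"
    unfolding bilinearity_relators_def
  proof (intro subsetI, elim UnE CollectE exE conjE)
    show "w \<in> carrier (free_Abelian_group (carrier A \<times> carrier B))"
      if "w = frag_of (a \<otimes>\<^bsub>A\<^esub> a', b) - frag_of (a, b) - frag_of (a', b)"
        "a \<in> carrier A" "a' \<in> carrier A" "b \<in> carrier B" for w a a' b
      unfolding that(1) carrier_free_Abelian_group_iff by (rule keys) (use that in auto)
    show "w \<in> carrier (free_Abelian_group (carrier A \<times> carrier B))"
      if "w = frag_of (a, b \<otimes>\<^bsub>B\<^esub> b') - frag_of (a, b) - frag_of (a, b')"
        "a \<in> carrier A" "b \<in> carrier B" "b' \<in> carrier B" for w a b b'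
      unfolding that(1) carrier_free_Abelian_group_iff by (rule keys) (use that in auto)
  qed
  then show ?thesis unfolding tensor_relations_def
    by (intro group.generate_is_subgroup group_free_Abelian_group)
qed

lemma tensor_map_class:
  fixes A :: "('a, 'x) monoid_scheme" and B :: "('b, 'y) monoid_scheme"
    and A' :: "('c, 'z) monoid_scheme" and B' :: "('d, 'w) monoid_scheme"
  assumes A: "group A" and B: "group B" and A': "group A'" and B': "group B'"
    and f: "f \<in> hom A A'" and g: "g \<in> hom B B'"
    and u: "u \<in> carrier (free_Abelian_group (carrier A \<times> carrier B))"
  shows "tensor_map A' B' f g (tensor_class A B u) =
    tensor_class A' B' (frag_extend (\<lambda>(a, b). frag_of (f a, g b)) u)"
proof -
  define F where "F = free_Abelian_group (carrier A \<times> carrier B)"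
  define F' where "F' = free_Abelian_group (carrier A' \<times> carrier B')"
  let ?R = "tensor_relations A B" and ?R' = "tensor_relations A' B'"
  let ?h = "frag_extend (\<lambda>(a, b). frag_of (f a, g b))"
  interpret A: group A by fact
  interpret B: group B by fact
  interpret F: comm_group F by (simp add: F_def abelian_free_Abelian_group)
  interpret F': comm_group F' by (simp add: F'_def abelian_free_Abelian_group)
  have R: "subgroup ?R F" and R': "subgroup ?R' F'"
    using subgroup_tensor_relations A B A' B' unfolding F_def F'_def by blast+
  have h: "?h w \<in> carrier F'" if "w \<in> carrier F" for w
  proof -
    have "Poly_Mapping.keys (?h w) \<subseteq> (\<Union>x \<in> Poly_Mapping.keys w. Poly_Mapping.keys (case x of (a, b) \<Rightarrow> frag_of (f a, g b)))"
      by (rule keys_frag_extend)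
    also have "\<dots> \<subseteq> carrier A' \<times> carrier B'"
    proof
      fix y assume "y \<in> (\<Union>x \<in> Poly_Mapping.keys w. Poly_Mapping.keys (case x of (a, b) \<Rightarrow> frag_of (f a, g b)))"
      then obtain a b where ab: "(a, b) \<in> Poly_Mapping.keys w" "y = (f a, g b)" by auto
      then have "a \<in> carrier A" "b \<in> carrier B" using that by (auto simp: F_def)
      then show "y \<in> carrier A' \<times> carrier B'"
        using hom_in_carrier[OF f] hom_in_carrier[OF g] ab by simp
    qed
    finally show ?thesis by (simp add: F'_def)
  qed
  interpret h: group_hom F F' ?h
  proof unfold_locales
    show "?h \<in> hom F F'"
    proof (rule homI)
      show "?h (x \<otimes>\<^bsub>F\<^esub> y) = ?h x \<otimes>\<^bsub>F'\<^esub> ?h y" for x y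
        by (simp add: F_def F'_def frag_extend_add)
    qed (rule h)
  qed
  have rel: "?h w \<in> bilinearity_relators A' B'" if "w \<in> bilinearity_relators A B" for w
    using that unfolding bilinearity_relators_def
  proof (elim UnE CollectE exE conjE)
    fix a a' b
    assume w: "w = frag_of (a \<otimes>\<^bsub>A\<^esub> a', b) - frag_of (a, b) - frag_of (a', b)"
      and ab: "a \<in> carrier A" "a' \<in> carrier A" "b \<in> carrier B"
    have "?h w = frag_of (f a \<otimes>\<^bsub>A'\<^esub> f a', g b) - frag_of (f a, g b) - frag_of (f a', g b)"
      using ab by (simp add: w frag_extend_diff hom_mult[OF f])
    then show "?h w \<in> {frag_of (a \<otimes>\<^bsub>A'\<^esub> a', b) - frag_of (a, b) - frag_of (a', b) | a a' b.
        a \<in> carrier A' \<and> a' \<in> carrier A' \<and> b \<in> carrier B'} \<union>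
       {frag_of (a, b \<otimes>\<^bsub>B'\<^esub> b') - frag_of (a, b) - frag_of (a, b') | a b b'.
        a \<in> carrier A' \<and> b \<in> carrier B' \<and> b' \<in> carrier B'}"
      using ab hom_in_carrier[OF f] hom_in_carrier[OF g] by blast
  next
    fix a b b'
    assume w: "w = frag_of (a, b \<otimes>\<^bsub>B\<^esub> b') - frag_of (a, b) - frag_of (a, b')"
      and ab: "a \<in> carrier A" "b \<in> carrier B" "b' \<in> carrier B"
    have "?h w = frag_of (f a, g b \<otimes>\<^bsub>B'\<^esub> g b') - frag_of (f a, g b) - frag_of (f a, g b')"
      using ab by (simp add: w frag_extend_diff hom_mult[OF g])
    then show "?h w \<in> {frag_of (a \<otimes>\<^bsub>A'\<^esub> a', b) - frag_of (a, b) - frag_of (a', b) | a a' b.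
        a \<in> carrier A' \<and> a' \<in> carrier A' \<and> b \<in> carrier B'} \<union>
       {frag_of (a, b \<otimes>\<^bsub>B'\<^esub> b') - frag_of (a, b) - frag_of (a, b') | a b b'.
        a \<in> carrier A' \<and> b \<in> carrier B' \<and> b' \<in> carrier B'}"
      using ab hom_in_carrier[OF f] hom_in_carrier[OF g] by blast
  qed
  have sub: "?h w \<in> ?R'" if "w \<in> ?R" for w
    using that unfolding tensor_relations_def[of A B] F_def[symmetric]
  proof (induction rule: generate.induct)
    case one
    then show ?case using R' by (simp add: subgroup.one_closed)
  next
    case (incl w)
    then show ?case using rel unfolding tensor_relations_def F'_def
      by (simp add: generate.incl)
  next
    case (inv w)
    then have "w \<in> ?R" unfolding tensor_relations_def by (auto intro: generate.incl)
    then have "w \<in> carrier F" using R by (simp add: subgroup.mem_carrier)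
    moreover have "?h w \<in> ?R'" using inv rel unfolding tensor_relations_def F'_def
      by (simp add: generate.incl)
    ultimately show ?case using R' by (simp add: subgroup.m_inv_closed)
  next
    case (eng w v)
    then have "w \<in> carrier F" "v \<in> carrier F"
      using subgroup.mem_carrier[OF R] unfolding tensor_relations_def F_def by blast+
    then show ?case using eng R' by (simp add: subgroup.m_closed)
  qed
  have uF: "u \<in> carrier F" unfolding F_def by (rule u)
  have eq: "tensor_class A' B' (?h w) = tensor_class A' B' (?h u)" if w: "w \<in> tensor_class A B u" for w
  proof -
    obtain r where r: "r \<in> ?R" "w = r \<otimes>\<^bsub>F\<^esub> u"
      using w by (auto simp: tensor_class_def r_coset_def F_def)
    have "r \<in> carrier F" by (rule subgroup.mem_carrier[OF R r(1)])
    then have "?h w = ?h r \<otimes>\<^bsub>F'\<^esub> ?h u" unfolding r(2) using uF by (rule h.hom_mult)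
    then have "?h w \<in> ?R' #>\<^bsub>F'\<^esub> ?h u" using sub[OF r(1)] unfolding r_coset_def by blast
    from F'.repr_independence[OF this h[OF uF] R'] show ?thesis
      unfolding tensor_class_def F'_def by (rule sym)
  qed
  have "u \<in> tensor_class A B u"
    using F.rcos_self[OF uF R] unfolding tensor_class_def F_def .
  then have "(\<lambda>w. tensor_class A' B' (?h w)) ` tensor_class A B u = {tensor_class A' B' (?h u)}"
    using eq by blast
  then show ?thesis by (simp add: tensor_map_def)
qed

lemma product_tensor_map_pure_tensor:
  assumes "\<And>i. i \<in> I \<Longrightarrow> group (N i)" "group M" "x \<in> carrier (product_group I N)" "m \<in> carrier M"
  shows "product_tensor_map I N M (tensor_class (product_group I N) M (frag_of (x, m))) =
    (\<lambda>i\<in>I. tensor_class (N i) M (frag_of (x i, m)))"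
proof -
  have "tensor_map (N i) M (\<lambda>x. x i) id (tensor_class (product_group I N) M (frag_of (x, m))) =
      tensor_class (N i) M (frag_of (x i, m))" if "i \<in> I" for i
  proof -
    have "(\<lambda>x. x i) \<in> hom (product_group I N) (N i)"
      using that by (auto simp: hom_def)
    then show ?thesis
      using assms that
      by (subst tensor_map_class) (auto simp: hom_def PiE_def)
  qed
  then show ?thesis unfolding product_tensor_map_def by (intro restrict_ext)
qed

subsection \<open>The relative Mittag-Leffler property\<close>

text \<open>
  The families \<open>(N i)\<^sub>i\<^sub>\<in>\<^sub>I\<close> range over all absolutely pure groups with elements in \<open>'n\<close> and all
  index sets in \<open>'i\<close>; the property ``for every family'' is the one at all types \<open>'i\<close> and \<open>'n\<close>. Finite types
  admit too few families to detect it: a finite absolutely pure group is trivial.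
\<close>

definition sharp_Mittag_Leffler ::
    "'i itself \<Rightarrow> 'n itself \<Rightarrow> ('m, 'x) monoid_scheme \<Rightarrow> bool" where
  "sharp_Mittag_Leffler TYPE('i) TYPE('n) M \<longleftrightarrow>
     (\<forall>(I :: 'i set) (N :: 'i \<Rightarrow> 'n monoid).
        (\<forall>i\<in>I. absolutely_pure (N i)) \<longrightarrow>
        inj_on (product_tensor_map I N M) (carrier (tensor_product (product_group I N) M)))"

end

theory Submission
  imports Defs
begin

text \<open>
  Write \<open>t\<close> for the torsion subgroup of \<open>M\<close>; it dies in \<open>D \<otimes> M\<close> for divisible \<open>D\<close>.

  If \<open>M / t\<close> is $\aleph_1$-free, a tensor in \<open>(\<Prod>i. N i) \<otimes> M\<close> lives on a finite part of a basis of the pure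
  closure of its finitely many \<open>M\<close>-entries, so it can be written as \<open>\<Sum>j. \<delta> j \<otimes> \<epsilon> j\<close> with \<open>\<epsilon>\<close> a basis of a pure
  subgroup. Purity makes the coordinates with respect to \<open>\<epsilon>\<close> available in each \<open>N i \<otimes> M\<close>, hence a tensor
  that vanishes componentwise has \<open>\<delta> = 0\<close>.

  Conversely the Mittag-Leffler property for powers of \<open>\<rat>/\<int>\<close> puts the pure closure of each finite
  subset of \<open>M / t\<close> into a finitely generated subgroup, and Pontryagin's criterion applies.

  Subgroups of \<open>M / t\<close> are handled through their preimages in the free abelian group on the elements
  of \<open>M\<close>, which is a group in the additive type class.
\<close>

text \<open>Both implications test tensors with coordinate functions. A relation in
  \<open>D \<otimes> M\<close> involves finitely many elements of \<open>M\<close>; modulo torsion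
  these generate a finitely generated torsion-free, hence free, group. A coordinate function
  \<open>c\<close> of a basis is additive there with integer values, so the product of the powers
  \<open>a [^] c v\<close> over the pairs \<open>(a, v)\<close> of a vanishing tensor is trivial.
  The obstacle is that \<open>M / t\<close> need not be free, so such functions exist only on
  suitable finitely generated parts, and the finite support of a relation must be tracked. Torsion
  dies because a divisible \<open>D\<close> has \<open>x = y [^] n\<close>, so that
  \<open>x \<otimes> t = y \<otimes> t [^] n\<close> for every \<open>n\<close>. The group of
  rationals modulo one is the test object because \<open>z / q\<close> vanishes in it exactly if
  \<open>q\<close> divides \<open>z\<close>: vanishing tensors become divisibility statements about
  coordinates. This group is countable, and so is the set of divisibility problems over finitely
  many fixed elements of \<open>M\<close>; hence one infinite element type and one infinite index
  type have room for them.\<close>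

interpretation frag: Modules.module frag_cmul
  by unfold_locales (simp_all add: frag_cmul_distrib frag_cmul_distrib2)

text \<open>Integer multiples are iterated differences, so \<open>frag.subspace\<close> just means
  subgroup.\<close>

lemma frag_subspaceI:
  assumes "0 \<in> S" "\<And>x y. x \<in> S \<Longrightarrow> y \<in> S \<Longrightarrow> x - y \<in> S"
  shows "frag.subspace S"
proof (rule frag.subspaceI)
  have neg: "- y \<in> S" if "y \<in> S" for y
    using assms(2)[OF assms(1) that] by simp
  then show "x + y \<in> S" if "x \<in> S" "y \<in> S" for x y
    using assms(2)[OF that(1) neg[OF that(2)]] by simp
  show "frag_cmul c x \<in> S" if "x \<in> S" for c x
    using assms that by (rule frag_closure_minus_cmul)
qed (rule assms)

lemma subspace_keys_subset: "frag.subspace {w. Poly_Mapping.keys w \<subseteq> S}"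
  by (rule frag_subspaceI) (auto dest: subsetD[OF keys_diff])

lemma frag_extend_mem:
  "frag.subspace W \<Longrightarrow> (\<And>i. i \<in> Poly_Mapping.keys c \<Longrightarrow> x i \<in> W) \<Longrightarrow> frag_extend x c \<in> W"
  unfolding frag_extend_def by (auto intro: frag.subspace_sum frag.subspace_scale)

lemma frag_extend_fun_add:
  "frag_extend (\<lambda>i. x i + y i) c = frag_extend x c + frag_extend y c"
  by (simp add: frag_extend_def sum.distrib frag_cmul_distrib2)

text \<open>Records how an elementary operation on generators changes a combination; it is the
  bookkeeping behind the Euclidean step in \<open>drop_dependent_generator\<close>.\<close>

lemma frag_extend_upd_add:
  "frag_extend (x(j := x j + z)) c = frag_extend x c + frag_cmul (Poly_Mapping.lookup c j) z"
proof -
  have "frag_extend (x(j := x j + z)) c = frag_extend (\<lambda>i. x i + (if i = j then z else 0)) c"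
    by (rule frag_extend_eq) auto
  also have "frag_extend (\<lambda>i. if i = j then z else 0) c = frag_cmul (Poly_Mapping.lookup c j) z"
    by (simp add: frag_extend_def if_distrib[of "frag_cmul _"] in_keys_iff cong: if_cong)
  ultimately show ?thesis by (simp add: frag_extend_fun_add)
qed

lemma keys_subset_Un_diff:
  "Poly_Mapping.keys c \<subseteq> S \<Longrightarrow> Poly_Mapping.keys d \<subseteq> S \<Longrightarrow> Poly_Mapping.keys (c - d) \<subseteq> S"
  using keys_diff[of c d] by blast

section \<open>Integer spans modulo a subgroup\<close>

text \<open>For a subgroup \<open>K\<close> this is the preimage of the subgroup that the classes of
  the \<open>x i\<close> generate modulo \<open>K\<close>. Keeping \<open>K\<close> as a parameter,
  instead of forming cosets, allows passing to a larger \<open>K\<close> without changing the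
  elements: a span can itself serve as the next \<open>K\<close>.\<close>

definition int_span :: "('a \<Rightarrow>\<^sub>0 int) set \<Rightarrow> ('i \<Rightarrow> 'a \<Rightarrow>\<^sub>0 int) \<Rightarrow> 'i set \<Rightarrow> ('a \<Rightarrow>\<^sub>0 int) set" where
  "int_span K x I = {v. \<exists>c. Poly_Mapping.keys c \<subseteq> I \<and> v - frag_extend x c \<in> K}"

definition int_indep :: "('a \<Rightarrow>\<^sub>0 int) set \<Rightarrow> ('i \<Rightarrow> 'a \<Rightarrow>\<^sub>0 int) \<Rightarrow> 'i set \<Rightarrow> bool" where
  "int_indep K x I \<longleftrightarrow> (\<forall>c. Poly_Mapping.keys c \<subseteq> I \<longrightarrow> frag_extend x c \<in> K \<longrightarrow> c = 0)"

text \<open>If \<open>V\<close> is a subgroup containing \<open>K\<close>, this is torsion-freeness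
  of \<open>V / K\<close>; if \<open>V\<close> is the whole ambient group, it is purity of
  \<open>K\<close>.\<close>

definition pure_in :: "('a \<Rightarrow>\<^sub>0 int) set \<Rightarrow> ('a \<Rightarrow>\<^sub>0 int) set \<Rightarrow> bool" where
  "pure_in K V \<longleftrightarrow> (\<forall>v\<in>V. \<forall>q. q \<noteq> 0 \<longrightarrow> frag_cmul q v \<in> K \<longrightarrow> v \<in> K)"

lemma int_spanI: "Poly_Mapping.keys c \<subseteq> I \<Longrightarrow> v - frag_extend x c \<in> K \<Longrightarrow> v \<in> int_span K x I"
  by (auto simp: int_span_def)

lemma int_spanE:
  assumes "v \<in> int_span K x I"
  obtains c where "Poly_Mapping.keys c \<subseteq> I" "v - frag_extend x c \<in> K"
  using assms by (auto simp: int_span_def)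

lemma int_span_base: "v \<in> K \<Longrightarrow> v \<in> int_span K x I"
  by (rule int_spanI[of 0]) auto

lemma int_span_gen: "frag.subspace K \<Longrightarrow> i \<in> I \<Longrightarrow> x i \<in> int_span K x I"
  by (rule int_spanI[of "frag_of i"]) (auto simp: frag.subspace_0)

lemma subspace_int_span:
  assumes "frag.subspace K" shows "frag.subspace (int_span K x I)"
proof (rule frag_subspaceI)
  show "0 \<in> int_span K x I" by (rule int_span_base) (rule frag.subspace_0[OF assms])
  fix v w assume "v \<in> int_span K x I" "w \<in> int_span K x I"
  then obtain c d where c: "Poly_Mapping.keys c \<subseteq> I" "v - frag_extend x c \<in> K"
    and d: "Poly_Mapping.keys d \<subseteq> I" "w - frag_extend x d \<in> K" by (auto elim!: int_spanE)
  have "(v - frag_extend x c) - (w - frag_extend x d) \<in> K"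
    using assms c(2) d(2) by (rule frag.subspace_diff)
  then show "v - w \<in> int_span K x I"
    by (intro int_spanI[of "c - d"]) (use c d in \<open>auto simp: frag_extend_diff algebra_simps keys_subset_Un_diff\<close>)
qed

lemma int_span_minimal:
  assumes "frag.subspace W" "K \<subseteq> W" "\<And>i. i \<in> I \<Longrightarrow> x i \<in> W"
  shows "int_span K x I \<subseteq> W"
proof
  fix v assume "v \<in> int_span K x I"
  then obtain c where c: "Poly_Mapping.keys c \<subseteq> I" "v - frag_extend x c \<in> K" by (rule int_spanE)
  have "frag_extend x c \<in> W" using c assms by (intro frag_extend_mem) auto
  then have "(v - frag_extend x c) + frag_extend x c \<in> W"
    using c assms by (intro frag.subspace_add) auto
  then show "v \<in> W" by simp
qed

lemma int_span_empty [simp]: "int_span K x {} = K"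
  by (auto simp: int_span_def)

lemma int_span_insert:
  assumes "frag.subspace K" "v \<in> int_span K x (insert i I)"
  obtains z where "v - frag_cmul z (x i) \<in> int_span K x I"
proof -
  obtain c where c: "Poly_Mapping.keys c \<subseteq> insert i I" "v - frag_extend x c \<in> K"
    using assms(2) by (rule int_spanE)
  let ?z = "Poly_Mapping.lookup c i"
  let ?d = "c - frag_cmul ?z (frag_of i)"
  have "Poly_Mapping.keys ?d \<subseteq> I"
  proof
    fix j assume j: "j \<in> Poly_Mapping.keys ?d"
    then have "j \<noteq> i" by (auto simp: in_keys_iff lookup_minus)
    moreover from this j have "j \<in> Poly_Mapping.keys c" by (auto simp: in_keys_iff lookup_minus)
    ultimately show "j \<in> I" using c by auto
  qed
  then have "v - frag_cmul ?z (x i) \<in> int_span K x I"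
    by (rule int_spanI) (use c in \<open>simp add: frag_extend_diff frag_extend_cmul algebra_simps\<close>)
  then show ?thesis by (rule that)
qed

lemma int_span_cong: "(\<And>i. i \<in> I \<Longrightarrow> x i = y i) \<Longrightarrow> int_span K x I = int_span K y I"
  unfolding int_span_def using frag_extend_eq[of _ x y] by (auto simp: subset_iff)

text \<open>Euclid's algorithm on the coefficients of a relation: a relation with two nonzero coefficients
  is made smaller by adding \<open>\<plusminus> x i\<close> to \<open>x j\<close>, and a relation with one coefficient makes its generator
  redundant by purity.\<close>

lemma drop_dependent_generator:
  assumes K: "frag.subspace K" and fin: "finite I" and "pure_in K (int_span K x I)"
    and "Poly_Mapping.keys c \<subseteq> I" "c \<noteq> 0" "frag_extend x c \<in> K"
  shows "\<exists>y i. i \<in> I \<and> int_span K y (I - {i}) = int_span K x I"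
  using assms(3-6)
proof (induction "nat (\<Sum>i\<in>I. \<bar>Poly_Mapping.lookup c i\<bar>)" arbitrary: x c rule: less_induct)
  case less
  obtain i0 where i0: "i0 \<in> Poly_Mapping.keys c" using less.prems by fastforce
  show ?case
  proof (cases "Poly_Mapping.keys c = {i0}")
    case True
    then have "frag_extend x c = frag_cmul (Poly_Mapping.lookup c i0) (x i0)"
      by (simp add: frag_extend_def)
    moreover have "x i0 \<in> int_span K x I" using i0 less.prems K by (intro int_span_gen) auto
    ultimately have "x i0 \<in> K"
      using less.prems i0 unfolding pure_in_def by (auto simp: in_keys_iff)
    then have "x i \<in> int_span K x (I - {i0})" if "i \<in> I" for i
      using that K by (cases "i = i0") (auto intro: int_span_base int_span_gen)
    then have "int_span K x I \<subseteq> int_span K x (I - {i0})"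
      by (intro int_span_minimal subspace_int_span K) (auto intro: int_span_base)
    moreover have "int_span K x (I - {i0}) \<subseteq> int_span K x I"
      by (intro int_span_minimal subspace_int_span K) (auto intro: int_span_base int_span_gen K)
    ultimately show ?thesis using i0 less.prems by blast
  next
    case False
    then obtain j0 where j0: "j0 \<in> Poly_Mapping.keys c" "j0 \<noteq> i0" using i0 by blast
    obtain i j where ij: "i \<in> Poly_Mapping.keys c" "j \<in> Poly_Mapping.keys c" "i \<noteq> j"
      "\<bar>Poly_Mapping.lookup c j\<bar> \<le> \<bar>Poly_Mapping.lookup c i\<bar>"
    proof (cases "\<bar>Poly_Mapping.lookup c j0\<bar> \<le> \<bar>Poly_Mapping.lookup c i0\<bar>")
      case True
      then show ?thesis using that[of i0 j0] i0 j0 by auto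
    next
      case False
      then show ?thesis using that[of j0 i0] i0 j0 by auto
    qed
    define a b where "a = Poly_Mapping.lookup c i" and "b = Poly_Mapping.lookup c j"
    have ab: "a \<noteq> 0" "b \<noteq> 0" "\<bar>b\<bar> \<le> \<bar>a\<bar>" using ij by (auto simp: a_def b_def in_keys_iff)
    \<comment> \<open>With this sign \<open>s * b\<close> has the sign of \<open>a\<close>, and
      \<open>0 < \<bar>b\<bar> \<le> \<bar>a\<bar>\<close> makes the subtraction shrink the
      coefficient \<open>a\<close>.\<close>
    define s where "s = sgn a * sgn b"
    have dec: "\<bar>a - s * b\<bar> < \<bar>a\<bar>" using ab by (auto simp: s_def sgn_if)
    \<comment> \<open>The change of generators compensates the change of coefficients:
      \<open>a x i + b x j = (a - s b) x i + b (x j + s x i)\<close>. The coefficient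
      \<open>b\<close> at \<open>j\<close> survives, so the new relation is still
      nontrivial.\<close>
    define y where "y = x(j := x j + frag_cmul s (x i))"
    define d where "d = c - frag_cmul (s * b) (frag_of i)"
    have I: "i \<in> I" "j \<in> I" using ij less.prems by auto
    have span: "int_span K y I = int_span K x I"
    proof
      have "y k \<in> int_span K x I" if "k \<in> I" for k
        using that K I unfolding y_def
        by (auto intro!: int_span_gen frag.subspace_add frag.subspace_scale subspace_int_span)
      then show "int_span K y I \<subseteq> int_span K x I"
        by (intro int_span_minimal subspace_int_span K) (auto intro: int_span_base)
      have y: "y k \<in> int_span K y I" if "k \<in> I" for k
        using that K by (auto intro: int_span_gen)
      have "y j - frag_cmul s (y i) \<in> int_span K y I"
        using K I y by (intro frag.subspace_diff frag.subspace_scale subspace_int_span) auto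
      then have "x k \<in> int_span K y I" if "k \<in> I" for k
        using y[OF that] ij by (cases "k = j") (auto simp: y_def)
      then show "int_span K x I \<subseteq> int_span K y I"
        by (intro int_span_minimal subspace_int_span K) (auto intro: int_span_base)
    qed
    have d_lookup: "Poly_Mapping.lookup d k = (if k = i then a - s * b else Poly_Mapping.lookup c k)" for k
      by (simp add: d_def lookup_minus a_def)
    have "(\<Sum>k\<in>I. \<bar>Poly_Mapping.lookup d k\<bar>) < (\<Sum>k\<in>I. \<bar>Poly_Mapping.lookup c k\<bar>)"
    proof (rule sum_strict_mono_ex1[OF fin])
      show "\<forall>k\<in>I. \<bar>Poly_Mapping.lookup d k\<bar> \<le> \<bar>Poly_Mapping.lookup c k\<bar>"
        using dec by (auto simp: d_lookup a_def)
      show "\<exists>k\<in>I. \<bar>Poly_Mapping.lookup d k\<bar> < \<bar>Poly_Mapping.lookup c k\<bar>"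
        using dec I by (intro bexI[of _ i]) (auto simp: d_lookup a_def)
    qed
    moreover have "0 \<le> (\<Sum>k\<in>I. \<bar>Poly_Mapping.lookup d k\<bar>)" by (rule sum_nonneg) simp
    ultimately have less': "nat (\<Sum>k\<in>I. \<bar>Poly_Mapping.lookup d k\<bar>) < nat (\<Sum>k\<in>I. \<bar>Poly_Mapping.lookup c k\<bar>)"
      by linarith
    have "frag_extend y d = frag_extend x c"
      unfolding y_def frag_extend_upd_add
      using ij by (simp add: d_def b_def frag_extend_diff frag_extend_cmul lookup_minus mult.commute)
    moreover have "Poly_Mapping.keys d \<subseteq> I" unfolding d_def
      using less.prems I keys_cmul by (intro keys_subset_Un_diff) fastforce+
    moreover have "d \<noteq> 0" using d_lookup[of j] ij by (auto simp: in_keys_iff)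
    ultimately show ?thesis using less.hyps[OF less', of y] less.prems by (simp add: span)
  qed
qed

lemma exists_int_basis:
  assumes K: "frag.subspace K" and "finite I" "pure_in K (int_span K x I)"
  shows "\<exists>y J. J \<subseteq> I \<and> int_span K y J = int_span K x I \<and> int_indep K y J"
  using assms(2,3)
proof (induction "card I" arbitrary: I x rule: less_induct)
  case less
  show ?case
  proof (cases "int_indep K x I")
    case False
    then obtain c where "Poly_Mapping.keys c \<subseteq> I" "c \<noteq> 0" "frag_extend x c \<in> K"
      by (auto simp: int_indep_def)
    then obtain y i where i: "i \<in> I" "int_span K y (I - {i}) = int_span K x I"
      using drop_dependent_generator[OF K less.prems] by blast
    then show ?thesis
      using less.hyps[of "I - {i}" y] less.prems by (metis Diff_subset card_Diff1_less finite_Diff order_trans)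
  qed auto
qed

text \<open>Subgroups of finitely generated abelian groups are finitely generated, with no more
  generators. The new generators are those of the part without \<open>x i\<close>, together with one
  element whose coefficient at \<open>x i\<close> generates the ideal of all such
  coefficients.\<close>

lemma finitely_generated_subspace:
  assumes K: "frag.subspace K" and "finite I" and "frag.subspace W" "K \<subseteq> W" "W \<subseteq> int_span K x I"
  shows "\<exists>y. int_span K y I = W"
  using assms(2-5)
proof (induction I arbitrary: W rule: finite_induct)
  case empty
  then show ?case by auto
next
  case (insert i I)
  let ?V = "int_span K x I"
  have V: "frag.subspace ?V" by (rule subspace_int_span[OF K])
  obtain y where y: "int_span K y I = W \<inter> ?V"
    using insert.IH[of "W \<inter> ?V"] insert.prems V
    by (auto simp: frag.subspace_inter int_span_base subset_iff)
  \<comment> \<open>The ideal of integers that can occur as coefficient of \<open>x i\<close> in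
    elements of \<open>W\<close>; below it is shown to be principal, by division with remainder by
    its least positive element.\<close>
  define D where "D = {z. \<exists>w\<in>W. w - frag_cmul z (x i) \<in> ?V}"
  have D_diff: "a - b \<in> D" if ab: "a \<in> D" "b \<in> D" for a b
  proof -
    obtain v w where vw: "v \<in> W" "v - frag_cmul a (x i) \<in> ?V" "w \<in> W" "w - frag_cmul b (x i) \<in> ?V"
      using ab by (auto simp: D_def)
    have "(v - frag_cmul a (x i)) - (w - frag_cmul b (x i)) \<in> ?V"
      by (rule frag.subspace_diff[OF V vw(2) vw(4)])
    then have "(v - w) - frag_cmul (a - b) (x i) \<in> ?V" by (simp add: frag_cmul_diff_distrib algebra_simps)
    then show ?thesis using vw insert.prems by (auto simp: D_def intro: frag.subspace_diff)
  qed
  have D0: "0 \<in> D" using insert.prems V by (auto simp: D_def frag.subspace_0 intro!: bexI[of _ 0])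
  have D_mult: "k * a \<in> D" if a: "a \<in> D" for k a
  proof -
    obtain w where "w \<in> W" "w - frag_cmul a (x i) \<in> ?V" using a by (auto simp: D_def)
    then have "frag_cmul k w \<in> W" "frag_cmul k (w - frag_cmul a (x i)) \<in> ?V"
      using insert.prems V by (auto intro: frag.subspace_scale)
    then show ?thesis by (auto simp: D_def frag.scale_right_diff_distrib)
  qed
  obtain g where g: "g \<in> D" "\<And>a. a \<in> D \<Longrightarrow> g dvd a"
  proof (cases "D = {0}")
    case True
    then show ?thesis using that[of 0] by auto
  next
    case False
    then obtain a where "a \<in> D" "a \<noteq> 0" using D0 by blast
    then have ex: "\<exists>n::nat. n > 0 \<and> int n \<in> D"
      using D_diff[OF D0] by (intro exI[of _ "nat \<bar>a\<bar>"]) (auto simp: abs_if)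
    define n where "n = (LEAST n::nat. n > 0 \<and> int n \<in> D)"
    have n: "n > 0" "int n \<in> D" unfolding n_def using LeastI_ex[OF ex] by auto
    have "int n dvd a" if a: "a \<in> D" for a
    proof -
      have "a mod int n = a - (a div int n) * int n" by (simp add: minus_div_mult_eq_mod)
      then have "a mod int n \<in> D" using D_diff[OF a D_mult[OF n(2), of "a div int n"]] by simp
      moreover have "0 \<le> a mod int n" "a mod int n < int n" using n by auto
      ultimately have "\<not> nat (a mod int n) > 0"
        using not_less_Least[of "nat (a mod int n)" "\<lambda>n::nat. n > 0 \<and> int n \<in> D"] unfolding n_def[symmetric]
        by (auto simp: nat_less_iff)
      then show ?thesis using \<open>0 \<le> a mod int n\<close> by (auto simp: dvd_eq_mod_eq_0)
    qed
    then show ?thesis using that n by blast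
  qed
  \<comment> \<open>This lift of the generator of the ideal becomes the new generator; subtracting a
    multiple of it moves any element of \<open>W\<close> into \<open>W \<inter> ?V\<close>.\<close>
  obtain w where w: "w \<in> W" "w - frag_cmul g (x i) \<in> ?V" using g by (auto simp: D_def)
  define y' where "y' = y(i := w)"
  have yI: "int_span K y' I = W \<inter> ?V"
    unfolding y[symmetric] y'_def by (rule int_span_cong) (use insert.hyps in auto)
  have sub: "int_span K y' I \<subseteq> int_span K y' (insert i I)"
    by (intro int_span_minimal subspace_int_span K) (auto intro: int_span_base int_span_gen K)
  have "int_span K y' (insert i I) = W"
  proof
    have "y' j \<in> W" if "j \<in> insert i I" for j
    proof (cases "j = i")
      case False
      then have "y' j \<in> int_span K y' I" using that K by (auto intro: int_span_gen)
      then show ?thesis using yI by auto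
    qed (simp add: y'_def w)
    then show "int_span K y' (insert i I) \<subseteq> W" using insert.prems by (intro int_span_minimal) auto
    show "W \<subseteq> int_span K y' (insert i I)"
    proof
      fix v assume v: "v \<in> W"
      then have "v \<in> int_span K x (insert i I)" using insert.prems by blast
      then obtain z where z: "v - frag_cmul z (x i) \<in> ?V" by (rule int_span_insert[OF K])
      then have "z \<in> D" using v by (auto simp: D_def)
      then have "z = z div g * g" using g(2)[of z] by simp
      then obtain k where k: "z = k * g" by blast
      have "(v - frag_cmul z (x i)) - frag_cmul k (w - frag_cmul g (x i)) \<in> ?V"
        by (intro frag.subspace_diff[OF V z] frag.subspace_scale[OF V w(2)])
      then have "v - frag_cmul k w \<in> ?V" by (simp add: k frag.scale_right_diff_distrib)
      then have "v - frag_cmul k w \<in> W \<inter> ?V"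
        using v w insert.prems by (auto intro: frag.subspace_diff frag.subspace_scale)
      then have "v - frag_cmul k (y' i) \<in> int_span K y' (insert i I)"
        using sub yI by (auto simp: y'_def)
      moreover have "frag_cmul k (y' i) \<in> int_span K y' (insert i I)"
        using K by (intro frag.subspace_scale subspace_int_span int_span_gen) auto
      ultimately have "(v - frag_cmul k (y' i)) + frag_cmul k (y' i) \<in> int_span K y' (insert i I)"
        using K by (intro frag.subspace_add subspace_int_span) auto
      then show "v \<in> int_span K y' (insert i I)" by simp
    qed
  qed
  then show ?case by blast
qed

lemma int_span_mono: "K \<subseteq> L \<Longrightarrow> I \<subseteq> J \<Longrightarrow> int_span K x I \<subseteq> int_span L x J"
  unfolding int_span_def by blast

lemma int_span_Un:
  assumes K: "frag.subspace K"
  shows "int_span (int_span K x I) x J = int_span K x (I \<union> J)"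
proof
  have "int_span K x I \<subseteq> int_span K x (I \<union> J)" by (rule int_span_mono) auto
  then show "int_span (int_span K x I) x J \<subseteq> int_span K x (I \<union> J)"
    by (intro int_span_minimal subspace_int_span K int_span_gen) (auto intro: int_span_base)
  have "x i \<in> int_span (int_span K x I) x J" if "i \<in> I \<union> J" for i
    using that K by (auto intro: int_span_base int_span_gen subspace_int_span)
  then show "int_span K x (I \<union> J) \<subseteq> int_span (int_span K x I) x J"
    by (intro int_span_minimal subspace_int_span K) (auto intro: int_span_base)
qed

text \<open>In a relation over \<open>I \<union> J\<close> the \<open>J\<close> part lies in the
  span of \<open>I\<close>, hence is trivial, and then so is the \<open>I\<close> part. This extends
  a basis across a free quotient, both in Pontryagin's chain and in
  \<open>tensor_basis_coefficients_trivial\<close>.\<close>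

lemma int_indep_Un:
  assumes K: "frag.subspace K" and I: "int_indep K x I" and J: "int_indep (int_span K x I) x J"
  shows "int_indep K x (I \<union> J)"
  unfolding int_indep_def
proof (intro allI impI)
  fix c assume c: "Poly_Mapping.keys c \<subseteq> I \<union> J" "frag_extend x c \<in> K"
  obtain d e where de: "Poly_Mapping.keys d \<subseteq> I" "Poly_Mapping.keys e \<subseteq> J" "d + e = c"
    using c(1) by (rule frag_split)
  have ext: "frag_extend x c = frag_extend x d + frag_extend x e"
    by (simp flip: de(3) add: frag_extend_add)
  have "Poly_Mapping.keys (- d) \<subseteq> I" using de(1) by simp
  moreover have "frag_extend x e - frag_extend x (- d) \<in> K"
    using c(2) ext by (simp add: frag_extend_minus add.commute)
  ultimately have "frag_extend x e \<in> int_span K x I" by (rule int_spanI)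
  then have "e = 0" using J de by (auto simp: int_indep_def)
  then show "c = 0" using I c de by (auto simp: int_indep_def)
qed

text \<open>Together with \<open>int_indep_reindex\<close> this renames indices, so that bases from
  different stages can be merged into one family over disjoint index sets.\<close>

lemma int_span_reindex:
  assumes K: "frag.subspace K"
  shows "int_span K x (f ` I) = int_span K (\<lambda>i. x (f i)) I"
proof
  show "int_span K (\<lambda>i. x (f i)) I \<subseteq> int_span K x (f ` I)"
    using K by (intro int_span_minimal subspace_int_span) (auto intro: int_span_base int_span_gen)
  have "x (f i) \<in> int_span K (\<lambda>i. x (f i)) I" if "i \<in> I" for i
    using int_span_gen[OF K that, of "\<lambda>i. x (f i)"] .
  then show "int_span K x (f ` I) \<subseteq> int_span K (\<lambda>i. x (f i)) I"
    using K by (intro int_span_minimal subspace_int_span) (auto intro: int_span_base)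
qed

lemma int_indep_reindex:
  assumes f: "inj_on f I" and I: "int_indep K (\<lambda>i. x (f i)) I"
  shows "int_indep K x (f ` I)"
  unfolding int_indep_def
proof (intro allI impI)
  fix c assume c: "Poly_Mapping.keys c \<subseteq> f ` I" "frag_extend x c \<in> K"
  define d where "d = frag_extend (frag_of \<circ> inv_into I f) c"
  have d: "Poly_Mapping.keys d \<subseteq> I"
    using keys_frag_extend[of "frag_of \<circ> inv_into I f" c] c(1) by (fastforce simp: d_def inv_into_into)
  have "frag_extend (frag_of \<circ> f) d = frag_extend ((frag_of \<circ> f) \<circ> inv_into I f) c"
    unfolding d_def by (rule frag_extend_compose)
  also have "\<dots> = frag_extend frag_of c"
    using c(1) by (intro frag_extend_eq) (auto simp: f_inv_into_f)
  finally have cd: "c = frag_extend (frag_of \<circ> f) d" by (simp flip: frag_expansion)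
  then have "frag_extend (\<lambda>i. x (f i)) d = frag_extend x c"
    using frag_extend_compose[of x f d] by (simp add: comp_def)
  then have "d = 0" using I c d by (auto simp: int_indep_def)
  then show "c = 0" using cd by simp
qed

section \<open>Coordinates with respect to a basis modulo a subgroup\<close>

definition int_coord :: "('a \<Rightarrow>\<^sub>0 int) set \<Rightarrow> ('i \<Rightarrow> 'a \<Rightarrow>\<^sub>0 int) \<Rightarrow> 'i set \<Rightarrow> ('a \<Rightarrow>\<^sub>0 int) \<Rightarrow> 'i \<Rightarrow>\<^sub>0 int" where
  "int_coord K x I v = (SOME c. Poly_Mapping.keys c \<subseteq> I \<and> v - frag_extend x c \<in> K)"

lemma int_coord:
  assumes "v \<in> int_span K x I"
  shows "Poly_Mapping.keys (int_coord K x I v) \<subseteq> I" "v - frag_extend x (int_coord K x I v) \<in> K"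
  using someI_ex[of "\<lambda>c. Poly_Mapping.keys c \<subseteq> I \<and> v - frag_extend x c \<in> K"] assms
  unfolding int_coord_def int_span_def by auto

lemma int_coord_eq:
  assumes K: "frag.subspace K" and I: "int_indep K x I"
    and c: "Poly_Mapping.keys c \<subseteq> I" "v - frag_extend x c \<in> K"
  shows "int_coord K x I v = c"
proof -
  let ?d = "int_coord K x I v"
  have "v \<in> int_span K x I" using c by (rule int_spanI)
  note d = int_coord[OF this]
  have "(v - frag_extend x c) - (v - frag_extend x ?d) \<in> K"
    using K c(2) d(2) by (rule frag.subspace_diff)
  then have "frag_extend x (?d - c) \<in> K" by (simp add: frag_extend_diff)
  moreover have "Poly_Mapping.keys (?d - c) \<subseteq> I" using d c by (intro keys_subset_Un_diff)
  ultimately have "?d - c = 0" using I unfolding int_indep_def by blast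
  then show ?thesis by simp
qed

lemma int_coord_add:
  assumes K: "frag.subspace K" and I: "int_indep K x I"
    and v: "v \<in> int_span K x I" and w: "w \<in> int_span K x I"
  shows "int_coord K x I (v + w) = int_coord K x I v + int_coord K x I w"
proof (rule int_coord_eq[OF K I])
  let ?c = "int_coord K x I v" and ?d = "int_coord K x I w"
  show "Poly_Mapping.keys (?c + ?d) \<subseteq> I"
    using int_coord(1)[OF v] int_coord(1)[OF w] keys_add[of ?c ?d] by blast
  have "(v - frag_extend x ?c) + (w - frag_extend x ?d) \<in> K"
    using K int_coord(2)[OF v] int_coord(2)[OF w] by (rule frag.subspace_add)
  then show "v + w - frag_extend x (?c + ?d) \<in> K" by (simp add: frag_extend_add algebra_simps)
qed

lemma int_coord_mod:
  assumes K: "frag.subspace K" and I: "int_indep K x I"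
    and v: "v \<in> int_span K x I" and vw: "v - w \<in> K"
  shows "int_coord K x I w = int_coord K x I v"
proof (rule int_coord_eq[OF K I int_coord(1)[OF v]])
  let ?c = "int_coord K x I v"
  have "(v - frag_extend x ?c) - (v - w) \<in> K"
    using K int_coord(2)[OF v] vw by (rule frag.subspace_diff)
  then show "w - frag_extend x ?c \<in> K" by simp
qed

lemma int_coord_gen:
  assumes "frag.subspace K" "int_indep K x I" "i \<in> I"
  shows "int_coord K x I (x i) = frag_of i"
  using assms by (intro int_coord_eq) (auto simp: frag.subspace_0)

text \<open>Pontryagin's criterion: the pure closures of the first \<open>n\<close> generators form a chain in which
  each step is finitely generated and torsion-free, so a basis of one extends to the next.\<close>

lemma Pontryagin_criterion:
  assumes K: "frag.subspace K" and V: "frag.subspace V" and KV: "K \<subseteq> V" and pure: "pure_in K V"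
    and h: "\<And>n::nat. h n \<in> V" and gen: "V \<subseteq> int_span K h UNIV"
    and fg: "\<And>n. \<exists>x (I :: 'i set). finite I \<and>
      {v \<in> V. \<exists>q. q \<noteq> 0 \<and> frag_cmul q v \<in> int_span K h {..<n}} \<subseteq> int_span K x I"
  shows "\<exists>b (I :: (nat \<times> 'i) set). int_span K b I = V \<and> int_indep K b I"
proof -
  \<comment> \<open>The pure closure in \<open>V\<close> of the first \<open>n\<close> generators
    \<open>h 0, ..., h (n - 1)\<close>.\<close>
  define S where "S n = {v \<in> V. \<exists>q. q \<noteq> 0 \<and> frag_cmul q v \<in> int_span K h {..<n}}" for n
  have sub_span: "frag.subspace (int_span K h {..<n})" for n by (rule subspace_int_span[OF K])
  have subS: "frag.subspace (S n)" for n
  proof (rule frag_subspaceI)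
    show "0 \<in> S n" using frag.subspace_0[OF V] frag.subspace_0[OF sub_span]
      by (auto simp: S_def intro!: exI[of _ 1])
    fix v w assume "v \<in> S n" "w \<in> S n"
    then obtain q r where v: "v \<in> V" "q \<noteq> 0" "frag_cmul q v \<in> int_span K h {..<n}"
      and w: "w \<in> V" "r \<noteq> 0" "frag_cmul r w \<in> int_span K h {..<n}" by (auto simp: S_def)
    have "frag_cmul r (frag_cmul q v) - frag_cmul q (frag_cmul r w) \<in> int_span K h {..<n}"
      by (intro frag.subspace_diff[OF sub_span] frag.subspace_scale[OF sub_span] v w)
    then have "frag_cmul (q * r) (v - w) \<in> int_span K h {..<n}"
      by (simp add: frag.scale_right_diff_distrib mult.commute)
    moreover have "v - w \<in> V" by (rule frag.subspace_diff[OF V v(1) w(1)])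
    ultimately show "v - w \<in> S n"
      using v(2) w(2) by (auto simp: S_def intro!: exI[of _ "q * r"])
  qed
  \<comment> \<open>The chain starts at \<open>K\<close> itself because \<open>K\<close> is pure in
    \<open>V\<close>; hence the empty family is a basis of the first stage.\<close>
  have S0: "S 0 = K"
  proof
    show "S 0 \<subseteq> K" using pure by (auto simp: S_def pure_in_def)
    show "K \<subseteq> S 0" using KV by (auto simp: S_def intro!: exI[of _ 1])
  qed
  have SV: "S n \<subseteq> V" for n by (auto simp: S_def)
  have S_Suc: "S n \<subseteq> S (Suc n)" for n
    using int_span_mono[of K K "{..<n}" "{..<Suc n}" h] by (auto simp: S_def)
  have KS: "K \<subseteq> S n" for n
    using S0 lift_Suc_mono_le[of S 0 n, OF S_Suc] by simp
  have pureS: "pure_in (S n) W" if "W \<subseteq> V" for n W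
    unfolding pure_in_def
  proof (intro ballI allI impI)
    fix v q assume v: "v \<in> W" and q: "q \<noteq> 0" and "frag_cmul q v \<in> S n"
    then obtain r where "r \<noteq> 0" "frag_cmul r (frag_cmul q v) \<in> int_span K h {..<n}" by (auto simp: S_def)
    then show "v \<in> S n" using v q that by (auto simp: S_def intro!: exI[of _ "r * q"])
  qed
  \<comment> \<open>One step of the chain: \<open>S (Suc n)\<close> is finitely generated over
    \<open>S n\<close>, being inside a finitely generated group, and torsion-free over it, since
    \<open>S n\<close> is pure. So it has a finite basis modulo \<open>S n\<close>.\<close>
  have "\<exists>p :: _ \<times> 'i set. int_span (S n) (fst p) (snd p) = S (Suc n) \<and>
      int_indep (S n) (fst p) (snd p)" for n
  proof -
    obtain x and I :: "'i set" where I: "finite I" "S (Suc n) \<subseteq> int_span K x I"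
      using fg[of "Suc n"] unfolding S_def by blast
    have "S (Suc n) \<subseteq> int_span (S n) x I" using I int_span_mono[OF KS, of I I] by blast
    then obtain y where y: "int_span (S n) y I = S (Suc n)"
      using finitely_generated_subspace[OF subS I(1) subS S_Suc] by blast
    have "pure_in (S n) (int_span (S n) y I)" unfolding y by (rule pureS[OF SV])
    from exists_int_basis[OF subS I(1) this]
    obtain z and J :: "'i set" where "int_span (S n) z J = S (Suc n)" "int_indep (S n) z J" by (auto simp: y)
    then show ?thesis by (intro exI[of _ "(z, J)"]) simp
  qed
  then have "\<forall>n. \<exists>p :: _ \<times> 'i set. int_span (S n) (fst p) (snd p) = S (Suc n) \<and>
      int_indep (S n) (fst p) (snd p)" by blast
  from choice[OF this] obtain f where f: "\<And>n. int_span (S n) (fst (f n)) (snd (f n)) = S (Suc n) \<and>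
      int_indep (S n) (fst (f n)) (snd (f n) :: 'i set)" by blast
  define y J where "y n = fst (f n)" and "J n = snd (f n)" for n
  have y: "int_span (S n) (y n) (J n) = S (Suc n)" and J: "int_indep (S n) (y n) (J n)" for n
    using f by (auto simp: y_def J_def)
  \<comment> \<open>Tagging each index with its stage keeps the bases of different steps disjoint,
    although all of them are indexed by the same type.\<close>
  define b where "b = (\<lambda>(n, i). y n i)"
  define I where "I n = Sigma {..<n} J" for n :: nat
  have I_Suc: "I (Suc n) = I n \<union> Pair n ` J n" for n
    by (auto simp: I_def less_Suc_eq)
  have basis: "int_span K b (I n) = S n \<and> int_indep K b (I n)" for n
  proof (induction n)
    case 0
    have "I 0 = {}" by (auto simp: I_def)
    then show ?case by (simp add: S0 int_indep_def)
  next
    case (Suc n)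
    have "int_span (S n) b (Pair n ` J n) = S (Suc n)"
      by (simp add: int_span_reindex[OF subS] b_def y)
    moreover have "int_indep (S n) b (Pair n ` J n)"
      by (rule int_indep_reindex) (auto simp: inj_on_def b_def J)
    ultimately show ?case
      using Suc int_span_Un[OF K, of b "I n" "Pair n ` J n"] int_indep_Un[OF K, of b "I n" "Pair n ` J n"]
      by (simp add: I_Suc)
  qed
  define B where "B = Sigma UNIV J"
  \<comment> \<open>A combination has finite support, so it involves finitely many stages; this
    passes independence from the stages to the union.\<close>
  have bounded: "\<exists>n. Poly_Mapping.keys c \<subseteq> I n" if "Poly_Mapping.keys c \<subseteq> B" for c
  proof -
    obtain n where "\<forall>k\<in>fst ` Poly_Mapping.keys c. k < n"
      using finite_nat_set_iff_bounded[of "fst ` Poly_Mapping.keys c"] by auto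
    then show ?thesis using that by (intro exI[of _ n]) (force simp: I_def B_def)
  qed
  have "int_indep K b B"
    unfolding int_indep_def
  proof (intro allI impI)
    fix c assume c: "Poly_Mapping.keys c \<subseteq> B" "frag_extend b c \<in> K"
    obtain n where "Poly_Mapping.keys c \<subseteq> I n" using bounded[OF c(1)] by blast
    then show "c = 0" using basis[of n] c(2) unfolding int_indep_def by blast
  qed
  moreover have "int_span K b B = V"
  proof
    have "b p \<in> V" if "p \<in> B" for p
    proof -
      obtain n i where p: "p = (n, i)" by (cases p)
      have "p \<in> I (Suc n)" using that by (auto simp: p I_def B_def)
      then have "b p \<in> int_span K b (I (Suc n))" by (rule int_span_gen[OF K])
      then have "b p \<in> S (Suc n)" using basis[of "Suc n"] by simp
      then show ?thesis using SV by blast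
    qed
    then show "int_span K b B \<subseteq> V" by (intro int_span_minimal V KV)
    show "V \<subseteq> int_span K b B"
    proof
      fix v assume v: "v \<in> V"
      then obtain c where c: "v - frag_extend h c \<in> K" using gen by (auto elim!: int_spanE)
      obtain n where "\<forall>k\<in>Poly_Mapping.keys c. k < n"
        using finite_nat_set_iff_bounded[of "Poly_Mapping.keys c"] by auto
      then have "v \<in> int_span K h {..<n}" using c by (intro int_spanI[of c]) auto
      then have "v \<in> S n" using v by (auto simp: S_def intro!: exI[of _ 1])
      then have "v \<in> int_span K b (I n)" using basis by blast
      then show "v \<in> int_span K b B"
        using int_span_mono[OF order_refl, of "I n" B K b] by (auto simp: I_def B_def)
    qed
  qed
  ultimately show ?thesis by blast
qed

section \<open>Evaluating formal combinations in an abelian group\<close>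

text \<open>The homomorphism given by the universal property of the free abelian group. For
  \<open>f = id\<close> it evaluates a formal combination of group elements and presents
  \<open>G\<close> as a quotient of the free group on its carrier.\<close>

definition frag_eval :: "('a, 'x) monoid_scheme \<Rightarrow> ('c \<Rightarrow> 'a) \<Rightarrow> ('c \<Rightarrow>\<^sub>0 int) \<Rightarrow> 'a" where
  "frag_eval G f w = (\<Otimes>\<^bsub>G\<^esub>x\<in>Poly_Mapping.keys w. f x [^]\<^bsub>G\<^esub> Poly_Mapping.lookup w x)"

lemma (in group) rcos_eq_iff:
  assumes H: "subgroup H G" and xy: "x \<in> carrier G" "y \<in> carrier G"
  shows "H #> x = H #> y \<longleftrightarrow> x \<otimes> inv y \<in> H"
proof
  have sub: "H \<subseteq> carrier G" using H by (rule subgroup.subset)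
  show "x \<otimes> inv y \<in> H" if "H #> x = H #> y"
    using coset_mult_inv2[OF that xy sub] xy H by (auto intro: coset_join1)
  show "H #> x = H #> y" if "x \<otimes> inv y \<in> H"
    using coset_join2[OF _ H that] xy sub by (intro coset_mult_inv1) auto
qed

context comm_group
begin

lemma frag_eval_superset:
  assumes "finite A" "Poly_Mapping.keys w \<subseteq> A" "f ` A \<subseteq> carrier G"
  shows "frag_eval G f w = (\<Otimes>x\<in>A. f x [^] Poly_Mapping.lookup w x)"
  unfolding frag_eval_def
  using assms by (intro finprod_mono_neutral_cong_left) (auto simp: in_keys_iff)

lemma frag_eval_closed:
  "f ` S \<subseteq> carrier G \<Longrightarrow> Poly_Mapping.keys w \<subseteq> S \<Longrightarrow> frag_eval G f w \<in> carrier G"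
  unfolding frag_eval_def by (intro finprod_closed) auto

lemma frag_eval_add:
  assumes f: "f ` S \<subseteq> carrier G" and v: "Poly_Mapping.keys v \<subseteq> S" and w: "Poly_Mapping.keys w \<subseteq> S"
  shows "frag_eval G f (v + w) = frag_eval G f v \<otimes> frag_eval G f w"
proof -
  let ?A = "Poly_Mapping.keys v \<union> Poly_Mapping.keys w"
  have A: "f ` ?A \<subseteq> carrier G" using assms by auto
  have "frag_eval G f (v + w) = (\<Otimes>x\<in>?A. f x [^] Poly_Mapping.lookup (v + w) x)"
    using A keys_add[of v w] by (intro frag_eval_superset) auto
  also have "\<dots> = (\<Otimes>x\<in>?A. f x [^] Poly_Mapping.lookup v x \<otimes> f x [^] Poly_Mapping.lookup w x)"
    using A by (intro finprod_cong') (auto simp: Poly_Mapping.lookup_add int_pow_mult)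
  also have "\<dots> = (\<Otimes>x\<in>?A. f x [^] Poly_Mapping.lookup v x) \<otimes> (\<Otimes>x\<in>?A. f x [^] Poly_Mapping.lookup w x)"
    using A by (intro finprod_multf) auto
  also have "(\<Otimes>x\<in>?A. f x [^] Poly_Mapping.lookup v x) = frag_eval G f v"
    using A by (intro frag_eval_superset[symmetric]) auto
  also have "(\<Otimes>x\<in>?A. f x [^] Poly_Mapping.lookup w x) = frag_eval G f w"
    using A by (intro frag_eval_superset[symmetric]) auto
  finally show ?thesis .
qed

lemma frag_eval_hom:
  assumes "f ` S \<subseteq> carrier G"
  shows "frag_eval G f \<in> hom (free_Abelian_group S) G"
  using assms by (intro homI) (auto intro: frag_eval_closed frag_eval_add)

lemma frag_eval_group_hom:
  "f ` S \<subseteq> carrier G \<Longrightarrow> group_hom (free_Abelian_group S) G (frag_eval G f)"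
  by (simp add: group_hom_def group_hom_axioms_def is_group frag_eval_hom)

lemma frag_eval_0 [simp]: "frag_eval G f 0 = \<one>"
  by (simp add: frag_eval_def)

lemma frag_eval_of [simp]: "f x \<in> carrier G \<Longrightarrow> frag_eval G f (frag_of x) = f x"
  by (simp add: frag_eval_def finprod_singleton)

lemma frag_eval_diff:
  assumes f: "f ` S \<subseteq> carrier G" and v: "Poly_Mapping.keys v \<subseteq> S" and w: "Poly_Mapping.keys w \<subseteq> S"
  shows "frag_eval G f (v - w) = frag_eval G f v \<otimes> inv frag_eval G f w"
proof -
  have "frag_eval G f v = frag_eval G f (v - w) \<otimes> frag_eval G f w"
    using frag_eval_add[OF f _ w, of "v - w"] keys_subset_Un_diff[OF v w] by simp
  then show ?thesis
    using frag_eval_closed[OF f] v w keys_subset_Un_diff[OF v w] by (simp add: m_assoc)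
qed

lemma frag_eval_cmul:
  assumes f: "f ` S \<subseteq> carrier G" and w: "Poly_Mapping.keys w \<subseteq> S"
  shows "frag_eval G f (frag_cmul n w) = frag_eval G f w [^] n"
proof -
  interpret h: group_hom "free_Abelian_group S" G "frag_eval G f"
    by (rule frag_eval_group_hom[OF f])
  show ?thesis using h.hom_int_pow[of w n] w by simp
qed

lemma frag_eval_frag_extend:
  assumes f: "f ` S \<subseteq> carrier G" and c: "Poly_Mapping.keys c \<subseteq> I"
    and x: "\<And>i. i \<in> I \<Longrightarrow> Poly_Mapping.keys (x i) \<subseteq> S"
  shows "frag_eval G f (frag_extend x c) = frag_eval G (\<lambda>i. frag_eval G f (x i)) c"
proof -
  have keys: "Poly_Mapping.keys (frag_extend x v) \<subseteq> S" if "Poly_Mapping.keys v \<subseteq> I" for v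
    using that x keys_frag_extend[of x v] by blast
  have g: "(\<lambda>i. frag_eval G f (x i)) ` I \<subseteq> carrier G"
    using x frag_eval_closed[OF f] by auto
  show ?thesis using c
  proof (induction c rule: free_Abelian_group_induct [consumes 1, case_names zero diff of])
    case (diff v w)
    then show ?case
      using keys f g by (simp add: frag_extend_diff frag_eval_diff[where S = S] frag_eval_diff[where S = I])
  next
    case (of i)
    then show ?case using frag_eval_closed[OF f x] by simp
  qed simp
qed

text \<open>A map that is additive only modulo \<open>R\<close> respects integer combinations modulo
  \<open>R\<close>. With \<open>R\<close> the tensor relations and \<open>\<Phi>\<close> sending an
  element to its pair with a fixed element of the other factor, this gives the linearity of tensors
  over the integers in each argument.\<close>

lemma additive_frag_eval:
  assumes R: "frag.subspace R"
    and add: "\<And>a b. a \<in> carrier G \<Longrightarrow> b \<in> carrier G \<Longrightarrow> \<Phi> (a \<otimes> b) - \<Phi> a - \<Phi> b \<in> R"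
    and f: "f ` S \<subseteq> carrier G" and c: "Poly_Mapping.keys c \<subseteq> S"
  shows "\<Phi> (frag_eval G f c) - frag_extend (\<lambda>i. \<Phi> (f i)) c \<in> R"
  using c
proof (induction c rule: free_Abelian_group_induct [consumes 1, case_names zero diff of])
  case zero
  \<comment> \<open>Additivity at the unit: the difference in parentheses equals
    \<open>- \<Phi> \<one>\<close> because \<open>\<one> \<otimes> \<one> = \<one>\<close>.\<close>
  have "- (\<Phi> (\<one> \<otimes> \<one>) - \<Phi> \<one> - \<Phi> \<one>) \<in> R" by (intro frag.subspace_neg[OF R] add) auto
  then show ?case by simp
next
  case (diff v w)
  let ?a = "frag_eval G f v" and ?b = "frag_eval G f w" and ?E = "frag_extend (\<lambda>i. \<Phi> (f i))"
  let ?d = "frag_eval G f (v - w)"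
  have ab: "?a \<in> carrier G" "?b \<in> carrier G" using diff frag_eval_closed[OF f] by auto
  have d: "?d = ?a \<otimes> inv ?b" using diff frag_eval_diff[OF f] by simp
  then have "?d \<otimes> ?b = ?a" using ab by (simp add: m_assoc)
  then have 1: "\<Phi> ?a - \<Phi> ?d - \<Phi> ?b \<in> R" using add[of ?d ?b] ab d by simp
  have "(\<Phi> ?a - ?E v) - (\<Phi> ?b - ?E w) \<in> R" by (rule frag.subspace_diff[OF R diff(3,4)])
  from frag.subspace_diff[OF R this 1]
  show ?case by (simp add: frag_extend_diff algebra_simps)
next
  case (of i)
  then have "f i \<in> carrier G" using f by auto
  then show ?case using frag.subspace_0[OF R] by simp
qed

section \<open>The torsion subgroup and its preimage in the free group\<close>

lemma subgroup_torsion: "subgroup (torsion_subgroup G) G"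
proof (rule subgroupI)
  show "torsion_subgroup G \<subseteq> carrier G" by (auto simp: torsion_subgroup_def)
  show "torsion_subgroup G \<noteq> {}" by (auto simp: torsion_subgroup_def intro!: exI[of _ \<one>] exI[of _ 1])
next
  fix a assume "a \<in> torsion_subgroup G"
  then show "inv a \<in> torsion_subgroup G"
    by (auto simp: torsion_subgroup_def nat_pow_inv)
next
  fix a b assume "a \<in> torsion_subgroup G" "b \<in> torsion_subgroup G"
  then obtain m n :: nat where ab: "a \<in> carrier G" "b \<in> carrier G"
    and mn: "m > 0" "n > 0" "a [^] m = \<one>" "b [^] n = \<one>" by (auto simp: torsion_subgroup_def)
  have "(a \<otimes> b) [^] (m * n) = (a [^] m) [^] n \<otimes> (b [^] n) [^] m"
    using ab by (simp add: nat_pow_distrib nat_pow_pow mult.commute)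
  then have "(a \<otimes> b) [^] (m * n) = \<one>" using mn by simp
  then show "a \<otimes> b \<in> torsion_subgroup G"
    using ab mn unfolding torsion_subgroup_def by (auto intro!: exI[of _ "m * n"])
qed

text \<open>The kernel of the map from the free group on \<open>carrier G\<close> onto
  \<open>G\<close> modulo torsion. It is the base subgroup \<open>K\<close> in all applications of
  the integer spans to groups.\<close>

definition torsion_frags :: "('a \<Rightarrow>\<^sub>0 int) set" where
  "torsion_frags = {w. Poly_Mapping.keys w \<subseteq> carrier G \<and> frag_eval G id w \<in> torsion_subgroup G}"

definition mod_torsion :: "('a \<Rightarrow>\<^sub>0 int) \<Rightarrow> 'a set" where
  "mod_torsion w = torsion_subgroup G #> frag_eval G id w"

lemma frag_eval_id_closed [simp]:
  "Poly_Mapping.keys w \<subseteq> carrier G \<Longrightarrow> frag_eval G id w \<in> carrier G"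
  by (rule frag_eval_closed) auto

lemma torsion_frags_keys: "torsion_frags \<subseteq> {w. Poly_Mapping.keys w \<subseteq> carrier G}"
  by (auto simp: torsion_frags_def)

lemma subspace_torsion_frags: "frag.subspace torsion_frags"
proof (rule frag_subspaceI)
  show "0 \<in> torsion_frags"
    using subgroup.one_closed[OF subgroup_torsion] by (simp add: torsion_frags_def)
  fix v w assume vw: "v \<in> torsion_frags" "w \<in> torsion_frags"
  then have "frag_eval G id (v - w) = frag_eval G id v \<otimes> inv frag_eval G id w"
    by (intro frag_eval_diff[where S = "carrier G"]) (auto simp: torsion_frags_def)
  then show "v - w \<in> torsion_frags"
    using vw subgroup.m_closed[OF subgroup_torsion] subgroup.m_inv_closed[OF subgroup_torsion]
    by (auto simp: torsion_frags_def dest: subsetD[OF keys_diff])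
qed

text \<open>This is torsion-freeness of the quotient by the torsion subgroup: if \<open>n\<close>
  kills the \<open>q\<close>-th power of an element, then \<open>\<bar>q\<bar> * n\<close> kills the
  element.\<close>

lemma pure_torsion_frags: "pure_in torsion_frags {w. Poly_Mapping.keys w \<subseteq> carrier G}"
  unfolding pure_in_def
proof (intro ballI allI impI)
  fix w :: "'a \<Rightarrow>\<^sub>0 int" and q :: int
  assume w: "w \<in> {w. Poly_Mapping.keys w \<subseteq> carrier G}" and q: "q \<noteq> 0"
    and qw: "frag_cmul q w \<in> torsion_frags"
  let ?m = "frag_eval G id w"
  have m: "?m \<in> carrier G" using w by simp
  have "?m [^] q \<in> torsion_subgroup G"
    using qw frag_eval_cmul[of id "carrier G" w q] w by (auto simp: torsion_frags_def)
  then obtain n :: nat where n: "n > 0" "(?m [^] q) [^] n = \<one>" by (auto simp: torsion_subgroup_def)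
  then have "?m [^] (q * int n) = \<one>" using m by (metis int_pow_int int_pow_pow)
  then have "?m [^] (\<bar>q\<bar> * int n) = \<one>"
    using int_pow_neg[OF m, of "q * int n"] by (auto simp: abs_if)
  then have "?m [^] nat (\<bar>q\<bar> * int n) = \<one>" by (simp flip: int_pow_int)
  moreover have "nat (\<bar>q\<bar> * int n) > 0" using q n by simp
  ultimately show "w \<in> torsion_frags"
    using w m unfolding torsion_frags_def torsion_subgroup_def by blast
qed

lemma mod_torsion_hom: "mod_torsion \<in> hom (free_Abelian_group (carrier G)) (G Mod torsion_subgroup G)"
proof -
  interpret T: normal "torsion_subgroup G" G by (rule subgroup_imp_normal[OF subgroup_torsion])
  have "(\<lambda>a. torsion_subgroup G #> a) \<circ> frag_eval G id
      \<in> hom (free_Abelian_group (carrier G)) (G Mod torsion_subgroup G)"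
    by (intro Group.hom_compose[OF frag_eval_hom T.r_coset_hom_Mod]) auto
  moreover have "(\<lambda>a. torsion_subgroup G #> a) \<circ> frag_eval G id = mod_torsion"
    by (simp add: mod_torsion_def fun_eq_iff)
  ultimately show ?thesis by simp
qed

lemma comm_group_mod_torsion: "comm_group (G Mod torsion_subgroup G)"
  by (rule abelian_FactGroup[OF subgroup_torsion])

lemma mod_torsion_surj:
  assumes "y \<in> carrier (G Mod torsion_subgroup G)"
  obtains a where "a \<in> carrier G" "mod_torsion (frag_of a) = y"
  using assms by (auto simp: FactGroup_def RCOSETS_def mod_torsion_def)

lemma mod_torsion_eq_iff:
  assumes v: "Poly_Mapping.keys v \<subseteq> carrier G" and w: "Poly_Mapping.keys w \<subseteq> carrier G"
  shows "mod_torsion v = mod_torsion w \<longleftrightarrow> v - w \<in> torsion_frags"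
proof -
  have "mod_torsion v = mod_torsion w \<longleftrightarrow> frag_eval G id v \<otimes> inv frag_eval G id w \<in> torsion_subgroup G"
    unfolding mod_torsion_def using v w by (intro rcos_eq_iff subgroup_torsion) auto
  also have "frag_eval G id v \<otimes> inv frag_eval G id w = frag_eval G id (v - w)"
    using v w by (intro frag_eval_diff[symmetric, where S = "carrier G"]) auto
  finally show ?thesis using keys_subset_Un_diff[OF v w] by (simp add: torsion_frags_def)
qed

lemma mod_torsion_0: "mod_torsion 0 = \<one>\<^bsub>G Mod torsion_subgroup G\<^esub>"
  using hom_one[OF mod_torsion_hom] comm_group_mod_torsion by (simp add: comm_group_def)

lemma mod_torsion_closed:
  "Poly_Mapping.keys w \<subseteq> carrier G \<Longrightarrow> mod_torsion w \<in> carrier (G Mod torsion_subgroup G)"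
  using hom_in_carrier[OF mod_torsion_hom] by simp

lemma mod_torsion_add:
  assumes "Poly_Mapping.keys v \<subseteq> carrier G" "Poly_Mapping.keys w \<subseteq> carrier G"
  shows "mod_torsion (v + w) = mod_torsion v \<otimes>\<^bsub>G Mod torsion_subgroup G\<^esub> mod_torsion w"
  using hom_mult[OF mod_torsion_hom, of v w] assms by simp

text \<open>Modulo \<open>torsion_frags\<close> each formal combination may be replaced by a single
  generator, namely its value. This passes between statements on elements of \<open>G\<close> and
  statements on combinations.\<close>

lemma frag_of_frag_eval:
  assumes "Poly_Mapping.keys w \<subseteq> carrier G"
  shows "w - frag_of (frag_eval G id w) \<in> torsion_frags"
proof -
  have "mod_torsion w = mod_torsion (frag_of (frag_eval G id w))"
    using assms by (simp add: mod_torsion_def)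
  then show ?thesis using assms by (subst (asm) mod_torsion_eq_iff) auto
qed

end

section \<open>Vanishing in tensor products\<close>

lemma subspace_tensor_relations:
  assumes "group A" "group B"
  shows "frag.subspace (tensor_relations A B)"
    and "tensor_relations A B \<subseteq> {w. Poly_Mapping.keys w \<subseteq> carrier A \<times> carrier B}"
proof -
  interpret R: subgroup "tensor_relations A B" "free_Abelian_group (carrier A \<times> carrier B)"
    by (rule subgroup_tensor_relations[OF assms])
  show keys: "tensor_relations A B \<subseteq> {w. Poly_Mapping.keys w \<subseteq> carrier A \<times> carrier B}"
  proof
    fix w assume "w \<in> tensor_relations A B"
    from R.mem_carrier[OF this] show "w \<in> {w. Poly_Mapping.keys w \<subseteq> carrier A \<times> carrier B}" by simp
  qed
  show "frag.subspace (tensor_relations A B)"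
  proof (rule frag_subspaceI)
    show "0 \<in> tensor_relations A B" using R.one_closed by simp
    fix v w assume vw: "v \<in> tensor_relations A B" "w \<in> tensor_relations A B"
    then have "Poly_Mapping.keys w \<subseteq> carrier A \<times> carrier B" using keys by blast
    from inv_free_Abelian_group[OF this] have "- w \<in> tensor_relations A B"
      using R.m_inv_closed[OF vw(2)] by simp
    then show "v - w \<in> tensor_relations A B" using R.m_closed[of v "- w"] vw by simp
  qed
qed

lemma tensor_add_left:
  assumes "a \<in> carrier A" "a' \<in> carrier A" "b \<in> carrier B"
  shows "frag_of (a \<otimes>\<^bsub>A\<^esub> a', b) - frag_of (a, b) - frag_of (a', b) \<in> tensor_relations A B"
  unfolding tensor_relations_def bilinearity_relators_def
  by (rule generate.incl) (use assms in blast)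

lemma tensor_add_right:
  assumes "a \<in> carrier A" "b \<in> carrier B" "b' \<in> carrier B"
  shows "frag_of (a, b \<otimes>\<^bsub>B\<^esub> b') - frag_of (a, b) - frag_of (a, b') \<in> tensor_relations A B"
  unfolding tensor_relations_def bilinearity_relators_def
  by (rule generate.incl) (use assms in blast)

lemma tensor_frag_eval_left:
  assumes A: "comm_group A" and B: "group B"
    and b: "b \<in> carrier B" and "f ` S \<subseteq> carrier A" "Poly_Mapping.keys c \<subseteq> S"
  shows "frag_of (frag_eval A f c, b) - frag_extend (\<lambda>i. frag_of (f i, b)) c \<in> tensor_relations A B"
proof -
  interpret A: comm_group A by fact
  show ?thesis
    by (rule A.additive_frag_eval[where \<Phi> = "\<lambda>a. frag_of (a, b)" and S = S])
      (use assms in \<open>simp_all add: subspace_tensor_relations(1) A.is_group tensor_add_left\<close>)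
qed

lemma tensor_frag_eval_right:
  assumes A: "group A" and B: "comm_group B"
    and a: "a \<in> carrier A" and "f ` S \<subseteq> carrier B" "Poly_Mapping.keys c \<subseteq> S"
  shows "frag_of (a, frag_eval B f c) - frag_extend (\<lambda>i. frag_of (a, f i)) c \<in> tensor_relations A B"
proof -
  interpret B: comm_group B by fact
  show ?thesis
    by (rule B.additive_frag_eval[where \<Phi> = "\<lambda>b. frag_of (a, b)" and S = S])
      (use assms in \<open>simp_all add: subspace_tensor_relations(1) B.is_group tensor_add_right\<close>)
qed

lemma tensor_int_pow_left:
  assumes A: "comm_group A" and B: "group B" and ab: "a \<in> carrier A" "b \<in> carrier B"
  shows "frag_of (a [^]\<^bsub>A\<^esub> (n::int), b) - frag_cmul n (frag_of (a, b)) \<in> tensor_relations A B"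
proof -
  interpret A: comm_group A by fact
  have "frag_eval A id (frag_cmul n (frag_of a)) = a [^]\<^bsub>A\<^esub> n"
    using A.frag_eval_cmul[of id "carrier A" "frag_of a" n] ab by simp
  moreover have "Poly_Mapping.keys (frag_cmul n (frag_of a)) \<subseteq> carrier A" using ab by auto
  ultimately show ?thesis
    using tensor_frag_eval_left[OF A B ab(2), of id "carrier A" "frag_cmul n (frag_of a)"]
    by (auto simp: frag_extend_cmul)
qed

lemma tensor_int_pow_right:
  assumes A: "group A" and B: "comm_group B" and ab: "a \<in> carrier A" "b \<in> carrier B"
  shows "frag_of (a, b [^]\<^bsub>B\<^esub> (n::int)) - frag_cmul n (frag_of (a, b)) \<in> tensor_relations A B"
proof -
  interpret B: comm_group B by fact
  have "frag_eval B id (frag_cmul n (frag_of b)) = b [^]\<^bsub>B\<^esub> n"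
    using B.frag_eval_cmul[of id "carrier B" "frag_of b" n] ab by simp
  moreover have "Poly_Mapping.keys (frag_cmul n (frag_of b)) \<subseteq> carrier B" using ab by auto
  ultimately show ?thesis
    using tensor_frag_eval_right[OF A B ab(1), of id "carrier B" "frag_cmul n (frag_of b)"]
    by (auto simp: frag_extend_cmul)
qed

lemma tensor_one_left:
  assumes A: "comm_group A" and B: "group B" and b: "b \<in> carrier B"
  shows "frag_of (\<one>\<^bsub>A\<^esub>, b) \<in> tensor_relations A B"
proof -
  interpret A: comm_group A by fact
  show ?thesis using tensor_int_pow_left[OF A B A.one_closed b, of 0] by simp
qed

text \<open>A relation involves only finitely many elements of \<open>B\<close>, so it is respected by every bilinear
  map that is defined on a subgroup containing these elements.\<close>

lemma tensor_relation_finite_support: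
  fixes A :: "('a, 'x) monoid_scheme" and B :: "('b, 'y) monoid_scheme"
  assumes A: "comm_group A" and B: "group B" and w: "w \<in> tensor_relations A B"
  shows "\<exists>S. finite S \<and> S \<subseteq> carrier B \<and> Poly_Mapping.keys w \<subseteq> carrier A \<times> S \<and>
    (\<forall>V c. S \<subseteq> V \<longrightarrow> (\<forall>u\<in>V. \<forall>v\<in>V. u \<otimes>\<^bsub>B\<^esub> v \<in> V \<longrightarrow> c (u \<otimes>\<^bsub>B\<^esub> v) = c u + c v) \<longrightarrow>
      frag_eval A (\<lambda>(a, v). a [^]\<^bsub>A\<^esub> (c v :: int)) w = \<one>\<^bsub>A\<^esub>)"
proof -
  interpret A: comm_group A by fact
  interpret B: group B by fact
  define E where "E c = frag_eval A (\<lambda>(a, v). a [^]\<^bsub>A\<^esub> (c v :: int))" for c :: "'b \<Rightarrow> int"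
  \<comment> \<open>Additivity is demanded only where the product stays in \<open>V\<close>, so
    \<open>V\<close> may be any set containing the support. This is what admits coordinate functions
    that are defined on a part of \<open>B\<close>.\<close>
  define additive where "additive V c \<longleftrightarrow>
    (\<forall>u\<in>V. \<forall>v\<in>V. u \<otimes>\<^bsub>B\<^esub> v \<in> V \<longrightarrow> c (u \<otimes>\<^bsub>B\<^esub> v) = c u + c v)" for V and c :: "'b \<Rightarrow> int"
  define P where "P w S \<longleftrightarrow> finite S \<and> S \<subseteq> carrier B \<and> Poly_Mapping.keys w \<subseteq> carrier A \<times> S \<and>
    (\<forall>V c. S \<subseteq> V \<longrightarrow> additive V c \<longrightarrow> E c w = \<one>\<^bsub>A\<^esub>)" for w S
  have img: "(\<lambda>(a, v). a [^]\<^bsub>A\<^esub> (c v :: int)) ` (carrier A \<times> S) \<subseteq> carrier A" for c S by auto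
  have Ediff: "E c (v - w) = E c v \<otimes>\<^bsub>A\<^esub> inv\<^bsub>A\<^esub> E c w"
    if "Poly_Mapping.keys v \<subseteq> carrier A \<times> S" "Poly_Mapping.keys w \<subseteq> carrier A \<times> S" for c v w S
    unfolding E_def by (rule A.frag_eval_diff[OF img that])
  have Eof: "E c (frag_of (a, v)) = a [^]\<^bsub>A\<^esub> c v" if "a \<in> carrier A" for c a v
    using that by (simp add: E_def)
  have P_diff: "\<exists>Z. P (v - w) Z" if "P v S" "P w Y" for v w S Y
  proof -
    have keys: "Poly_Mapping.keys v \<subseteq> carrier A \<times> (S \<union> Y)" "Poly_Mapping.keys w \<subseteq> carrier A \<times> (S \<union> Y)"
      using that by (auto simp: P_def)
    have "E c (v - w) = \<one>\<^bsub>A\<^esub>" if "S \<union> Y \<subseteq> V" "additive V c" for V c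
    proof -
      have "E c v = \<one>\<^bsub>A\<^esub>" "E c w = \<one>\<^bsub>A\<^esub>"
        using \<open>P v S\<close> \<open>P w Y\<close> that unfolding P_def by auto
      then show ?thesis unfolding Ediff[OF keys] by simp
    qed
    then have "P (v - w) (S \<union> Y)"
      using that keys_subset_Un_diff[OF keys] unfolding P_def by auto
    then show ?thesis by blast
  qed
  have P0: "P 0 {}" by (simp add: P_def E_def)
  have cancel: "x \<otimes>\<^bsub>A\<^esub> y \<otimes>\<^bsub>A\<^esub> inv\<^bsub>A\<^esub> x \<otimes>\<^bsub>A\<^esub> inv\<^bsub>A\<^esub> y = \<one>\<^bsub>A\<^esub>"
    if "x \<in> carrier A" "y \<in> carrier A" for x y
  proof -
    have "x \<otimes>\<^bsub>A\<^esub> y \<otimes>\<^bsub>A\<^esub> inv\<^bsub>A\<^esub> x = y \<otimes>\<^bsub>A\<^esub> x \<otimes>\<^bsub>A\<^esub> inv\<^bsub>A\<^esub> x"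
      by (subst A.m_comm) (use that in simp_all)
    also have "\<dots> = y" using that by (subst A.m_assoc) simp_all
    finally show ?thesis using that by simp
  qed
  have P_rel: "\<exists>S. P w S" if "w \<in> bilinearity_relators A B" for w
  proof -
    from that show ?thesis unfolding bilinearity_relators_def
    proof (elim UnE CollectE exE conjE)
      fix a a' b
      assume w: "w = frag_of (a \<otimes>\<^bsub>A\<^esub> a', b) - frag_of (a, b) - frag_of (a', b)"
        and left: "a \<in> carrier A" "a' \<in> carrier A" "b \<in> carrier B"
      let ?S = "{b}"
      have keys: "Poly_Mapping.keys (frag_of (a \<otimes>\<^bsub>A\<^esub> a', b)) \<subseteq> carrier A \<times> ?S"
        "Poly_Mapping.keys (frag_of (a, b)) \<subseteq> carrier A \<times> ?S"
        "Poly_Mapping.keys (frag_of (a', b)) \<subseteq> carrier A \<times> ?S" using left by auto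
      note keys2 = keys_subset_Un_diff[OF keys(1,2)]
      have "E c w = \<one>\<^bsub>A\<^esub>" for c
        unfolding w Ediff[OF keys2 keys(3)] Ediff[OF keys(1,2)]
          Eof[OF A.m_closed[OF left(1,2)]] Eof[OF left(1)] Eof[OF left(2)] A.int_pow_distrib[OF left(1,2)]
        by (rule cancel) (use left in simp_all)
      then have "P w ?S" using left w keys_subset_Un_diff[OF keys2 keys(3)] by (simp add: P_def)
      then show ?thesis by blast
    next
      fix a b b'
      assume w: "w = frag_of (a, b \<otimes>\<^bsub>B\<^esub> b') - frag_of (a, b) - frag_of (a, b')"
        and right: "a \<in> carrier A" "b \<in> carrier B" "b' \<in> carrier B"
      \<comment> \<open>The product belongs to the support as well: this relator dies only because
        \<open>c\<close> is additive at exactly this product. The other kind of relator dies for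
        every \<open>c\<close>, by the power law in \<open>A\<close>.\<close>
      let ?S = "{b, b', b \<otimes>\<^bsub>B\<^esub> b'}"
      have keys: "Poly_Mapping.keys (frag_of (a, b \<otimes>\<^bsub>B\<^esub> b')) \<subseteq> carrier A \<times> ?S"
        "Poly_Mapping.keys (frag_of (a, b)) \<subseteq> carrier A \<times> ?S"
        "Poly_Mapping.keys (frag_of (a, b')) \<subseteq> carrier A \<times> ?S" using right by auto
      note keys2 = keys_subset_Un_diff[OF keys(1,2)]
      have "E c w = \<one>\<^bsub>A\<^esub>" if "?S \<subseteq> V" "additive V c" for V c
      proof -
        have c: "c (b \<otimes>\<^bsub>B\<^esub> b') = c b + c b'" using that by (auto simp: additive_def)
        show ?thesis
          unfolding w Ediff[OF keys2 keys(3)] Ediff[OF keys(1,2)] Eof[OF right(1)] c A.int_pow_mult[OF right(1)]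
          by (rule cancel) (use right in simp_all)
      qed
      then have "P w ?S" using right w keys_subset_Un_diff[OF keys2 keys(3)] by (simp add: P_def)
      then show ?thesis by blast
    qed
  qed
  have keysR: "Poly_Mapping.keys v \<subseteq> carrier A \<times> carrier B" if "v \<in> tensor_relations A B" for v
    using subspace_tensor_relations(2)[OF A.is_group B] that by blast
  have "\<exists>S. P w S" using w unfolding tensor_relations_def
  proof (induction rule: generate.induct)
    case one
    then show ?case using P0 by auto
  next
    case (incl h)
    then show ?case by (rule P_rel)
  next
    case (inv h)
    then have "h \<in> tensor_relations A B" unfolding tensor_relations_def by (rule generate.incl)
    then show ?case using P_rel[OF inv] P_diff[OF P0] keysR by fastforce
  next
    case (eng v w)
    then obtain S Y where XY: "P v S" "P w Y" by blast
    obtain Z where "P (0 - w) Z" using P_diff[OF P0 XY(2)] by blast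
    from P_diff[OF XY(1) this] show ?case by simp
  qed
  then show ?thesis unfolding P_def additive_def E_def by blast
qed

lemma tensor_class_eq_iff:
  assumes A: "group A" and B: "group B"
    and u: "Poly_Mapping.keys u \<subseteq> carrier A \<times> carrier B"
    and v: "Poly_Mapping.keys v \<subseteq> carrier A \<times> carrier B"
  shows "tensor_class A B u = tensor_class A B v \<longleftrightarrow> u - v \<in> tensor_relations A B"
proof -
  interpret F: group "free_Abelian_group (carrier A \<times> carrier B)" by simp
  show ?thesis unfolding tensor_class_def
    using F.rcos_eq_iff[OF subgroup_tensor_relations[OF A B], of u v] u v by simp
qed

definition tensor_component :: "'i \<Rightarrow> (('i \<Rightarrow> 'n) \<times> 'm \<Rightarrow>\<^sub>0 int) \<Rightarrow> 'n \<times> 'm \<Rightarrow>\<^sub>0 int" where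
  "tensor_component i = frag_extend (\<lambda>(x, m). frag_of (x i, m))"

lemma keys_tensor_component:
  assumes "Poly_Mapping.keys u \<subseteq> carrier (product_group I N) \<times> C" "i \<in> I"
  shows "Poly_Mapping.keys (tensor_component i u) \<subseteq> carrier (N i) \<times> C"
proof -
  have "Poly_Mapping.keys (tensor_component i u) \<subseteq>
      (\<Union>p\<in>Poly_Mapping.keys u. Poly_Mapping.keys (case p of (x, m) \<Rightarrow> frag_of (x i, m)))"
    unfolding tensor_component_def by (rule keys_frag_extend)
  then show ?thesis using assms by fastforce
qed

lemma tensor_map_component:
  assumes N: "\<And>i. i \<in> I \<Longrightarrow> group (N i)" and M: "group M" and i: "i \<in> I"
    and u: "Poly_Mapping.keys u \<subseteq> carrier (product_group I N) \<times> carrier M"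
  shows "tensor_map (N i) M (\<lambda>x. x i) id (tensor_class (product_group I N) M u) =
    tensor_class (N i) M (tensor_component i u)"
proof -
  have "(\<lambda>x. x i) \<in> hom (product_group I N) (N i)" using i by (auto simp: hom_def)
  then show ?thesis
    using u N M i by (subst tensor_map_class) (auto simp: hom_def tensor_component_def)
qed

text \<open>The canonical map is additive, so injectivity is triviality of the kernel. Stated on
  representatives, it replaces cosets by membership in \<open>tensor_relations\<close>, the form
  used in the rest of the proof.\<close>

lemma inj_product_tensor_map_iff:
  assumes N: "\<And>i. i \<in> I \<Longrightarrow> group (N i)" and M: "group M"
  shows "inj_on (product_tensor_map I N M) (carrier (tensor_product (product_group I N) M)) \<longleftrightarrow>
    (\<forall>u. Poly_Mapping.keys u \<subseteq> carrier (product_group I N) \<times> carrier M \<longrightarrow>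
      (\<forall>i\<in>I. tensor_component i u \<in> tensor_relations (N i) M) \<longrightarrow>
      u \<in> tensor_relations (product_group I N) M)" (is "?inj \<longleftrightarrow> ?ker")
proof -
  let ?P = "product_group I N"
  have P: "group ?P" using N by simp
  have carr: "carrier (tensor_product ?P M) =
      tensor_class ?P M ` {u. Poly_Mapping.keys u \<subseteq> carrier ?P \<times> carrier M}"
    unfolding tensor_product_def tensor_class_def FactGroup_def RCOSETS_def by auto
  have eq: "product_tensor_map I N M (tensor_class ?P M u) = product_tensor_map I N M (tensor_class ?P M v)
      \<longleftrightarrow> (\<forall>i\<in>I. tensor_component i (u - v) \<in> tensor_relations (N i) M)"
    if u: "Poly_Mapping.keys u \<subseteq> carrier ?P \<times> carrier M"
      and v: "Poly_Mapping.keys v \<subseteq> carrier ?P \<times> carrier M" for u v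
  proof -
    have "product_tensor_map I N M (tensor_class ?P M u) = product_tensor_map I N M (tensor_class ?P M v)
      \<longleftrightarrow> (\<forall>i\<in>I. tensor_map (N i) M (\<lambda>x. x i) id (tensor_class ?P M u)
                = tensor_map (N i) M (\<lambda>x. x i) id (tensor_class ?P M v))"
      unfolding product_tensor_map_def by (auto simp: restrict_def fun_eq_iff)
    also have "\<dots> \<longleftrightarrow> (\<forall>i\<in>I. tensor_component i (u - v) \<in> tensor_relations (N i) M)"
    proof (intro ball_cong refl)
      fix i assume i: "i \<in> I"
      have map: "tensor_map (N i) M (\<lambda>x. x i) id (tensor_class ?P M u) = tensor_class (N i) M (tensor_component i u)"
        if "Poly_Mapping.keys u \<subseteq> carrier ?P \<times> carrier M" for u
        using N M i that by (rule tensor_map_component)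
      have "tensor_map (N i) M (\<lambda>x. x i) id (tensor_class ?P M u)
            = tensor_map (N i) M (\<lambda>x. x i) id (tensor_class ?P M v) \<longleftrightarrow>
          tensor_component i u - tensor_component i v \<in> tensor_relations (N i) M"
        unfolding map[OF u] map[OF v]
        by (rule tensor_class_eq_iff[OF N[OF i] M keys_tensor_component[OF u i] keys_tensor_component[OF v i]])
      then show "tensor_map (N i) M (\<lambda>x. x i) id (tensor_class ?P M u)
            = tensor_map (N i) M (\<lambda>x. x i) id (tensor_class ?P M v) \<longleftrightarrow>
          tensor_component i (u - v) \<in> tensor_relations (N i) M"
        by (simp add: tensor_component_def frag_extend_diff)
    qed
    finally show ?thesis .
  qed
  show ?thesis
  proof
    assume inj: ?inj
    show ?ker
    proof (intro allI impI)
      fix u assume u: "Poly_Mapping.keys u \<subseteq> carrier ?P \<times> carrier M"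
        and ker: "\<forall>i\<in>I. tensor_component i u \<in> tensor_relations (N i) M"
      then have "product_tensor_map I N M (tensor_class ?P M u) = product_tensor_map I N M (tensor_class ?P M 0)"
        using eq[OF u, of 0] by simp
      then have "tensor_class ?P M u = tensor_class ?P M 0"
        by (rule inj_onD[OF inj]) (use u in \<open>auto simp: carr\<close>)
      then show "u \<in> tensor_relations ?P M" using tensor_class_eq_iff[OF P M u, of 0] by simp
    qed
  next
    assume ker: ?ker
    show ?inj
    proof (rule inj_onI)
      fix s t assume st: "s \<in> carrier (tensor_product ?P M)" "t \<in> carrier (tensor_product ?P M)"
        and "product_tensor_map I N M s = product_tensor_map I N M t"
      moreover from st obtain u v where u: "Poly_Mapping.keys u \<subseteq> carrier ?P \<times> carrier M" "s = tensor_class ?P M u"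
        and v: "Poly_Mapping.keys v \<subseteq> carrier ?P \<times> carrier M" "t = tensor_class ?P M v"
        unfolding carr by blast
      ultimately have "\<forall>i\<in>I. tensor_component i (u - v) \<in> tensor_relations (N i) M"
        using eq[OF u(1) v(1)] by simp
      then have "u - v \<in> tensor_relations ?P M"
        using ker keys_subset_Un_diff[OF u(1) v(1)] by blast
      then show "s = t" using tensor_class_eq_iff[OF P M u(1) v(1)] u v by simp
    qed
  qed
qed

lemma frag_extend_frag_extend:
  "frag_extend f (frag_extend g c) = frag_extend (\<lambda>i. frag_extend f (g i)) c"
  by (induction c rule: frag_induction[OF subset_UNIV]) (auto simp: frag_extend_diff)

lemma frag_extend_fun_diff:
  "frag_extend (\<lambda>i. x i - y i) c = frag_extend x c - frag_extend y c"
  by (induction c rule: frag_induction[OF subset_UNIV]) (auto simp: frag_extend_diff)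

lemma int_coord_frag_extend:
  assumes K: "frag.subspace K" and J: "int_indep K y J"
    and x: "\<And>i. i \<in> Poly_Mapping.keys c \<Longrightarrow> x i \<in> int_span K y J"
  shows "int_coord K y J (frag_extend x c) = frag_extend (\<lambda>i. int_coord K y J (x i)) c"
proof (rule int_coord_eq[OF K J])
  let ?C = "\<lambda>i. int_coord K y J (x i)"
  show "Poly_Mapping.keys (frag_extend ?C c) \<subseteq> J"
    using keys_frag_extend[of ?C c] int_coord(1)[OF x] by blast
  have "frag_extend (\<lambda>i. x i - frag_extend y (?C i)) c \<in> K"
    using int_coord(2)[OF x] by (rule frag_extend_mem[OF K])
  then show "frag_extend x c - frag_extend y (frag_extend ?C c) \<in> K"
    by (simp add: frag_extend_fun_diff frag_extend_frag_extend)
qed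

lemma frag_divide:
  assumes "\<And>b. q dvd Poly_Mapping.lookup D b"
  obtains D' where "Poly_Mapping.keys D' \<subseteq> Poly_Mapping.keys D" "frag_cmul q D' = D"
proof
  let ?D = "\<Sum>b\<in>Poly_Mapping.keys D. frag_cmul (Poly_Mapping.lookup D b div q) (frag_of b)"
  have "Poly_Mapping.keys ?D \<subseteq> (\<Union>b\<in>Poly_Mapping.keys D. Poly_Mapping.keys (frag_cmul (Poly_Mapping.lookup D b div q) (frag_of b)))"
    by (rule keys_sum)
  then show "Poly_Mapping.keys ?D \<subseteq> Poly_Mapping.keys D" by auto
  have "frag_cmul q ?D = frag_extend frag_of D"
    using assms by (simp add: frag_cmul_sum frag_extend_def)
  then show "frag_cmul q ?D = D" by (simp flip: frag_expansion)
qed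

text \<open>\<open>frag_of\<close> is not additive, but \<open>frag_of (u \<otimes> v)\<close> and
  \<open>frag_of u + frag_of v\<close> agree modulo \<open>torsion_frags\<close>, and coordinates
  depend only on that class. This supplies the additive functions for
  \<open>tensor_relation_finite_support\<close>.\<close>

lemma (in comm_group) int_coord_frag_of_mult:
  assumes J: "int_indep torsion_frags y J" and uv: "u \<in> carrier G" "v \<in> carrier G"
    and "frag_of u \<in> int_span torsion_frags y J" "frag_of v \<in> int_span torsion_frags y J"
  shows "int_coord torsion_frags y J (frag_of (u \<otimes> v)) =
    int_coord torsion_frags y J (frag_of u) + int_coord torsion_frags y J (frag_of v)"
proof -
  note K = subspace_torsion_frags
  have uv_keys: "Poly_Mapping.keys (frag_of u + frag_of v) \<subseteq> carrier G"
    using uv keys_add[of "frag_of u" "frag_of v"] by auto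
  have "frag_eval G id (frag_of u + frag_of v) = u \<otimes> v"
    using uv frag_eval_add[of id "carrier G" "frag_of u" "frag_of v"] by simp
  then have "(frag_of u + frag_of v) - frag_of (u \<otimes> v) \<in> torsion_frags"
    using frag_of_frag_eval[OF uv_keys] by simp
  moreover have "frag_of u + frag_of v \<in> int_span torsion_frags y J"
    using assms by (intro frag.subspace_add subspace_int_span K)
  ultimately show ?thesis
    using int_coord_mod[OF K J] int_coord_add[OF K J] assms by metis
qed

lemma (in comm_group) int_span_torsion_frags_keys:
  assumes "\<And>i. i \<in> J \<Longrightarrow> Poly_Mapping.keys (y i) \<subseteq> carrier G"
  shows "int_span torsion_frags y J \<subseteq> {w. Poly_Mapping.keys w \<subseteq> carrier G}"
  using assms torsion_frags_keys by (intro int_span_minimal subspace_keys_subset) auto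

lemma (in comm_group) finite_basis_mod_torsion:
  assumes "finite S" "S \<subseteq> carrier G"
  obtains y J where "J \<subseteq> S" "int_span torsion_frags y J = int_span torsion_frags frag_of S"
    "int_indep torsion_frags y J"
proof -
  have "int_span torsion_frags frag_of S \<subseteq> {w. Poly_Mapping.keys w \<subseteq> carrier G}"
    using assms by (intro int_span_torsion_frags_keys) auto
  then have "pure_in torsion_frags (int_span torsion_frags frag_of S)"
    using pure_torsion_frags unfolding pure_in_def by blast
  from exists_int_basis[OF subspace_torsion_frags assms(1) this] show ?thesis using that by blast
qed

section \<open>The group of rationals modulo one\<close>

text \<open>The rationals are countable, so their quotient modulo the integers can be copied into
  any infinite type. The map \<open>\<phi>\<close> is the quotient map; the copy is divisible
  because \<open>q / n\<close> is an \<open>n\<close>-th root of the class of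
  \<open>q\<close>.\<close>

lemma rat_circle_exists:
  assumes inf: "infinite (UNIV :: 'n set)"
  obtains C :: "'n monoid" and \<phi> :: "rat \<Rightarrow> 'n" where
    "comm_group C" "absolutely_pure C" "\<forall>q. \<phi> q \<in> carrier C"
    "\<forall>q r. \<phi> (q + r) = \<phi> q \<otimes>\<^bsub>C\<^esub> \<phi> r" "\<forall>q. \<phi> q = \<one>\<^bsub>C\<^esub> \<longleftrightarrow> q \<in> \<int>"
proof -
  obtain f :: "nat \<Rightarrow> 'n" where f: "inj f" using infinite_countable_subset[OF inf] by blast
  define g :: "rat \<Rightarrow> 'n" where "g q = f (to_nat q)" for q
  have g: "g q = g r \<longleftrightarrow> q = r" for q r
    using f by (simp add: g_def inj_eq)
  define h where "h = inv_into UNIV g"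
  have h: "h (g q) = q" for q unfolding h_def using g by (simp add: inv_into_f_f inj_def)
  \<comment> \<open>The fractional part picks the representative in \<open>[0, 1)\<close> of each
    class, \<open>g\<close> encodes it in \<open>'n\<close>, and \<open>h\<close> decodes it again
    for the multiplication of \<open>C\<close>.\<close>
  define \<phi> where "\<phi> q = g (frac q)" for q
  define C where "C = \<lparr>carrier = range \<phi>, monoid.mult = (\<lambda>x y. \<phi> (h x + h y)), one = \<phi> 0\<rparr>"
  have eq: "\<phi> q = \<phi> r \<longleftrightarrow> q - r \<in> \<int>" for q r
  proof -
    have "frac q = frac r \<longleftrightarrow> q - frac r \<in> \<int>" by (simp add: frac_unique_iff frac_lt_1)
    also have "q - frac r = (q - r) + of_int \<lfloor>r\<rfloor>" by (simp add: frac_def)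
    finally show ?thesis by (simp add: \<phi>_def g)
  qed
  have mult: "\<phi> q \<otimes>\<^bsub>C\<^esub> \<phi> r = \<phi> (q + r)" for q r
  proof -
    have "frac q + frac r - (q + r) = of_int (- \<lfloor>q\<rfloor> - \<lfloor>r\<rfloor>)" by (simp add: frac_def)
    then have "frac q + frac r - (q + r) \<in> \<int>" by (metis Ints_of_int)
    then have "\<phi> (frac q + frac r) = \<phi> (q + r)" by (simp add: eq)
    then show ?thesis by (simp add: C_def \<phi>_def[of q] \<phi>_def[of r] h)
  qed
  have carr: "x \<in> carrier C \<longleftrightarrow> (\<exists>q. x = \<phi> q)" for x by (auto simp: C_def)
  have one: "\<one>\<^bsub>C\<^esub> = \<phi> 0" by (simp add: C_def)
  interpret C: comm_group C
  proof (rule comm_groupI)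
    show "\<exists>y\<in>carrier C. y \<otimes>\<^bsub>C\<^esub> x = \<one>\<^bsub>C\<^esub>" if "x \<in> carrier C" for x
    proof -
      obtain q where q: "x = \<phi> q" using \<open>x \<in> carrier C\<close> carr by auto
      have "\<phi> (- q) \<otimes>\<^bsub>C\<^esub> x = \<one>\<^bsub>C\<^esub>" by (simp add: q mult one)
      then show ?thesis using carr by blast
    qed
  qed (auto simp: carr mult one add_ac)
  have pow: "\<phi> q [^]\<^bsub>C\<^esub> n = \<phi> (of_nat n * q)" for q and n :: nat
    by (induction n) (auto simp: one mult algebra_simps)
  have "\<exists>c\<in>carrier C. c [^]\<^bsub>C\<^esub> n = a" if "n > 0" "a \<in> carrier C" for a and n :: nat
  proof -
    obtain q where q: "a = \<phi> q" using \<open>a \<in> carrier C\<close> carr by auto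
    have "\<phi> (q / of_nat n) [^]\<^bsub>C\<^esub> n = a" using that by (simp add: pow q)
    then show ?thesis using carr by blast
  qed
  then have "absolutely_pure C" unfolding absolutely_pure_iff_divisible using C.comm_group_axioms by blast
  moreover have "\<phi> q = \<one>\<^bsub>C\<^esub> \<longleftrightarrow> q \<in> \<int>" for q unfolding one eq by simp
  moreover have "\<phi> q \<in> carrier C" for q using carr by blast
  ultimately show ?thesis using that[of C \<phi>] C.comm_group_axioms mult by simp
qed

lemma comm_group_product_group:
  assumes "\<And>i. i \<in> I \<Longrightarrow> comm_group (N i)"
  shows "comm_group (product_group I N)"
proof (rule group.group_comm_groupI)
  show "group (product_group I N)" using assms by (simp add: comm_group_def)
  fix x y assume xy: "x \<in> carrier (product_group I N)" "y \<in> carrier (product_group I N)"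
  have "x i \<otimes>\<^bsub>N i\<^esub> y i = y i \<otimes>\<^bsub>N i\<^esub> x i" if "i \<in> I" for i
  proof -
    interpret comm_group "N i" by (rule assms[OF that])
    show ?thesis using xy that by (auto intro: m_comm)
  qed
  then show "x \<otimes>\<^bsub>product_group I N\<^esub> y = y \<otimes>\<^bsub>product_group I N\<^esub> x"
    by (simp cong: restrict_cong)
qed

lemma product_group_projection:
  assumes "\<And>i. i \<in> I \<Longrightarrow> group (N i)" "i \<in> I"
  shows "group_hom (product_group I N) (N i) (\<lambda>x. x i)"
  using assms by (auto simp: group_hom_def group_hom_axioms_def hom_def)

lemma sharp_Mittag_Leffler_iff_kernel:
  fixes M :: "('m, 'x) monoid_scheme"
  assumes M: "group M"
  shows "sharp_Mittag_Leffler TYPE('i) TYPE('n) M \<longleftrightarrow>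
    (\<forall>(I :: 'i set) (N :: 'i \<Rightarrow> 'n monoid). (\<forall>i\<in>I. absolutely_pure (N i)) \<longrightarrow>
      (\<forall>u. Poly_Mapping.keys u \<subseteq> carrier (product_group I N) \<times> carrier M \<longrightarrow>
        (\<forall>i\<in>I. tensor_component i u \<in> tensor_relations (N i) M) \<longrightarrow>
        u \<in> tensor_relations (product_group I N) M))"
proof -
  have "inj_on (product_tensor_map I N M) (carrier (tensor_product (product_group I N) M)) \<longleftrightarrow>
    (\<forall>u. Poly_Mapping.keys u \<subseteq> carrier (product_group I N) \<times> carrier M \<longrightarrow>
      (\<forall>i\<in>I. tensor_component i u \<in> tensor_relations (N i) M) \<longrightarrow>
      u \<in> tensor_relations (product_group I N) M)"
    if "\<forall>i\<in>I. absolutely_pure (N i)" for I :: "'i set" and N :: "'i \<Rightarrow> 'n monoid"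
    using that M by (intro inj_product_tensor_map_iff) (auto simp: absolutely_pure_def comm_group_def)
  then show ?thesis unfolding sharp_Mittag_Leffler_def by (intro iff_allI imp_cong refl)
qed

section \<open>The Mittag-Leffler property bounds pure closures\<close>

text \<open>If \<open>q p = \<Sum>k<n. c k \<cdot> e k\<close> then \<open>\<Sum>k<n. (c k / q) \<otimes> e k = (1/q) \<otimes> q p\<close> vanishes in
  \<open>\<rat>/\<int> \<otimes> M\<close>. Over all such \<open>(q, c)\<close> at once this is a single element of \<open>(\<rat>/\<int>)\<^sup>I \<otimes> M\<close>, killed by
  finitely many relations. The coordinates with respect to a basis of the subgroup supporting
  these relations then show that \<open>q\<close> divides the coordinates of \<open>q p\<close>.\<close>

lemma Mittag_Leffler_pure_closure_bounded:
  fixes M :: "('m, 'x) monoid_scheme" and e :: "nat \<Rightarrow> 'm"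
  assumes M: "comm_group M"
    and inf: "infinite (UNIV :: 'i set)" "infinite (UNIV :: 'n set)"
    and mitt: "sharp_Mittag_Leffler TYPE('i) TYPE('n) M"
    and e: "\<And>k. e k \<in> carrier M"
  shows "\<exists>S. finite S \<and> S \<subseteq> carrier M \<and> (\<forall>p\<in>carrier M. \<forall>q c. q \<noteq> 0 \<longrightarrow>
    Poly_Mapping.keys c \<subseteq> {..<n} \<longrightarrow> p [^]\<^bsub>M\<^esub> (q :: int) = frag_eval M e c \<longrightarrow>
    frag_of p \<in> int_span (comm_group.torsion_frags M) frag_of S)"
proof -
  interpret M: comm_group M by fact
  obtain C :: "'n monoid" and \<phi> :: "rat \<Rightarrow> 'n" where C: "comm_group C" "absolutely_pure C"
    and \<phi>': "\<forall>q. \<phi> q \<in> carrier C" "\<forall>q r. \<phi> (q + r) = \<phi> q \<otimes>\<^bsub>C\<^esub> \<phi> r"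
      "\<forall>q. \<phi> q = \<one>\<^bsub>C\<^esub> \<longleftrightarrow> q \<in> \<int>"
    by (rule rat_circle_exists[OF inf(2)])
  note \<phi> = \<phi>'[rule_format]
  interpret C: comm_group C by fact
  have \<phi>_nat: "\<phi> (of_nat z * r) = \<phi> r [^]\<^bsub>C\<^esub> z" for z r
    by (induction z) (use \<phi> in \<open>auto simp: algebra_simps C.m_comm\<close>)
  have \<phi>_neg: "\<phi> (- r) = inv\<^bsub>C\<^esub> \<phi> r" for r
    using \<phi>(2)[of "- r" r] \<phi>(3)[of 0] \<phi>(1) by (intro C.inv_equality[symmetric]) auto
  have \<phi>_int: "\<phi> (of_int z * r) = \<phi> r [^]\<^bsub>C\<^esub> z" for z r
  proof (cases z)
    case (nonneg m)
    then show ?thesis using \<phi>_nat[of m r] by (simp add: int_pow_int)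
  next
    case (neg m)
    then have "of_int z = - (of_nat (Suc m) :: rat)" by simp
    then have "of_int z * r = - (of_nat (Suc m) * r)" by (simp only: mult_minus_left)
    then have "\<phi> (of_int z * r) = inv\<^bsub>C\<^esub> (\<phi> r [^]\<^bsub>C\<^esub> Suc m)" by (simp only: \<phi>_neg \<phi>_nat)
    then show ?thesis using neg \<phi>(1) by (simp only: C.int_pow_neg_int)
  qed
  obtain f :: "nat \<Rightarrow> 'i" where f: "inj f" using infinite_countable_subset[OF inf(1)] by blast
  \<comment> \<open>An index stands for a divisor \<open>q\<close> and a list \<open>l\<close> of
    coefficients of \<open>e 0, ..., e (n - 1)\<close>. Lists are used because pairs of this type
    are countable and so embed into the index type.\<close>
  define \<iota> :: "int \<times> int list \<Rightarrow> 'i" where "\<iota> = f \<circ> to_nat"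
  have \<iota>: "inj \<iota>" unfolding \<iota>_def using f by (intro inj_compose) auto
  define I where "I = range \<iota>"
  define P where "P = product_group I (\<lambda>_. C)"
  interpret P: comm_group P unfolding P_def using C(1) by (rule comm_group_product_group)
  define cl where "cl l = (\<Sum>k<n. frag_cmul (l ! k) (frag_of k))" for l
  define valid where "valid = (\<lambda>(q, l). q \<noteq> 0 \<and> length l = n \<and> (\<exists>p\<in>carrier M. p [^]\<^bsub>M\<^esub> (q :: int) = frag_eval M e (cl l)))"
  \<comment> \<open>At pairs that solve no divisibility problem in \<open>M\<close> the value 0
    makes the component of the tensor trivial, so the index set can be the full range of
    \<open>\<iota>\<close>.\<close>
  define r where "r ql k = (if valid ql then of_int (snd ql ! k) / of_int (fst ql) else 0 :: rat)" for ql k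
  \<comment> \<open>The element of the power of \<open>C\<close> whose component at a valid
    \<open>(q, l)\<close> is the class of \<open>l ! k / q\<close>.\<close>
  define d where "d k = (\<lambda>i\<in>I. \<phi> (r (inv_into UNIV \<iota> i) k))" for k
  have d: "d k \<in> carrier P" for k by (auto simp: d_def P_def \<phi>)
  have d_at: "d k (\<iota> ql) = \<phi> (r ql k)" for k ql
    using \<iota> by (simp add: d_def I_def inv_into_f_f)
  \<comment> \<open>The tensor of interest is \<open>u n\<close>; the partial sums exist for the
    induction that evaluates it in \<open>integral\<close>.\<close>
  define u where "u m = (\<Sum>k<m. frag_of (d k, e k))" for m :: nat
  have u_keys: "Poly_Mapping.keys (u m) \<subseteq> carrier P \<times> carrier M" for m
  proof -
    have "u m \<in> {w. Poly_Mapping.keys w \<subseteq> carrier P \<times> carrier M}"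
      unfolding u_def by (rule frag.subspace_sum[OF subspace_keys_subset]) (use d e in auto)
    then show ?thesis by simp
  qed
  note R = subspace_tensor_relations(1)[OF C.is_group M.is_group]
  have cl_keys: "Poly_Mapping.keys (cl l) \<subseteq> {..<n}" for l
  proof -
    have "cl l \<in> {w. Poly_Mapping.keys w \<subseteq> {..<n}}"
      unfolding cl_def by (rule frag.subspace_sum[OF subspace_keys_subset]) auto
    then show ?thesis by simp
  qed
  have cl_extend: "frag_extend x (cl l) = (\<Sum>k<n. frag_cmul (l ! k) (x k))" for x :: "nat \<Rightarrow> 'z \<Rightarrow>\<^sub>0 int" and l
    by (simp add: cl_def frag_extend_sum frag_extend_cmul comp_def)
  have e_img: "e ` S \<subseteq> carrier M" for S using e by auto
  have comp: "tensor_component (\<iota> ql) (u n) \<in> tensor_relations C M" for ql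
  proof -
    have sum: "tensor_component (\<iota> ql) (u n) = (\<Sum>k<n. frag_of (\<phi> (r ql k), e k))"
      by (simp add: tensor_component_def u_def frag_extend_sum comp_def d_at)
    show ?thesis
    proof (cases "valid ql")
      case False
      then have "\<phi> (r ql k) = \<one>\<^bsub>C\<^esub>" for k by (simp add: r_def \<phi>)
      then show ?thesis unfolding sum
        by (intro frag.subspace_sum[OF R]) (simp add: tensor_one_left[OF C(1) M.is_group e])
    next
      case True
      obtain q l where ql: "ql = (q, l)" by (cases ql)
      obtain p where p: "p \<in> carrier M" "p [^]\<^bsub>M\<^esub> q = frag_eval M e (cl l)" and q: "q \<noteq> 0"
        using True by (auto simp: ql valid_def)
      define a where "a = \<phi> (1 / of_int q)"
      have a: "a \<in> carrier C" by (simp add: a_def \<phi>)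
      have "\<phi> (r ql k) = a [^]\<^bsub>C\<^esub> (l ! k)" for k
        using True \<phi>_int[of "l ! k" "1 / of_int q"] by (simp add: r_def ql a_def)
      then have "tensor_component (\<iota> ql) (u n) - (\<Sum>k<n. frag_cmul (l ! k) (frag_of (a, e k)))
          = (\<Sum>k<n. frag_of (a [^]\<^bsub>C\<^esub> (l ! k), e k) - frag_cmul (l ! k) (frag_of (a, e k)))"
        unfolding sum by (simp add: sum_subtractf)
      also have "\<dots> \<in> tensor_relations C M"
        by (intro frag.subspace_sum[OF R] tensor_int_pow_left[OF C(1) M.is_group a e])
      finally have 1: "tensor_component (\<iota> ql) (u n) - frag_extend (\<lambda>k. frag_of (a, e k)) (cl l)
          \<in> tensor_relations C M" by (simp add: cl_extend)
      have 2: "frag_of (a, p [^]\<^bsub>M\<^esub> q) - frag_extend (\<lambda>k. frag_of (a, e k)) (cl l) \<in> tensor_relations C M"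
        unfolding p by (rule tensor_frag_eval_right[OF C.is_group M a e_img cl_keys])
      have 3: "frag_of (a, p [^]\<^bsub>M\<^esub> q) - frag_cmul q (frag_of (a, p)) \<in> tensor_relations C M"
        by (rule tensor_int_pow_right[OF C.is_group M a p(1)])
      have "a [^]\<^bsub>C\<^esub> q = \<one>\<^bsub>C\<^esub>"
        using \<phi>_int[of q "1 / of_int q"] q \<phi>(3)[of 1] by (simp add: a_def)
      then have diff: "frag_of (\<one>\<^bsub>C\<^esub>, p) - frag_cmul q (frag_of (a, p)) \<in> tensor_relations C M"
        using tensor_int_pow_left[OF C(1) M.is_group a p(1), of q] by simp
      have 4: "frag_cmul q (frag_of (a, p)) \<in> tensor_relations C M"
        using frag.subspace_diff[OF R tensor_one_left[OF C(1) M.is_group p(1)] diff]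
        by (simp only: diff_diff_eq2 add_diff_cancel_left')
      have 5: "frag_of (a, p [^]\<^bsub>M\<^esub> q) \<in> tensor_relations C M"
        using frag.subspace_add[OF R 3 4] by (simp only: diff_add_cancel)
      have "frag_extend (\<lambda>k. frag_of (a, e k)) (cl l) \<in> tensor_relations C M"
        using frag.subspace_diff[OF R 5 2] by (simp only: diff_diff_eq2 add_diff_cancel_left')
      from frag.subspace_add[OF R 1 this] show ?thesis by (simp only: diff_add_cancel)
    qed
  qed
  have "u n \<in> tensor_relations P M"
    using mitt[unfolded sharp_Mittag_Leffler_iff_kernel[OF M.is_group], rule_format, of I "\<lambda>_. C" "u n"]
      C(2) u_keys comp unfolding P_def I_def by blast
  from tensor_relation_finite_support[OF P.comm_group_axioms M.is_group this]
  obtain S0 where S0: "finite S0" "S0 \<subseteq> carrier M" and kill: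
    "\<forall>V c. S0 \<subseteq> V \<longrightarrow> (\<forall>u\<in>V. \<forall>v\<in>V. u \<otimes>\<^bsub>M\<^esub> v \<in> V \<longrightarrow> c (u \<otimes>\<^bsub>M\<^esub> v) = c u + c v) \<longrightarrow>
      frag_eval P (\<lambda>(a, v). a [^]\<^bsub>P\<^esub> (c v :: int)) (u n) = \<one>\<^bsub>P\<^esub>"
    by (elim exE conjE)
  \<comment> \<open>The support of the relation makes coordinate functions applicable to
    \<open>u n\<close>; the elements \<open>e k\<close> are added so that their own coordinates make
    sense.\<close>
  define S where "S = S0 \<union> e ` {..<n}"
  have S: "finite S" "S \<subseteq> carrier M" using S0 e by (auto simp: S_def)
  let ?K = M.torsion_frags
  note K = M.subspace_torsion_frags
  obtain y and J :: "'m set" where y: "int_span ?K y J = int_span ?K frag_of S" "int_indep ?K y J"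
    by (rule M.finite_basis_mod_torsion[OF S])
  let ?V = "int_span ?K y J"
  have V_keys: "?V \<subseteq> {w. Poly_Mapping.keys w \<subseteq> carrier M}"
    unfolding y(1) using S by (intro M.int_span_torsion_frags_keys) auto
  have eV: "frag_of (e k) \<in> ?V" if "k < n" for k
    unfolding y(1) using that by (intro int_span_gen[OF K]) (auto simp: S_def)
  define co where "co b v = Poly_Mapping.lookup (int_coord ?K y J (frag_of v)) b" for b v
  \<comment> \<open>Applying the \<open>b\<close>-th coordinate function to the second factors of
    \<open>u n\<close> and projecting to the index \<open>ql\<close> gives the class of this sum.
    The tensor vanishes, so the class is trivial and the sum is an integer.\<close>
  have integral: "(\<Sum>k<n. of_int (co b (e k)) * r ql k) \<in> \<int>" for b ql
  proof -
    let ?F = "\<lambda>(a, v). a [^]\<^bsub>P\<^esub> co b v"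
    have \<iota>I: "\<iota> ql \<in> I" by (simp add: I_def)
    interpret pr: group_hom P C "\<lambda>x. x (\<iota> ql)"
      unfolding P_def by (rule product_group_projection[of I "\<lambda>_. C"]) (use \<iota>I C.is_group in auto)
    have F_img: "?F ` (carrier P \<times> carrier M) \<subseteq> carrier P" by auto
    have eval: "frag_eval P ?F (u m) (\<iota> ql) = \<phi> (\<Sum>k<m. of_int (co b (e k)) * r ql k)" for m
    proof (induction m)
      case 0
      then show ?case using pr.hom_one \<phi>(3)[of 0] by (simp add: u_def)
    next
      case (Suc m)
      have "frag_eval P ?F (u (Suc m)) = frag_eval P ?F (u m) \<otimes>\<^bsub>P\<^esub> frag_eval P ?F (frag_of (d m, e m))"
        unfolding u_def sum.lessThan_Suc
        by (rule P.frag_eval_add[OF F_img]) (use u_keys[of m] d e in \<open>auto simp: u_def\<close>)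
      also have "frag_eval P ?F (frag_of (d m, e m)) = d m [^]\<^bsub>P\<^esub> co b (e m)"
        using d by simp
      finally have "frag_eval P ?F (u (Suc m)) = frag_eval P ?F (u m) \<otimes>\<^bsub>P\<^esub> d m [^]\<^bsub>P\<^esub> co b (e m)" .
      then have "frag_eval P ?F (u (Suc m)) (\<iota> ql) =
          frag_eval P ?F (u m) (\<iota> ql) \<otimes>\<^bsub>C\<^esub> d m (\<iota> ql) [^]\<^bsub>C\<^esub> co b (e m)"
        using pr.hom_mult[of "frag_eval P ?F (u m)" "d m [^]\<^bsub>P\<^esub> co b (e m)"]
          pr.hom_int_pow[OF d[of m], of "co b (e m)"] P.frag_eval_closed[OF F_img u_keys[of m]] d
        by simp
      then show ?case by (simp add: Suc d_at \<phi>_int \<phi>(2))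
    qed
    have one: "frag_eval P ?F (u n) = \<one>\<^bsub>P\<^esub>"
    proof (rule kill[THEN spec, THEN spec, THEN mp, THEN mp])
      show "S0 \<subseteq> {v \<in> carrier M. frag_of v \<in> ?V}"
        unfolding y(1) using S0 by (auto simp: S_def intro: int_span_gen[OF K])
      show "\<forall>v\<in>{v \<in> carrier M. frag_of v \<in> ?V}. \<forall>w\<in>{v \<in> carrier M. frag_of v \<in> ?V}.
          v \<otimes>\<^bsub>M\<^esub> w \<in> {v \<in> carrier M. frag_of v \<in> ?V} \<longrightarrow> co b (v \<otimes>\<^bsub>M\<^esub> w) = co b v + co b w"
        by (simp add: co_def M.int_coord_frag_of_mult[OF y(2)] Poly_Mapping.lookup_add)
    qed
    have "\<phi> (\<Sum>k<n. of_int (co b (e k)) * r ql k) = \<one>\<^bsub>C\<^esub>"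
      using eval[of n] pr.hom_one unfolding one by (rule trans[OF sym])
    then show ?thesis by (simp only: \<phi>(3))
  qed
  have "frag_of p \<in> int_span ?K frag_of S"
    if p: "p \<in> carrier M" and q: "q \<noteq> 0" and c: "Poly_Mapping.keys c \<subseteq> {..<n}"
      and pq: "p [^]\<^bsub>M\<^esub> (q :: int) = frag_eval M e c" for p q c
  proof -
    define l where "l = map (Poly_Mapping.lookup c) [0..<n]"
    have l: "length l = n" "\<And>k. k < n \<Longrightarrow> l ! k = Poly_Mapping.lookup c k" by (auto simp: l_def)
    have "cl l = c"
    proof (rule poly_mapping_eqI)
      show "Poly_Mapping.lookup (cl l) k = Poly_Mapping.lookup c k" for k
        using c by (auto simp: cl_def lookup_sum l if_distrib[of "(*) _"] in_keys_iff cong: if_cong)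
    qed
    then have valid: "valid (q, l)" using p q pq l by (auto simp: valid_def)
    define w where "w = frag_extend (\<lambda>k. frag_of (e k)) c"
    have wV: "w \<in> ?V" unfolding w_def
      using c eV by (intro frag_extend_mem subspace_int_span K) auto
    define D where "D = int_coord ?K y J w"
    have D: "Poly_Mapping.keys D \<subseteq> J" "w - frag_extend y D \<in> ?K" using int_coord[OF wV] by (simp_all add: D_def)
    \<comment> \<open>The coordinate of \<open>w\<close> at \<open>b\<close> is the sum of
      \<open>l ! k * co b (e k)\<close>, that is, \<open>q\<close> times the integer found in
      \<open>integral\<close>.\<close>
    have dvd: "q dvd Poly_Mapping.lookup D b" for b
    proof -
      have "D = frag_extend (\<lambda>k. int_coord ?K y J (frag_of (e k))) (cl l)"
        unfolding D_def w_def \<open>cl l = c\<close> using eV c by (intro int_coord_frag_extend[OF K y(2)]) auto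
      then have "Poly_Mapping.lookup D b = (\<Sum>k<n. l ! k * co b (e k))"
        by (simp add: cl_extend lookup_sum co_def)
      then have "(of_int (Poly_Mapping.lookup D b) :: rat) = of_int q * (\<Sum>k<n. of_int (co b (e k)) * r (q, l) k)"
        using q by (simp add: r_def valid sum_distrib_left mult.commute)
      moreover obtain z where "(\<Sum>k<n. of_int (co b (e k)) * r (q, l) k) = of_int z"
        using integral[of b "(q, l)"] by (rule Ints_cases)
      ultimately have "(of_int (Poly_Mapping.lookup D b) :: rat) = of_int (q * z)" by simp
      then show ?thesis by (simp only: of_int_eq_iff) simp
    qed
    \<comment> \<open>The quotient \<open>D'\<close> is the candidate for the coordinates of
      \<open>p\<close>: \<open>q\<close> times the difference is torsion, and torsion-freeness of
      the quotient removes the factor \<open>q\<close>.\<close>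
    obtain D' where D': "Poly_Mapping.keys D' \<subseteq> Poly_Mapping.keys D" "frag_cmul q D' = D"
      by (rule frag_divide[OF dvd])
    have w_keys: "Poly_Mapping.keys w \<subseteq> carrier M" using wV V_keys by blast
    have p_keys: "Poly_Mapping.keys (frag_cmul q (frag_of p)) \<subseteq> carrier M" using p by auto
    have "frag_eval M id w = frag_eval M (\<lambda>k. frag_eval M id (frag_of (e k))) c"
      unfolding w_def by (rule M.frag_eval_frag_extend[of id "carrier M" c UNIV]) (use e in auto)
    also have "\<dots> = frag_eval M e c" using e by simp
    also have "\<dots> = frag_eval M id (frag_cmul q (frag_of p))"
      using pq p M.frag_eval_cmul[of id "carrier M" "frag_of p" q] by simp
    finally have "M.mod_torsion (frag_cmul q (frag_of p)) = M.mod_torsion w"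
      by (simp add: M.mod_torsion_def)
    then have "frag_cmul q (frag_of p) - w \<in> ?K"
      using M.mod_torsion_eq_iff[OF p_keys w_keys] by simp
    from frag.subspace_add[OF K this D(2)]
    have "frag_cmul q (frag_of p - frag_extend y D') \<in> ?K"
      by (simp add: frag.scale_right_diff_distrib frag_extend_cmul[symmetric] D'(2))
    moreover have "Poly_Mapping.keys (frag_of p - frag_extend y D') \<subseteq> carrier M"
    proof (rule keys_subset_Un_diff)
      have "frag_extend y D' \<in> ?V"
        using D' D by (intro frag_extend_mem subspace_int_span K int_span_gen) auto
      then show "Poly_Mapping.keys (frag_extend y D') \<subseteq> carrier M" using V_keys by blast
    qed (use p in auto)
    ultimately have "frag_of p - frag_extend y D' \<in> ?K"
      using M.pure_torsion_frags q unfolding pure_in_def by blast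
    then show ?thesis unfolding y(1)[symmetric] using D' D by (intro int_spanI[of D']) auto
  qed
  then show ?thesis using S by blast
qed

section \<open>From bounded pure closures to aleph_1-freeness\<close>

context comm_group
begin

lemma mod_torsion_uminus:
  assumes w: "Poly_Mapping.keys w \<subseteq> carrier G"
  shows "mod_torsion (- w) = inv\<^bsub>G Mod torsion_subgroup G\<^esub> mod_torsion w"
proof -
  interpret Q: comm_group "G Mod torsion_subgroup G" by (rule comm_group_mod_torsion)
  have w': "Poly_Mapping.keys (- w) \<subseteq> carrier G" using w by simp
  have "mod_torsion (- w) \<otimes>\<^bsub>G Mod torsion_subgroup G\<^esub> mod_torsion w = \<one>\<^bsub>G Mod torsion_subgroup G\<^esub>"
    using mod_torsion_add[OF w' w] mod_torsion_0 by simp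
  from Q.inv_equality[OF this mod_torsion_closed[OF w] mod_torsion_closed[OF w']]
  show ?thesis by simp
qed

lemma subspace_mod_torsion_vimage:
  assumes H: "subgroup H (G Mod torsion_subgroup G)"
  shows "frag.subspace {w. Poly_Mapping.keys w \<subseteq> carrier G \<and> mod_torsion w \<in> H}"
proof (rule frag_subspaceI)
  show "0 \<in> {w. Poly_Mapping.keys w \<subseteq> carrier G \<and> mod_torsion w \<in> H}"
    using subgroup.one_closed[OF H] by (simp add: mod_torsion_0)
  fix v w assume "v \<in> {w. Poly_Mapping.keys w \<subseteq> carrier G \<and> mod_torsion w \<in> H}"
    "w \<in> {w. Poly_Mapping.keys w \<subseteq> carrier G \<and> mod_torsion w \<in> H}"
  then have vw: "Poly_Mapping.keys v \<subseteq> carrier G" "Poly_Mapping.keys w \<subseteq> carrier G"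
    "mod_torsion v \<in> H" "mod_torsion w \<in> H" by auto
  have w': "Poly_Mapping.keys (- w) \<subseteq> carrier G" using vw by simp
  have "mod_torsion (v + - w) \<in> H"
    unfolding mod_torsion_add[OF vw(1) w'] mod_torsion_uminus[OF vw(2)]
    using vw by (intro subgroup.m_closed[OF H] subgroup.m_inv_closed[OF H])
  then show "v - w \<in> {w. Poly_Mapping.keys w \<subseteq> carrier G \<and> mod_torsion w \<in> H}"
    using keys_subset_Un_diff[OF vw(1,2)] by simp
qed

text \<open>Sending coefficients \<open>c\<close> to the class of \<open>frag_extend b c\<close> is
  an isomorphism from the free group on \<open>I\<close>: independence modulo torsion gives
  injectivity, and the span condition gives surjectivity.\<close>

lemma free_abelian_of_int_basis:
  assumes S: "S \<subseteq> carrier (G Mod torsion_subgroup G)"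
    and span: "int_span torsion_frags b I =
      {w. Poly_Mapping.keys w \<subseteq> carrier G \<and> mod_torsion w \<in> carrier (subgroup_generated (G Mod torsion_subgroup G) S)}"
    and indep: "int_indep torsion_frags b I"
  shows "free_abelian (subgroup_generated (G Mod torsion_subgroup G) S)"
proof -
  let ?Q = "G Mod torsion_subgroup G" and ?K = torsion_frags
  note K = subspace_torsion_frags
  interpret Q: comm_group ?Q by (rule comm_group_mod_torsion)
  define H where "H = subgroup_generated ?Q S"
  define \<psi> where "\<psi> c = mod_torsion (frag_extend b c)" for c
  have ext: "Poly_Mapping.keys (frag_extend b c) \<subseteq> carrier G" "\<psi> c \<in> carrier H"
    if "Poly_Mapping.keys c \<subseteq> I" for c
  proof -
    have "frag_extend b c \<in> int_span ?K b I"
      using that by (intro frag_extend_mem subspace_int_span K int_span_gen) auto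
    then show "Poly_Mapping.keys (frag_extend b c) \<subseteq> carrier G" "\<psi> c \<in> carrier H"
      unfolding span by (auto simp: \<psi>_def H_def)
  qed
  have inj: "c = d" if "Poly_Mapping.keys c \<subseteq> I" "Poly_Mapping.keys d \<subseteq> I" "\<psi> c = \<psi> d" for c d
  proof -
    have "frag_extend b (c - d) \<in> ?K"
      using that ext by (simp add: \<psi>_def mod_torsion_eq_iff frag_extend_diff)
    then have "c - d = 0"
      using indep keys_subset_Un_diff[OF that(1,2)] unfolding int_indep_def by blast
    then show ?thesis by simp
  qed
  have "\<psi> \<in> hom (free_Abelian_group I) H"
  proof (rule homI)
    show "\<psi> (x \<otimes>\<^bsub>free_Abelian_group I\<^esub> y) = \<psi> x \<otimes>\<^bsub>H\<^esub> \<psi> y"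
      if "x \<in> carrier (free_Abelian_group I)" "y \<in> carrier (free_Abelian_group I)" for x y
      using that ext(1) by (simp add: \<psi>_def H_def frag_extend_add mod_torsion_add)
  qed (use ext in auto)
  moreover have "bij_betw \<psi> (carrier (free_Abelian_group I)) (carrier H)"
  proof (rule bij_betw_imageI)
    show "inj_on \<psi> (carrier (free_Abelian_group I))"
      by (rule inj_onI) (use inj in auto)
    show "\<psi> ` carrier (free_Abelian_group I) = carrier H"
    proof
      show "\<psi> ` carrier (free_Abelian_group I) \<subseteq> carrier H" using ext by auto
      show "carrier H \<subseteq> \<psi> ` carrier (free_Abelian_group I)"
      proof
        fix y assume y: "y \<in> carrier H"
        then have "y \<in> carrier ?Q"
          using Q.carrier_subgroup_generated_subset[of S] unfolding H_def by blast
        then obtain a where a: "a \<in> carrier G" "mod_torsion (frag_of a) = y" by (rule mod_torsion_surj)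
        then have "frag_of a \<in> int_span ?K b I" using y unfolding span H_def by simp
        then obtain c where c: "Poly_Mapping.keys c \<subseteq> I" "frag_of a - frag_extend b c \<in> ?K"
          by (rule int_spanE)
        then have "\<psi> c = y"
          using a ext(1)[OF c(1)] mod_torsion_eq_iff[of "frag_of a" "frag_extend b c"] by (simp add: \<psi>_def)
        then show "y \<in> \<psi> ` carrier (free_Abelian_group I)" using c by auto
      qed
    qed
  qed
  ultimately have "free_Abelian_group I \<cong> H" by (auto simp: is_iso_def iso_def)
  then have HI: "H \<cong> free_Abelian_group I" by (rule group.iso_sym[OF group_free_Abelian_group])
  \<comment> \<open>\<open>free_abelian\<close> asks for an index set of group elements, so
    \<open>I\<close> is replaced by the equipotent set of the actual basis elements.\<close>
  let ?B = "(\<lambda>i. \<psi> (frag_of i)) ` I"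
  have "inj_on (\<lambda>i. \<psi> (frag_of i)) I"
  proof (rule inj_onI)
    fix i j assume "i \<in> I" "j \<in> I" "\<psi> (frag_of i) = \<psi> (frag_of j)"
    then have "frag_of i = frag_of j" by (intro inj) auto
    then show "i = j" by (simp add: frag_of_eq)
  qed
  then have "I \<approx> ?B" by (simp add: inj_on_image_eqpoll_self eqpoll_sym)
  then have "free_Abelian_group I \<cong> free_Abelian_group ?B"
    by (simp add: isomorphic_free_Abelian_groups)
  from iso_trans[OF HI this] show ?thesis unfolding free_abelian_def H_def by blast
qed

end

lemma Mittag_Leffler_imp_aleph1_free:
  fixes M :: "('m, 'x) monoid_scheme"
  assumes M: "comm_group M"
    and inf: "infinite (UNIV :: 'i set)" "infinite (UNIV :: 'n set)"
    and mitt: "sharp_Mittag_Leffler TYPE('i) TYPE('n) M"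
  shows "aleph1_free (M Mod torsion_subgroup M)"
  unfolding aleph1_free_def
proof (intro conjI allI impI)
  interpret M: comm_group M by fact
  let ?Q = "M Mod torsion_subgroup M" and ?K = M.torsion_frags
  note K = M.subspace_torsion_frags
  show "comm_group ?Q" by (rule M.comm_group_mod_torsion)
  then interpret Q: comm_group ?Q .
  fix S assume S: "S \<subseteq> carrier ?Q" "countable S"
  define H where "H = subgroup_generated ?Q S"
  have H: "subgroup (carrier H) ?Q" unfolding H_def by (rule Q.subgroup_subgroup_generated)
  have SH: "S \<subseteq> carrier H" unfolding H_def using S(1) by (rule Q.subgroup_generated_subset_carrier_subset)
  \<comment> \<open>Adding the unit makes the countable generating set nonempty, so that
    \<open>from_nat_into\<close> enumerates it.\<close>
  define S' where "S' = insert \<one>\<^bsub>?Q\<^esub> S"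
  have S': "countable S'" "S' \<noteq> {}" "S' \<subseteq> carrier H"
    using S SH subgroup.one_closed[OF H] by (auto simp: S'_def)
  have "\<exists>a. a \<in> carrier M \<and> M.mod_torsion (frag_of a) = from_nat_into S' n" for n
  proof -
    have "from_nat_into S' n \<in> carrier ?Q"
      using from_nat_into[OF S'(2)] S'(3) subgroup.subset[OF H] by blast
    then show ?thesis by (rule M.mod_torsion_surj) blast
  qed
  then obtain e where e: "\<And>n. e n \<in> carrier M" "\<And>n. M.mod_torsion (frag_of (e n)) = from_nat_into S' n"
    by metis
  define h where "h n = frag_of (e n)" for n :: nat
  have h_keys: "Poly_Mapping.keys (h n) \<subseteq> carrier M" for n using e by (simp add: h_def)
  define V where "V = {w. Poly_Mapping.keys w \<subseteq> carrier M \<and> M.mod_torsion w \<in> carrier H}"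
  have V: "frag.subspace V" unfolding V_def by (rule M.subspace_mod_torsion_vimage[OF H])
  have KV: "?K \<subseteq> V"
  proof
    fix w assume w: "w \<in> ?K"
    then have "Poly_Mapping.keys w \<subseteq> carrier M" using M.torsion_frags_keys by blast
    moreover from this w have "M.mod_torsion w = M.mod_torsion 0" by (subst M.mod_torsion_eq_iff) auto
    ultimately show "w \<in> V" using subgroup.one_closed[OF H] by (simp add: V_def M.mod_torsion_0)
  qed
  have pure: "pure_in ?K V" using M.pure_torsion_frags unfolding pure_in_def V_def by blast
  have hV: "h n \<in> V" for n
    using from_nat_into[OF S'(2), of n] S'(3) e h_keys by (auto simp: V_def h_def)
  let ?U = "int_span ?K h UNIV"
  note U = subspace_int_span[OF K, of h UNIV]
  have mem_U: "w \<in> ?U" if "v \<in> ?U" "M.mod_torsion w = M.mod_torsion v"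
    "Poly_Mapping.keys v \<subseteq> carrier M" "Poly_Mapping.keys w \<subseteq> carrier M" for v w
  proof -
    have "w - v \<in> ?K" using that M.mod_torsion_eq_iff by blast
    then have "(w - v) + v \<in> ?U" by (intro frag.subspace_add[OF U] int_span_base that(1))
    then show ?thesis by simp
  qed
  have lift_S: "\<exists>n. M.mod_torsion (h n) = y" if "y \<in> S" for y
    using that e(2) S'(1) from_nat_into_surj[of S' y] by (auto simp: S'_def h_def)
  have gen: "w \<in> ?U" if "y \<in> generate ?Q S" "Poly_Mapping.keys w \<subseteq> carrier M" "M.mod_torsion w = y" for y w
    using that
  proof (induction arbitrary: w rule: generate.induct)
    case one
    show ?case by (rule mem_U[of 0]) (use one frag.subspace_0[OF U] in \<open>auto simp: M.mod_torsion_0\<close>)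
  next
    case (incl y)
    then obtain n where n: "M.mod_torsion (h n) = y" using lift_S by blast
    show ?case
    proof (rule mem_U[of "h n"])
      show "h n \<in> ?U" by (rule int_span_gen[OF K]) simp
    qed (use incl n h_keys[of n] in auto)
  next
    case (inv y)
    then obtain n where n: "M.mod_torsion (h n) = y" using lift_S by blast
    show ?case
    proof (rule mem_U[of "- h n"])
      show "- h n \<in> ?U" by (intro frag.subspace_neg[OF U] int_span_gen[OF K]) auto
    qed (use inv n h_keys[of n] M.mod_torsion_uminus[OF h_keys[of n]] in auto)
  next
    case (eng y z)
    have yz: "y \<in> carrier ?Q" "z \<in> carrier ?Q"
      using eng Q.generate_in_carrier[OF S(1)] by auto
    obtain a where a: "a \<in> carrier M" "M.mod_torsion (frag_of a) = y"
      using yz(1) by (rule M.mod_torsion_surj)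
    obtain b where b: "b \<in> carrier M" "M.mod_torsion (frag_of b) = z"
      using yz(2) by (rule M.mod_torsion_surj)
    show ?case
    proof (rule mem_U[of "frag_of a + frag_of b"])
      show "frag_of a + frag_of b \<in> ?U"
      proof (rule frag.subspace_add[OF U])
        show "frag_of a \<in> ?U" by (rule eng.IH(1)) (use a in auto)
        show "frag_of b \<in> ?U" by (rule eng.IH(2)) (use b in auto)
      qed
      show "M.mod_torsion w = M.mod_torsion (frag_of a + frag_of b)"
        using eng a b by (simp add: M.mod_torsion_add)
      show "Poly_Mapping.keys (frag_of a + frag_of b) \<subseteq> carrier M"
        using a b keys_add[of "frag_of a" "frag_of b"] by auto
    qed (use eng in simp)
  qed
  have VU: "V \<subseteq> ?U"
  proof
    fix w assume "w \<in> V"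
    then show "w \<in> ?U"
      using gen[of "M.mod_torsion w" w] S(1) by (auto simp: V_def H_def carrier_subgroup_generated Int_absorb1)
  qed
  have bounded: "\<exists>x (T :: 'm set). finite T \<and>
      {v \<in> V. \<exists>q. q \<noteq> 0 \<and> frag_cmul q v \<in> int_span ?K h {..<n}} \<subseteq> int_span ?K x T" for n
  proof -
    obtain T where T: "finite T" "T \<subseteq> carrier M"
      and pT: "\<forall>p\<in>carrier M. \<forall>q c. q \<noteq> 0 \<longrightarrow> Poly_Mapping.keys c \<subseteq> {..<n} \<longrightarrow>
        p [^]\<^bsub>M\<^esub> (q :: int) = frag_eval M e c \<longrightarrow> frag_of p \<in> int_span ?K frag_of T"
      using Mittag_Leffler_pure_closure_bounded[where e = e and n = n, OF M inf mitt e(1)] by (elim exE conjE)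
    have "v \<in> int_span ?K frag_of T"
      if v: "v \<in> V" and q: "q \<noteq> 0" and qv: "frag_cmul q v \<in> int_span ?K h {..<n}" for v q
    proof -
      obtain c where c: "Poly_Mapping.keys c \<subseteq> {..<n}" "frag_cmul q v - frag_extend h c \<in> ?K"
        using qv by (rule int_spanE)
      then obtain m :: nat where m: "m > 0"
        "frag_eval M id (frag_cmul q v - frag_extend h c) [^]\<^bsub>M\<^esub> m = \<one>\<^bsub>M\<^esub>"
        by (auto simp: M.torsion_frags_def torsion_subgroup_def)
      have v_keys: "Poly_Mapping.keys v \<subseteq> carrier M" using v by (simp add: V_def)
      have h_ext_keys: "Poly_Mapping.keys (frag_extend h d) \<subseteq> carrier M" for d
        using keys_frag_extend[of h d] h_keys by blast
      \<comment> \<open>The bound on pure closures needs an exact equation in \<open>M\<close>,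
        whereas \<open>q v\<close> equals the combination of the \<open>h k\<close> only up to
        torsion. Multiplying by an exponent \<open>m\<close> that kills the error turns it into an
        exact equation with divisor \<open>m q\<close> and coefficients \<open>m c\<close>.\<close>
      let ?p = "frag_eval M id v" and ?mc = "frag_cmul (int m) c" and ?mq = "int m * q"
      have p: "?p \<in> carrier M" using v_keys by simp
      have mq_keys: "Poly_Mapping.keys (frag_cmul ?mq v) \<subseteq> carrier M" using v_keys keys_cmul by blast
      have diff_keys: "Poly_Mapping.keys (frag_cmul q v - frag_extend h c) \<subseteq> carrier M"
        using v_keys keys_cmul by (intro keys_subset_Un_diff h_ext_keys) blast
      have "frag_eval M id (frag_cmul (int m) (frag_cmul q v - frag_extend h c)) = \<one>\<^bsub>M\<^esub>"
        using M.frag_eval_cmul[OF _ diff_keys, of id "int m"] m(2) by (simp add: int_pow_int)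
      then have "frag_eval M id (frag_cmul ?mq v - frag_extend h ?mc) = \<one>\<^bsub>M\<^esub>"
        by (simp add: frag.scale_right_diff_distrib frag_extend_cmul)
      then have "frag_eval M id (frag_cmul ?mq v) \<otimes>\<^bsub>M\<^esub> inv\<^bsub>M\<^esub> frag_eval M id (frag_extend h ?mc) = \<one>\<^bsub>M\<^esub>"
        using M.frag_eval_diff[OF _ mq_keys h_ext_keys, of id] by simp
      then have "frag_eval M id (frag_cmul ?mq v) = frag_eval M id (frag_extend h ?mc)"
        using M.inv_equality[of "frag_eval M id (frag_cmul ?mq v)" "inv\<^bsub>M\<^esub> frag_eval M id (frag_extend h ?mc)"]
          mq_keys h_ext_keys by simp
      then have "?p [^]\<^bsub>M\<^esub> ?mq = frag_eval M id (frag_extend h ?mc)"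
        using M.frag_eval_cmul[OF _ v_keys, of id ?mq] by simp
      also have "\<dots> = frag_eval M (\<lambda>i. frag_eval M id (h i)) ?mc"
        by (rule M.frag_eval_frag_extend[of id "carrier M" _ UNIV]) (use h_keys in auto)
      also have "\<dots> = frag_eval M e ?mc" using e by (simp add: h_def)
      finally have "frag_of ?p \<in> int_span ?K frag_of T"
        using pT[rule_format, OF p, of ?mq ?mc] q m c keys_cmul[of "int m" c] by auto
      moreover have "v - frag_of ?p \<in> int_span ?K frag_of T"
        by (rule int_span_base[OF M.frag_of_frag_eval[OF v_keys]])
      ultimately have "(v - frag_of ?p) + frag_of ?p \<in> int_span ?K frag_of T"
        by (intro frag.subspace_add subspace_int_span K)
      then show ?thesis by simp
    qed
    then show ?thesis using T by blast
  qed
  obtain b and I :: "(nat \<times> 'm) set" where b: "int_span ?K b I = V" "int_indep ?K b I"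
    using Pontryagin_criterion[OF K V KV pure hV VU bounded] by blast
  show "free_abelian (subgroup_generated ?Q S)"
    by (rule M.free_abelian_of_int_basis[OF S(1) _ b(2)]) (simp add: b(1) V_def H_def)
qed

section \<open>Tensors over a free pure subgroup\<close>

text \<open>If \<open>t [^] n\<close> is trivial and \<open>y [^] n = x\<close>, then
  \<open>x \<otimes> t\<close> equals \<open>n (y \<otimes> t)\<close>, which equals
  \<open>y \<otimes> t [^] n\<close>, and this vanishes.\<close>

lemma tensor_torsion_zero:
  assumes D: "comm_group D" and M: "comm_group M"
    and div: "\<And>n a. n > 0 \<Longrightarrow> a \<in> carrier D \<Longrightarrow> \<exists>c\<in>carrier D. c [^]\<^bsub>D\<^esub> (n :: nat) = a"
    and x: "x \<in> carrier D" and t: "t \<in> torsion_subgroup M"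
  shows "frag_of (x, t) \<in> tensor_relations D M"
proof -
  interpret D: comm_group D by fact
  interpret M: comm_group M by fact
  note R = subspace_tensor_relations(1)[OF D.is_group M.is_group]
  obtain n :: nat where n: "n > 0" "t [^]\<^bsub>M\<^esub> n = \<one>\<^bsub>M\<^esub>" and tM: "t \<in> carrier M"
    using t by (auto simp: torsion_subgroup_def)
  obtain y where y: "y \<in> carrier D" "y [^]\<^bsub>D\<^esub> n = x" using div[OF n(1) x] by blast
  have 1: "frag_of (x, t) - frag_cmul (int n) (frag_of (y, t)) \<in> tensor_relations D M"
    using tensor_int_pow_left[OF D M.is_group y(1) tM, of "int n"] y(2) by (simp add: int_pow_int)
  have 2: "frag_of (y, \<one>\<^bsub>M\<^esub>) - frag_cmul (int n) (frag_of (y, t)) \<in> tensor_relations D M"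
    using tensor_int_pow_right[OF D.is_group M y(1) tM, of "int n"] n(2) by (simp add: int_pow_int)
  have 3: "frag_of (y, \<one>\<^bsub>M\<^esub>) \<in> tensor_relations D M"
    using tensor_int_pow_right[OF D.is_group M y(1) M.one_closed, of 0] by simp
  have "frag_cmul (int n) (frag_of (y, t)) \<in> tensor_relations D M"
    using frag.subspace_diff[OF R 3 2] by (simp only: diff_diff_eq2 add_diff_cancel_left')
  from frag.subspace_add[OF R 1 this] show ?thesis by (simp only: diff_add_cancel)
qed

text \<open>A pair \<open>(x, m)\<close> is expanded along the coordinates \<open>c\<close> of
  \<open>m\<close> modulo torsion: the torsion error dies against a divisible group, and the
  integers move to the left factor as powers of \<open>x\<close>. The coefficients of a difference
  are quotients of coefficients.\<close>

lemma tensor_reduce_to_basis: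
  fixes D :: "('a, 'x) monoid_scheme" and M :: "('b, 'y) monoid_scheme"
  assumes D: "comm_group D" and M: "comm_group M"
    and div: "\<And>n a. n > 0 \<Longrightarrow> a \<in> carrier D \<Longrightarrow> \<exists>c\<in>carrier D. c [^]\<^bsub>D\<^esub> (n :: nat) = a"
    and J: "finite J" "\<And>j. j \<in> J \<Longrightarrow> \<epsilon> j \<in> carrier M"
    and A: "A \<subseteq> carrier M" "\<And>m. m \<in> A \<Longrightarrow> \<exists>c. Poly_Mapping.keys c \<subseteq> J \<and>
      frag_of m - frag_extend (\<lambda>j. frag_of (\<epsilon> j)) c \<in> comm_group.torsion_frags M"
    and u: "Poly_Mapping.keys u \<subseteq> carrier D \<times> A"
  shows "\<exists>\<delta>. (\<forall>j. \<delta> j \<in> carrier D) \<and> u - (\<Sum>j\<in>J. frag_of (\<delta> j, \<epsilon> j)) \<in> tensor_relations D M"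
  using u
proof (induction u rule: frag_induction)
  interpret D: comm_group D by fact
  interpret M: comm_group M by fact
  let ?R = "tensor_relations D M"
  note R = subspace_tensor_relations(1)[OF D.is_group M.is_group]
  case zero
  have "- (\<Sum>j\<in>J. frag_of (\<one>\<^bsub>D\<^esub>, \<epsilon> j)) \<in> ?R"
    by (intro frag.subspace_neg[OF R] frag.subspace_sum[OF R] tensor_one_left[OF D M.is_group] J)
  then show ?case by (intro exI[of _ "\<lambda>_. \<one>\<^bsub>D\<^esub>"]) simp
next
  interpret D: comm_group D by fact
  interpret M: comm_group M by fact
  let ?R = "tensor_relations D M"
  note R = subspace_tensor_relations(1)[OF D.is_group M.is_group]
  case (one p)
  then obtain x m where p: "p = (x, m)" "x \<in> carrier D" "m \<in> A" by auto
  obtain c where c: "Poly_Mapping.keys c \<subseteq> J"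
    "frag_of m - frag_extend (\<lambda>j. frag_of (\<epsilon> j)) c \<in> M.torsion_frags" using A(2)[OF p(3)] by blast
  let ?w = "frag_of m - frag_extend (\<lambda>j. frag_of (\<epsilon> j)) c"
  let ?\<Phi> = "frag_extend (\<lambda>v. frag_of (x, v))"
  have w: "Poly_Mapping.keys ?w \<subseteq> carrier M" "frag_eval M id ?w \<in> torsion_subgroup M"
    using c(2) unfolding M.torsion_frags_def by auto
  have "frag_of (x, frag_eval M id ?w) - frag_extend (\<lambda>v. frag_of (x, id v)) ?w \<in> ?R"
    by (rule tensor_frag_eval_right[OF D.is_group M p(2) _ w(1)]) auto
  then have 1: "frag_of (x, frag_eval M id ?w) - ?\<Phi> ?w \<in> ?R" by (simp only: id_apply)
  have 2: "frag_of (x, frag_eval M id ?w) \<in> ?R"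
    by (rule tensor_torsion_zero[OF D M div p(2) w(2)])
  have "?\<Phi> ?w \<in> ?R"
    using frag.subspace_diff[OF R 2 1] by (simp only: diff_diff_eq2 add_diff_cancel_left')
  then have 3: "frag_of (x, m) - frag_extend (\<lambda>j. frag_of (x, \<epsilon> j)) c \<in> ?R"
    by (simp add: frag_extend_diff frag_extend_frag_extend)
  have sum: "frag_extend (\<lambda>j. frag_of (x, \<epsilon> j)) c =
      (\<Sum>j\<in>J. frag_cmul (Poly_Mapping.lookup c j) (frag_of (x, \<epsilon> j)))"
    unfolding frag_extend_def using c(1) J(1)
    by (intro sum.mono_neutral_left) (auto simp: in_keys_iff)
  have "(\<Sum>j\<in>J. frag_of (x [^]\<^bsub>D\<^esub> Poly_Mapping.lookup c j, \<epsilon> j)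
      - frag_cmul (Poly_Mapping.lookup c j) (frag_of (x, \<epsilon> j))) \<in> ?R"
    by (intro frag.subspace_sum[OF R] tensor_int_pow_left[OF D M.is_group p(2)] J)
  then have 4: "(\<Sum>j\<in>J. frag_of (x [^]\<^bsub>D\<^esub> Poly_Mapping.lookup c j, \<epsilon> j))
      - frag_extend (\<lambda>j. frag_of (x, \<epsilon> j)) c \<in> ?R" by (simp only: sum sum_subtractf)
  have "frag_of (x, m) - (\<Sum>j\<in>J. frag_of (x [^]\<^bsub>D\<^esub> Poly_Mapping.lookup c j, \<epsilon> j)) \<in> ?R"
    using frag.subspace_diff[OF R 3 4] by (simp only: diff_diff_eq2 diff_add_cancel diff_diff_add)
  then show ?case using p by (intro exI[of _ "\<lambda>j. x [^]\<^bsub>D\<^esub> Poly_Mapping.lookup c j"]) simp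
next
  interpret D: comm_group D by fact
  interpret M: comm_group M by fact
  let ?R = "tensor_relations D M"
  note R = subspace_tensor_relations(1)[OF D.is_group M.is_group]
  case (diff v w)
  obtain \<delta> where \<delta>: "\<forall>j. \<delta> j \<in> carrier D" "v - (\<Sum>j\<in>J. frag_of (\<delta> j, \<epsilon> j)) \<in> ?R"
    using diff by blast
  obtain \<eta> where \<eta>: "\<forall>j. \<eta> j \<in> carrier D" "w - (\<Sum>j\<in>J. frag_of (\<eta> j, \<epsilon> j)) \<in> ?R"
    using diff by blast
  let ?d = "\<lambda>j. \<delta> j \<otimes>\<^bsub>D\<^esub> inv\<^bsub>D\<^esub> \<eta> j"
  have d: "?d j \<in> carrier D" for j using \<delta> \<eta> by simp
  have "?d j \<otimes>\<^bsub>D\<^esub> \<eta> j = \<delta> j" for j using \<delta> \<eta> by (simp add: D.m_assoc)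
  then have "frag_of (\<delta> j, \<epsilon> j) - frag_of (?d j, \<epsilon> j) - frag_of (\<eta> j, \<epsilon> j) \<in> ?R" if "j \<in> J" for j
    using tensor_add_left[OF d[of j] \<eta>(1)[THEN spec, of j] J(2)[OF that]] by simp
  then have "(\<Sum>j\<in>J. frag_of (\<delta> j, \<epsilon> j) - frag_of (?d j, \<epsilon> j) - frag_of (\<eta> j, \<epsilon> j)) \<in> ?R"
    by (rule frag.subspace_sum[OF R])
  then have 1: "(\<Sum>j\<in>J. frag_of (\<delta> j, \<epsilon> j)) - (\<Sum>j\<in>J. frag_of (?d j, \<epsilon> j)) - (\<Sum>j\<in>J. frag_of (\<eta> j, \<epsilon> j)) \<in> ?R"
    by (simp only: sum_subtractf)
  have 2: "(v - (\<Sum>j\<in>J. frag_of (\<delta> j, \<epsilon> j))) - (w - (\<Sum>j\<in>J. frag_of (\<eta> j, \<epsilon> j))) \<in> ?R"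
    by (rule frag.subspace_diff[OF R \<delta>(2) \<eta>(2)])
  have eq: "(p - q) - (r - s) + (q - t - s) = p - r - t" for p q r s t :: "'a \<times> 'b \<Rightarrow>\<^sub>0 int"
    by (simp add: algebra_simps)
  have "v - w - (\<Sum>j\<in>J. frag_of (?d j, \<epsilon> j)) \<in> ?R"
    using frag.subspace_add[OF R 2 1] unfolding eq .
  then show ?case using d by (intro exI[of _ ?d]) simp
qed

text \<open>Purity of the span of the \<open>\<epsilon> j\<close> lets their coordinates extend to every finitely generated
  subgroup that supports the given relation.\<close>

lemma tensor_basis_coefficients_trivial:
  fixes M :: "('m, 'x) monoid_scheme" and \<epsilon> :: "'j \<Rightarrow> 'm"
  assumes C: "comm_group C" and M: "comm_group M"
    and J: "finite J" "\<And>j. j \<in> J \<Longrightarrow> \<epsilon> j \<in> carrier M"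
    and indep: "int_indep (comm_group.torsion_frags M) (\<lambda>j. frag_of (\<epsilon> j)) J"
    and pure: "pure_in (int_span (comm_group.torsion_frags M) (\<lambda>j. frag_of (\<epsilon> j)) J)
      {w. Poly_Mapping.keys w \<subseteq> carrier M}"
    and a: "\<And>j. j \<in> J \<Longrightarrow> a j \<in> carrier C"
    and rel: "(\<Sum>j\<in>J. frag_of (a j, \<epsilon> j)) \<in> tensor_relations C M"
    and j0: "j0 \<in> J"
  shows "a j0 = \<one>\<^bsub>C\<^esub>"
proof -
  interpret C: comm_group C by fact
  interpret M: comm_group M by fact
  let ?K = M.torsion_frags and ?e = "\<lambda>j. frag_of (\<epsilon> j)"
  note K = M.subspace_torsion_frags
  define L where "L = int_span ?K ?e J"
  have L: "frag.subspace L" unfolding L_def by (rule subspace_int_span[OF K])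
  have L_keys: "L \<subseteq> {w. Poly_Mapping.keys w \<subseteq> carrier M}"
    unfolding L_def using J by (intro M.int_span_torsion_frags_keys) auto
  from tensor_relation_finite_support[OF C M.is_group rel]
  obtain S0 where S0: "finite S0" "S0 \<subseteq> carrier M" and kill:
    "\<forall>V c. S0 \<subseteq> V \<longrightarrow> (\<forall>u\<in>V. \<forall>v\<in>V. u \<otimes>\<^bsub>M\<^esub> v \<in> V \<longrightarrow> c (u \<otimes>\<^bsub>M\<^esub> v) = c u + c v) \<longrightarrow>
      frag_eval C (\<lambda>(a, v). a [^]\<^bsub>C\<^esub> (c v :: int)) (\<Sum>j\<in>J. frag_of (a j, \<epsilon> j)) = \<one>\<^bsub>C\<^esub>"
    by (elim exE conjE)
  have "int_span L frag_of S0 \<subseteq> {w. Poly_Mapping.keys w \<subseteq> carrier M}"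
    using S0 L_keys by (intro int_span_minimal subspace_keys_subset) auto
  then have "pure_in L (int_span L frag_of S0)"
    using pure unfolding pure_in_def L_def[symmetric] by blast
  \<comment> \<open>By purity, \<open>S0\<close> generates a torsion-free group modulo
    \<open>L\<close>; its basis \<open>y\<close> over \<open>L\<close> completes the
    \<open>\<epsilon> j\<close> to a basis of everything that supports the relation.\<close>
  from exists_int_basis[OF L S0(1) this]
  obtain y and B :: "'m set" where y: "int_span L y B = int_span L frag_of S0" "int_indep L y B" by blast
  define b where "b = case_sum ?e y"
  define T where "T = Inl ` J \<union> Inr ` B"
  have bJ: "int_span ?K b (Inl ` J) = L" "int_indep ?K b (Inl ` J)"
    using indep by (auto simp: int_span_reindex[OF K] b_def L_def inj_on_def intro!: int_indep_reindex)
  have bB: "int_span L b (Inr ` B) = int_span L frag_of S0" "int_indep L b (Inr ` B)"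
    using y by (auto simp: int_span_reindex[OF L] b_def inj_on_def intro!: int_indep_reindex)
  have span: "int_span ?K b T = int_span L frag_of S0"
    using int_span_Un[OF K, of b "Inl ` J" "Inr ` B"] unfolding T_def bJ bB by simp
  have indT: "int_indep ?K b T"
    unfolding T_def using bJ(2) bB(2) by (intro int_indep_Un[OF K]) (simp_all add: bJ(1))
  \<comment> \<open>The coordinate at \<open>\<epsilon> j0\<close> in the enlarged basis; it takes
    the value 1 at \<open>\<epsilon> j0\<close> and 0 at the other \<open>\<epsilon> j\<close>, and
    so extracts \<open>a j0\<close>.\<close>
  define co where "co v = Poly_Mapping.lookup (int_coord ?K b T (frag_of v)) (Inl j0)" for v
  have co_\<epsilon>: "co (\<epsilon> j) = (if j = j0 then 1 else 0)" if "j \<in> J" for j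
  proof -
    have "int_coord ?K b T (b (Inl j)) = frag_of (Inl j)"
      using that by (intro int_coord_gen[OF K indT]) (simp add: T_def)
    then show ?thesis by (auto simp: co_def b_def)
  qed
  let ?F = "\<lambda>(a, v). a [^]\<^bsub>C\<^esub> co v"
  define V where "V = {v \<in> carrier M. frag_of v \<in> int_span ?K b T}"
  have F: "frag_eval C ?F (\<Sum>j\<in>J. frag_of (a j, \<epsilon> j)) = \<one>\<^bsub>C\<^esub>"
  proof (rule kill[THEN spec, THEN spec, THEN mp, THEN mp])
    show "S0 \<subseteq> V" unfolding V_def span using S0 by (auto intro: int_span_gen[OF L])
    show "\<forall>v\<in>V. \<forall>w\<in>V. v \<otimes>\<^bsub>M\<^esub> w \<in> V \<longrightarrow> co (v \<otimes>\<^bsub>M\<^esub> w) = co v + co w"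
      by (simp add: V_def co_def M.int_coord_frag_of_mult[OF indT] Poly_Mapping.lookup_add)
  qed
  \<comment> \<open>All coefficients are 1: this writes the sum over \<open>J\<close> as a
    \<open>frag_extend\<close>, so that its evaluation becomes a product over
    \<open>J\<close>.\<close>
  define c where "c = (\<Sum>j\<in>J. frag_of j)"
  have c_lookup: "Poly_Mapping.lookup c j = (if j \<in> J then 1 else 0)" for j
    using J(1) by (simp add: c_def lookup_sum)
  have c_keys: "Poly_Mapping.keys c = J" by (auto simp: in_keys_iff c_lookup split: if_splits)
  have "(\<Sum>j\<in>J. frag_of (a j, \<epsilon> j)) = frag_extend (\<lambda>j. frag_of (a j, \<epsilon> j)) c"
    using J(1) by (simp add: c_def frag_extend_sum comp_def)
  moreover have "frag_eval C ?F (frag_extend (\<lambda>j. frag_of (a j, \<epsilon> j)) c) =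
      frag_eval C (\<lambda>j. frag_eval C ?F (frag_of (a j, \<epsilon> j))) c"
    by (rule C.frag_eval_frag_extend[of ?F "carrier C \<times> carrier M" c J]) (use a J c_keys in auto)
  moreover have "\<dots> = (\<Otimes>\<^bsub>C\<^esub>j\<in>J. if j0 = j then a j else \<one>\<^bsub>C\<^esub>)"
    unfolding frag_eval_def[of C _ c] c_keys
  proof (rule C.finprod_cong')
    fix j assume j: "j \<in> J"
    then have "frag_eval C ?F (frag_of (a j, \<epsilon> j)) = a j [^]\<^bsub>C\<^esub> co (\<epsilon> j)" using a by simp
    then show "frag_eval C ?F (frag_of (a j, \<epsilon> j)) [^]\<^bsub>C\<^esub> Poly_Mapping.lookup c j =
        (if j0 = j then a j else \<one>\<^bsub>C\<^esub>)"
      using a[OF j] j by (auto simp: c_lookup co_\<epsilon>)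
  qed (use a in auto)
  moreover have "\<dots> = a j0" using C.finprod_singleton[OF j0 J(1), of a] a by simp
  ultimately show ?thesis using F by simp
qed

text \<open>This is the well-definedness of the induced map on cosets, applied to the coset of
  0.\<close>

lemma tensor_component_relation:
  assumes N: "\<And>i. i \<in> I \<Longrightarrow> group (N i)" and M: "group M" and i: "i \<in> I"
    and v: "v \<in> tensor_relations (product_group I N) M"
  shows "tensor_component i v \<in> tensor_relations (N i) M"
proof -
  let ?P = "product_group I N"
  have P: "group ?P" using N by simp
  have v_keys: "Poly_Mapping.keys v \<subseteq> carrier ?P \<times> carrier M"
    using subspace_tensor_relations(2)[OF P M] v by blast
  have "tensor_class ?P M v = tensor_class ?P M 0"
    using tensor_class_eq_iff[OF P M v_keys, of 0] v by simp
  then have "tensor_class (N i) M (tensor_component i v) = tensor_class (N i) M (tensor_component i 0)"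
    using tensor_map_component[where N = N and I = I, OF _ M i] N v_keys by (metis empty_subsetI keys_zero)
  moreover have "tensor_component i (0 :: ('a \<Rightarrow> 'b) \<times> 'd \<Rightarrow>\<^sub>0 int) = 0" by (simp add: tensor_component_def)
  ultimately show ?thesis
    using tensor_class_eq_iff[OF N[OF i] M keys_tensor_component[OF v_keys i], of 0]
    by (simp add: tensor_component_def)
qed

section \<open>Countable pure closures and bases of pure subgroups\<close>

lemma countable_finite_support_frags:
  assumes "finite A"
  shows "countable {c :: 'a \<Rightarrow>\<^sub>0 int. Poly_Mapping.keys c \<subseteq> A}"
  using assms
proof (induction A rule: finite_induct)
  case (insert a A)
  have "{c :: 'a \<Rightarrow>\<^sub>0 int. Poly_Mapping.keys c \<subseteq> insert a A} \<subseteq>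
      (\<lambda>(z, c). frag_cmul z (frag_of a) + c) ` (UNIV \<times> {c. Poly_Mapping.keys c \<subseteq> A})"
  proof
    fix c :: "'a \<Rightarrow>\<^sub>0 int" assume c: "c \<in> {c. Poly_Mapping.keys c \<subseteq> insert a A}"
    let ?z = "Poly_Mapping.lookup c a"
    have "Poly_Mapping.keys (c - frag_cmul ?z (frag_of a)) \<subseteq> A"
      using c by (auto simp: in_keys_iff lookup_minus split: if_splits)
    then show "c \<in> (\<lambda>(z, c). frag_cmul z (frag_of a) + c) ` (UNIV \<times> {c. Poly_Mapping.keys c \<subseteq> A})"
      by (intro image_eqI[of _ _ "(?z, c - frag_cmul ?z (frag_of a))"]) auto
  qed
  moreover have "countable ((\<lambda>(z, c). frag_cmul z (frag_of a) + c) `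
      ((UNIV :: int set) \<times> {c. Poly_Mapping.keys c \<subseteq> A}))"
    using insert.IH by (intro countable_image countable_SIGMA) auto
  ultimately show ?case by (rule countable_subset)
qed simp

context comm_group
begin

text \<open>The preimage in the free group of the pure closure of the classes of \<open>A\<close>
  modulo torsion.\<close>

definition pure_closure_frags :: "'a set \<Rightarrow> ('a \<Rightarrow>\<^sub>0 int) set" where
  "pure_closure_frags A = {w. Poly_Mapping.keys w \<subseteq> carrier G \<and>
    (\<exists>q. q \<noteq> 0 \<and> frag_cmul q w \<in> int_span torsion_frags frag_of A)}"

lemma subspace_pure_closure_frags: "frag.subspace (pure_closure_frags A)"
proof (rule frag_subspaceI)
  note U = subspace_int_span[OF subspace_torsion_frags, of frag_of A]
  show "0 \<in> pure_closure_frags A"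
    using frag.subspace_0[OF U] by (auto simp: pure_closure_frags_def intro!: exI[of _ 1])
  fix v w assume "v \<in> pure_closure_frags A" "w \<in> pure_closure_frags A"
  then obtain q r where v: "Poly_Mapping.keys v \<subseteq> carrier G" "q \<noteq> 0" "frag_cmul q v \<in> int_span torsion_frags frag_of A"
    and w: "Poly_Mapping.keys w \<subseteq> carrier G" "r \<noteq> 0" "frag_cmul r w \<in> int_span torsion_frags frag_of A"
    by (auto simp: pure_closure_frags_def)
  have "frag_cmul r (frag_cmul q v) - frag_cmul q (frag_cmul r w) \<in> int_span torsion_frags frag_of A"
    by (intro frag.subspace_diff[OF U] frag.subspace_scale[OF U] v w)
  then have "frag_cmul (q * r) (v - w) \<in> int_span torsion_frags frag_of A"
    by (simp add: frag.scale_right_diff_distrib mult.commute)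
  then show "v - w \<in> pure_closure_frags A"
    using v(2) w(2) keys_subset_Un_diff[OF v(1) w(1)]
    by (auto simp: pure_closure_frags_def intro!: exI[of _ "q * r"])
qed

lemma pure_pure_closure_frags:
  "pure_in (pure_closure_frags A) {w. Poly_Mapping.keys w \<subseteq> carrier G}"
  unfolding pure_in_def
proof (intro ballI allI impI)
  fix w :: "'a \<Rightarrow>\<^sub>0 int" and q :: int
  assume w: "w \<in> {w. Poly_Mapping.keys w \<subseteq> carrier G}" and q: "q \<noteq> 0"
    and "frag_cmul q w \<in> pure_closure_frags A"
  then obtain r where "r \<noteq> 0" "frag_cmul r (frag_cmul q w) \<in> int_span torsion_frags frag_of A"
    by (auto simp: pure_closure_frags_def)
  then show "w \<in> pure_closure_frags A"
    using w q by (auto simp: pure_closure_frags_def intro!: exI[of _ "r * q"])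
qed

lemma torsion_frags_subset_pure_closure: "torsion_frags \<subseteq> pure_closure_frags A"
  using torsion_frags_keys by (auto simp: pure_closure_frags_def intro!: exI[of _ 1] int_span_base)

lemma mod_torsion_mem_pure_closure_iff:
  assumes w: "Poly_Mapping.keys w \<subseteq> carrier G"
  shows "mod_torsion w \<in> mod_torsion ` pure_closure_frags A \<longleftrightarrow> w \<in> pure_closure_frags A"
proof
  assume "mod_torsion w \<in> mod_torsion ` pure_closure_frags A"
  then obtain v where v: "v \<in> pure_closure_frags A" "mod_torsion w = mod_torsion v" by auto
  then have "w - v \<in> torsion_frags"
    using w mod_torsion_eq_iff[OF w, of v] by (auto simp: pure_closure_frags_def)
  then have "(w - v) + v \<in> pure_closure_frags A"
    using v torsion_frags_subset_pure_closure[of A]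
    by (intro frag.subspace_add[OF subspace_pure_closure_frags]) auto
  then show "w \<in> pure_closure_frags A" by simp
qed auto

lemma subgroup_pure_closure: "subgroup (mod_torsion ` pure_closure_frags A) (G Mod torsion_subgroup G)"
proof -
  let ?Q = "G Mod torsion_subgroup G" and ?W = "pure_closure_frags A"
  interpret Q: comm_group ?Q by (rule comm_group_mod_torsion)
  note W = subspace_pure_closure_frags[of A]
  have keys: "Poly_Mapping.keys w \<subseteq> carrier G" if "w \<in> ?W" for w
    using that by (simp add: pure_closure_frags_def)
  show ?thesis
  proof (rule Q.subgroupI)
    show "mod_torsion ` ?W \<subseteq> carrier ?Q" using keys mod_torsion_closed by auto
    show "mod_torsion ` ?W \<noteq> {}" using frag.subspace_0[OF W] by auto
    show "inv\<^bsub>?Q\<^esub> y \<in> mod_torsion ` ?W" if y: "y \<in> mod_torsion ` ?W" for y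
    proof -
      obtain w where w: "w \<in> ?W" "y = mod_torsion w" using y by auto
      then have "inv\<^bsub>?Q\<^esub> y = mod_torsion (- w)" using mod_torsion_uminus[OF keys] by simp
      then show ?thesis using frag.subspace_neg[OF W w(1)] by auto
    qed
    show "y \<otimes>\<^bsub>?Q\<^esub> z \<in> mod_torsion ` ?W" if yz: "y \<in> mod_torsion ` ?W" "z \<in> mod_torsion ` ?W" for y z
    proof -
      obtain v where v: "v \<in> ?W" "y = mod_torsion v" using yz by auto
      obtain w where w: "w \<in> ?W" "z = mod_torsion w" using yz by auto
      have "y \<otimes>\<^bsub>?Q\<^esub> z = mod_torsion (v + w)" using mod_torsion_add[OF keys keys] v w by simp
      then show ?thesis using frag.subspace_add[OF W v(1) w(1)] by auto
    qed
  qed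
qed

text \<open>Multiplication by \<open>q \<noteq> 0\<close> is injective on a torsion-free group, so
  the equation \<open>q w = c\<close> has at most one solution class. There are countably many pairs
  \<open>(q, c)\<close> with \<open>c\<close> supported on the finite set \<open>A\<close>.\<close>

lemma countable_pure_closure:
  assumes A: "finite A" "A \<subseteq> carrier G"
  shows "countable (mod_torsion ` pure_closure_frags A)"
proof -
  define Y where "Y p = {mod_torsion w | w. Poly_Mapping.keys w \<subseteq> carrier G \<and> fst p \<noteq> 0 \<and>
    frag_cmul (fst p) w - snd p \<in> torsion_frags}" for p :: "int \<times> ('a \<Rightarrow>\<^sub>0 int)"
  have uniq: "y = z" if yz: "y \<in> Y p" "z \<in> Y p" for y z p
  proof -
    obtain v w where v: "y = mod_torsion v" "Poly_Mapping.keys v \<subseteq> carrier G"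
        "frag_cmul (fst p) v - snd p \<in> torsion_frags"
      and w: "z = mod_torsion w" "Poly_Mapping.keys w \<subseteq> carrier G"
        "frag_cmul (fst p) w - snd p \<in> torsion_frags" and p: "fst p \<noteq> 0"
      using yz by (auto simp: Y_def)
    have "(frag_cmul (fst p) v - snd p) - (frag_cmul (fst p) w - snd p) \<in> torsion_frags"
      by (rule frag.subspace_diff[OF subspace_torsion_frags v(3) w(3)])
    then have "frag_cmul (fst p) (v - w) \<in> torsion_frags"
      by (simp add: frag.scale_right_diff_distrib)
    then have "v - w \<in> torsion_frags"
      using pure_torsion_frags p keys_subset_Un_diff[OF v(2) w(2)] unfolding pure_in_def by blast
    then show ?thesis using mod_torsion_eq_iff[OF v(2) w(2)] v w by simp
  qed
  have "countable (Y p)" for p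
  proof (cases "Y p = {}")
    case False
    then obtain y where "y \<in> Y p" by blast
    then have "Y p \<subseteq> {y}" using uniq by blast
    then show ?thesis by (rule countable_subset) simp
  qed simp
  moreover have "countable (UNIV \<times> {c :: 'a \<Rightarrow>\<^sub>0 int. Poly_Mapping.keys c \<subseteq> A} :: (int \<times> _) set)"
    by (intro countable_SIGMA countable_finite_support_frags A) auto
  ultimately have "countable (\<Union>p\<in>UNIV \<times> {c. Poly_Mapping.keys c \<subseteq> A}. Y p)"
    by (intro countable_UN)
  moreover have "mod_torsion ` pure_closure_frags A \<subseteq> (\<Union>p\<in>UNIV \<times> {c. Poly_Mapping.keys c \<subseteq> A}. Y p)"
  proof
    fix y assume "y \<in> mod_torsion ` pure_closure_frags A"
    then obtain w q where w: "y = mod_torsion w" "Poly_Mapping.keys w \<subseteq> carrier G" "q \<noteq> 0"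
      "frag_cmul q w \<in> int_span torsion_frags frag_of A" by (auto simp: pure_closure_frags_def)
    obtain c where "Poly_Mapping.keys c \<subseteq> A" "frag_cmul q w - frag_extend frag_of c \<in> torsion_frags"
      using w(4) by (rule int_spanE)
    then have "y \<in> Y (q, c)" using w by (auto simp: Y_def simp flip: frag_expansion)
    then show "y \<in> (\<Union>p\<in>UNIV \<times> {c. Poly_Mapping.keys c \<subseteq> A}. Y p)"
      using \<open>Poly_Mapping.keys c \<subseteq> A\<close> by blast
  qed
  ultimately show ?thesis using countable_subset by blast
qed

text \<open>The pure closure of \<open>A\<close> is countable, hence free by assumption. Finitely
  many members of its basis already express \<open>A\<close>; they span a direct summand of the pure
  closure, and a direct summand of a pure subgroup is pure. The elements of \<open>J\<close> serve
  only as names, the group elements being the lifts \<open>\<epsilon> j\<close>.\<close>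

lemma aleph1_free_pure_basis:
  assumes free: "aleph1_free (G Mod torsion_subgroup G)" and A: "finite A" "A \<subseteq> carrier G"
  shows "\<exists>\<epsilon> (J :: 'a set set). finite J \<and> (\<forall>j\<in>J. \<epsilon> j \<in> carrier G) \<and>
    int_indep torsion_frags (\<lambda>j. frag_of (\<epsilon> j)) J \<and>
    pure_in (int_span torsion_frags (\<lambda>j. frag_of (\<epsilon> j)) J) {w. Poly_Mapping.keys w \<subseteq> carrier G} \<and>
    (\<forall>m\<in>A. \<exists>c. Poly_Mapping.keys c \<subseteq> J \<and>
      frag_of m - frag_extend (\<lambda>j. frag_of (\<epsilon> j)) c \<in> torsion_frags)"
proof -
  let ?Q = "G Mod torsion_subgroup G" and ?W = "pure_closure_frags A"
  note K = subspace_torsion_frags and W = subspace_pure_closure_frags[of A]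
  interpret Q: comm_group ?Q by (rule comm_group_mod_torsion)
  define H where "H = subgroup_generated ?Q (mod_torsion ` ?W)"
  have HW: "carrier H = mod_torsion ` ?W"
    unfolding H_def by (rule subgroup.carrier_subgroup_generated_subgroup[OF subgroup_pure_closure])
  have "free_abelian H"
    using free countable_pure_closure[OF A] subgroup.subset[OF subgroup_pure_closure[of A]]
    unfolding aleph1_free_def H_def by blast
  moreover have "group H" unfolding H_def by simp
  ultimately obtain S :: "'a set set" where "free_Abelian_group S \<cong> H"
    unfolding free_abelian_def by (auto intro: group.iso_sym)
  then obtain \<psi> where \<psi>: "\<psi> \<in> iso (free_Abelian_group S) H" by (auto simp: is_iso_def)
  have \<psi>_add: "\<psi> (c + d) = \<psi> c \<otimes>\<^bsub>?Q\<^esub> \<psi> d"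
    if "Poly_Mapping.keys c \<subseteq> S" "Poly_Mapping.keys d \<subseteq> S" for c d
    using \<psi> that hom_mult[of \<psi> "free_Abelian_group S" H c d] by (simp add: iso_def H_def)
  have \<psi>_bij: "bij_betw \<psi> {c. Poly_Mapping.keys c \<subseteq> S} (carrier H)"
    using \<psi> by (simp add: iso_def free_Abelian_group_def)
  have \<psi>_inj: "c = d" if "\<psi> c = \<psi> d" "Poly_Mapping.keys c \<subseteq> S" "Poly_Mapping.keys d \<subseteq> S" for c d
    using \<psi>_bij that by (auto simp: bij_betw_def inj_on_def)
  have \<psi>_mem: "\<psi> c \<in> mod_torsion ` ?W" if "Poly_Mapping.keys c \<subseteq> S" for c
    using bij_betwE[OF \<psi>_bij] that HW by blast
  have \<psi>_surj: "\<exists>c. Poly_Mapping.keys c \<subseteq> S \<and> \<psi> c = mod_torsion w" if "w \<in> ?W" for w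
  proof -
    have "mod_torsion w \<in> \<psi> ` {c. Poly_Mapping.keys c \<subseteq> S}"
      using \<psi>_bij that HW by (simp add: bij_betw_def)
    then show ?thesis by auto
  qed
  have W_keys: "Poly_Mapping.keys w \<subseteq> carrier G" if "w \<in> ?W" for w
    using that by (simp add: pure_closure_frags_def)
  have "\<exists>a. a \<in> carrier G \<and> (j \<in> S \<longrightarrow> mod_torsion (frag_of a) = \<psi> (frag_of j))" for j
  proof (cases "j \<in> S")
    case True
    then have "\<psi> (frag_of j) \<in> carrier ?Q"
      using \<psi>_mem[of "frag_of j"] subgroup.subset[OF subgroup_pure_closure[of A]] by auto
    then obtain a where "a \<in> carrier G" "mod_torsion (frag_of a) = \<psi> (frag_of j)"
      by (rule mod_torsion_surj)
    then show ?thesis by blast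
  qed auto
  then obtain \<epsilon> where \<epsilon>: "\<And>j. \<epsilon> j \<in> carrier G" "\<And>j. j \<in> S \<Longrightarrow> mod_torsion (frag_of (\<epsilon> j)) = \<psi> (frag_of j)"
    by metis
  let ?e = "\<lambda>j. frag_of (\<epsilon> j)"
  have e_keys: "Poly_Mapping.keys (frag_extend ?e c) \<subseteq> carrier G" for c
    using keys_frag_extend[of ?e c] \<epsilon>(1) by auto
  have \<psi>_ext: "mod_torsion (frag_extend ?e c) = \<psi> c" if "Poly_Mapping.keys c \<subseteq> S" for c
    using that
  proof (induction c rule: free_Abelian_group_induct [consumes 1, case_names zero diff of])
    case zero
    have "\<psi> 0 \<in> carrier ?Q" using \<psi>_mem[of 0] subgroup.subset[OF subgroup_pure_closure[of A]] by auto
    moreover have "\<psi> 0 \<otimes>\<^bsub>?Q\<^esub> \<psi> 0 = \<psi> 0" using \<psi>_add[of 0 0] by simp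
    ultimately have "\<psi> 0 = \<one>\<^bsub>?Q\<^esub>" using Q.l_cancel_one by blast
    then show ?case by (simp only: frag_extend_0 mod_torsion_0)
  next
    case (diff c d)
    have cd: "Poly_Mapping.keys (c - d) \<subseteq> S" by (rule keys_subset_Un_diff[OF diff(1,2)])
    have car: "\<psi> (c - d) \<in> carrier ?Q" "\<psi> d \<in> carrier ?Q"
      using \<psi>_mem[OF cd] \<psi>_mem[OF diff(2)] subgroup.subset[OF subgroup_pure_closure[of A]] by auto
    have "mod_torsion (frag_extend ?e (c - d)) \<otimes>\<^bsub>?Q\<^esub> \<psi> d = mod_torsion (frag_extend ?e (c - d) + frag_extend ?e d)"
      using mod_torsion_add[OF e_keys e_keys] diff by simp
    also have "\<dots> = \<psi> c" using diff by (simp add: frag_extend_diff)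
    also have "\<dots> = \<psi> (c - d) \<otimes>\<^bsub>?Q\<^esub> \<psi> d" using \<psi>_add[OF cd diff(2)] by simp
    finally show ?case using Q.right_cancel[OF car(2) mod_torsion_closed[OF e_keys] car(1)] by blast
  next
    case (of j)
    then show ?case using \<epsilon> by simp
  qed
  have AW: "frag_of m \<in> ?W" if "m \<in> A" for m
    unfolding pure_closure_frags_def
  proof (intro CollectI conjI exI)
    have "frag_of m \<in> int_span torsion_frags frag_of A" by (rule int_span_gen[OF K that])
    then show "frag_cmul 1 (frag_of m) \<in> int_span torsion_frags frag_of A" by (simp only: frag_cmul_one)
    show "Poly_Mapping.keys (frag_of m) \<subseteq> carrier G" using that A by auto
  qed simp
  have "\<forall>m\<in>A. \<exists>c. Poly_Mapping.keys c \<subseteq> S \<and> \<psi> c = mod_torsion (frag_of m)"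
    using \<psi>_surj[OF AW] by blast
  from bchoice[OF this] obtain cf where "\<forall>m\<in>A. Poly_Mapping.keys (cf m) \<subseteq> S \<and> \<psi> (cf m) = mod_torsion (frag_of m)" ..
  then have cf: "\<And>m. m \<in> A \<Longrightarrow> Poly_Mapping.keys (cf m) \<subseteq> S"
    "\<And>m. m \<in> A \<Longrightarrow> \<psi> (cf m) = mod_torsion (frag_of m)" by auto
  \<comment> \<open>Only the basis members that occur in the coordinates of elements of
    \<open>A\<close> are kept, which makes the index set finite.\<close>
  define J where "J = (\<Union>m\<in>A. Poly_Mapping.keys (cf m))"
  have JS: "J \<subseteq> S" using cf by (auto simp: J_def)
  have ext_W: "frag_extend ?e c \<in> ?W" if "Poly_Mapping.keys c \<subseteq> S" for c
    using \<psi>_ext[OF that] \<psi>_mem[OF that] mod_torsion_mem_pure_closure_iff[OF e_keys] by metis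
  show ?thesis
  proof (rule exI[of _ \<epsilon>], rule exI[of _ J], intro conjI)
    show "finite J" using A by (simp add: J_def)
    show "\<forall>j\<in>J. \<epsilon> j \<in> carrier G" using \<epsilon>(1) by blast
    show "int_indep torsion_frags ?e J"
      unfolding int_indep_def
    proof (intro allI impI)
      fix c assume c: "Poly_Mapping.keys c \<subseteq> J" "frag_extend ?e c \<in> torsion_frags"
      have "\<psi> c = \<psi> 0"
        using c(2) \<psi>_ext[of c] \<psi>_ext[of 0] c(1) JS mod_torsion_eq_iff[OF e_keys[of c], of 0] by simp
      then show "c = 0" using c JS by (intro \<psi>_inj) auto
    qed
    show "pure_in (int_span torsion_frags ?e J) {w. Poly_Mapping.keys w \<subseteq> carrier G}"
      unfolding pure_in_def
    proof (intro ballI allI impI)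
      fix w :: "'a \<Rightarrow>\<^sub>0 int" and q :: int
      assume w: "w \<in> {w. Poly_Mapping.keys w \<subseteq> carrier G}" and q: "q \<noteq> 0"
        and qw: "frag_cmul q w \<in> int_span torsion_frags ?e J"
      obtain c where c: "Poly_Mapping.keys c \<subseteq> J" "frag_cmul q w - frag_extend ?e c \<in> torsion_frags"
        using qw by (rule int_spanE)
      have qw_keys: "Poly_Mapping.keys (frag_cmul q w) \<subseteq> carrier G" using w keys_cmul by blast
      have "(frag_cmul q w - frag_extend ?e c) + frag_extend ?e c \<in> ?W"
        using c JS torsion_frags_subset_pure_closure[of A] ext_W[of c]
        by (intro frag.subspace_add[OF W]) auto
      then have "frag_cmul q w \<in> ?W" by simp
      then have "w \<in> ?W" using pure_pure_closure_frags[of A] w q unfolding pure_in_def by blast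
      then obtain d where d: "Poly_Mapping.keys d \<subseteq> S" "\<psi> d = mod_torsion w" using \<psi>_surj by blast
      have w_keys: "Poly_Mapping.keys w \<subseteq> carrier G" using w by simp
      have wd: "w - frag_extend ?e d \<in> torsion_frags"
        using d(2) \<psi>_ext[OF d(1)] mod_torsion_eq_iff[OF w_keys e_keys[of d]] by simp
      have "(frag_cmul q w - frag_extend ?e c) - frag_cmul q (w - frag_extend ?e d) \<in> torsion_frags"
        by (intro frag.subspace_diff[OF K c(2)] frag.subspace_scale[OF K wd])
      moreover have "(a - b) - (a - t) = t - b" for a b t :: "'a \<Rightarrow>\<^sub>0 int" by simp
      ultimately have "frag_extend ?e (frag_cmul q d) - frag_extend ?e c \<in> torsion_frags"
        by (simp only: frag.scale_right_diff_distrib frag_extend_cmul)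
      then have "mod_torsion (frag_extend ?e (frag_cmul q d)) = mod_torsion (frag_extend ?e c)"
        using mod_torsion_eq_iff[OF e_keys e_keys] by blast
      moreover have qd: "Poly_Mapping.keys (frag_cmul q d) \<subseteq> S" using d(1) keys_cmul by blast
      moreover have cS: "Poly_Mapping.keys c \<subseteq> S" using c(1) JS by blast
      ultimately have "\<psi> (frag_cmul q d) = \<psi> c" by (simp only: \<psi>_ext)
      \<comment> \<open>Coordinates in the full basis \<open>S\<close> are unique, so those of
        \<open>w\<close>, multiplied by \<open>q\<close>, are those of \<open>q w\<close>. As
        \<open>q \<noteq> 0\<close>, both have the same support, which lies in
        \<open>J\<close>.\<close>
      then have "frag_cmul q d = c" using qd cS by (rule \<psi>_inj)
      then have "Poly_Mapping.keys d \<subseteq> J" using c(1) q by auto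
      then show "w \<in> int_span torsion_frags ?e J" using wd by (rule int_spanI)
    qed
    show "\<forall>m\<in>A. \<exists>c. Poly_Mapping.keys c \<subseteq> J \<and> frag_of m - frag_extend ?e c \<in> torsion_frags"
    proof (intro ballI exI conjI)
      fix m assume m: "m \<in> A"
      then show "Poly_Mapping.keys (cf m) \<subseteq> J" by (auto simp: J_def)
      have m_keys: "Poly_Mapping.keys (frag_of m) \<subseteq> carrier G" using m A by auto
      have "mod_torsion (frag_of m) = mod_torsion (frag_extend ?e (cf m))"
        using cf[OF m] \<psi>_ext by simp
      then show "frag_of m - frag_extend ?e (cf m) \<in> torsion_frags"
        using mod_torsion_eq_iff[OF m_keys e_keys] by blast
    qed
  qed
qed

end

lemma aleph1_free_imp_Mittag_Leffler:
  fixes M :: "('m, 'x) monoid_scheme"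
  assumes M: "comm_group M" and free: "aleph1_free (M Mod torsion_subgroup M)"
  shows "sharp_Mittag_Leffler TYPE('i) TYPE('n) M"
proof -
  interpret M: comm_group M by fact
  show ?thesis unfolding sharp_Mittag_Leffler_iff_kernel[OF M.is_group]
  proof (intro allI impI)
    fix I :: "'i set" and N :: "'i \<Rightarrow> 'n monoid" and u :: "('i \<Rightarrow> 'n) \<times> 'm \<Rightarrow>\<^sub>0 int"
    let ?P = "product_group I N"
    assume ap: "\<forall>i\<in>I. absolutely_pure (N i)"
      and u: "Poly_Mapping.keys u \<subseteq> carrier ?P \<times> carrier M"
      and ker: "\<forall>i\<in>I. tensor_component i u \<in> tensor_relations (N i) M"
    have N: "comm_group (N i)" if "i \<in> I" for i using ap that by (auto simp: absolutely_pure_def)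
    have N': "group (N i)" if "i \<in> I" for i using N[OF that] by (simp add: comm_group_def)
    have P: "comm_group ?P" using N by (rule comm_group_product_group)
    interpret P: comm_group ?P by (rule P)
    \<comment> \<open>Roots are chosen in every component at once, so the product of the divisible
      groups is divisible and torsion dies in its tensor product as well.\<close>
    have div: "\<exists>c\<in>carrier ?P. c [^]\<^bsub>?P\<^esub> n = a" if n: "n > 0" and a: "a \<in> carrier ?P" for n :: nat and a
    proof -
      have "\<exists>c. i \<in> I \<longrightarrow> c \<in> carrier (N i) \<and> c [^]\<^bsub>N i\<^esub> n = a i" for i
        using ap n a unfolding absolutely_pure_iff_divisible by auto blast
      then obtain c where c: "\<And>i. i \<in> I \<Longrightarrow> c i \<in> carrier (N i)" "\<And>i. i \<in> I \<Longrightarrow> c i [^]\<^bsub>N i\<^esub> n = a i"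
        by metis
      let ?c = "restrict c I"
      have cP: "?c \<in> carrier ?P" using c by auto
      have "(?c [^]\<^bsub>?P\<^esub> n) i = a i" for i
      proof (cases "i \<in> I")
        case True
        interpret pr: group_hom ?P "N i" "\<lambda>x. x i"
          by (rule product_group_projection[OF N' True])
        show ?thesis using pr.hom_nat_pow[OF cP, of n] c True by simp
      next
        case False
        have "?c [^]\<^bsub>?P\<^esub> n \<in> carrier ?P" using cP by (rule P.nat_pow_closed)
        then show ?thesis using a False by (auto simp: PiE_def extensional_def)
      qed
      then show ?thesis using cP by blast
    qed
    define A where "A = snd ` Poly_Mapping.keys u"
    have A: "finite A" "A \<subseteq> carrier M" "Poly_Mapping.keys u \<subseteq> carrier ?P \<times> A"
      using u by (auto simp: A_def image_iff) force+
    from M.aleph1_free_pure_basis[OF free A(1,2)]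
    obtain \<epsilon> and J :: "'m set set" where J: "finite J" "\<forall>j\<in>J. \<epsilon> j \<in> carrier M"
      and indep: "int_indep M.torsion_frags (\<lambda>j. frag_of (\<epsilon> j)) J"
      and pure: "pure_in (int_span M.torsion_frags (\<lambda>j. frag_of (\<epsilon> j)) J) {w. Poly_Mapping.keys w \<subseteq> carrier M}"
      and AJ: "\<forall>m\<in>A. \<exists>c. Poly_Mapping.keys c \<subseteq> J \<and>
        frag_of m - frag_extend (\<lambda>j. frag_of (\<epsilon> j)) c \<in> M.torsion_frags"
      by (elim exE conjE)
    note J = J(1) J(2)[rule_format] and AJ = AJ[rule_format]
    have "\<exists>\<delta>. (\<forall>j. \<delta> j \<in> carrier ?P) \<and> u - (\<Sum>j\<in>J. frag_of (\<delta> j, \<epsilon> j)) \<in> tensor_relations ?P M"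
      by (rule tensor_reduce_to_basis[OF P M _ J(1) _ A(2) _ A(3)]) (erule (1) div | erule J(2) | erule AJ)+
    then obtain \<delta> where "\<forall>j. \<delta> j \<in> carrier ?P"
      and u\<delta>: "u - (\<Sum>j\<in>J. frag_of (\<delta> j, \<epsilon> j)) \<in> tensor_relations ?P M"
      by (elim exE conjE)
    then have \<delta>: "\<delta> j \<in> carrier ?P" for j by blast
    \<comment> \<open>The \<open>\<delta> j\<close> were chosen once for the whole product, before
      any index \<open>i\<close>. Each component can therefore be treated separately, and the
      results combine to \<open>\<delta> j = \<one>\<close> in the product.\<close>
    have triv: "\<delta> j i = \<one>\<^bsub>N i\<^esub>" if i: "i \<in> I" and j: "j \<in> J" for i j
    proof (rule tensor_basis_coefficients_trivial[OF N[OF i] M J indep pure _ _ j])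
      show "\<delta> j i \<in> carrier (N i)" for j using \<delta>[of j] i by auto
      note R = subspace_tensor_relations(1)[OF N'[OF i] M.is_group]
      have "tensor_component i (u - (\<Sum>j\<in>J. frag_of (\<delta> j, \<epsilon> j))) \<in> tensor_relations (N i) M"
        using N' M.is_group i u\<delta> by (rule tensor_component_relation)
      then have 1: "tensor_component i u - (\<Sum>j\<in>J. frag_of (\<delta> j i, \<epsilon> j)) \<in> tensor_relations (N i) M"
        using J(1) by (simp add: tensor_component_def frag_extend_diff frag_extend_sum comp_def)
      have 2: "tensor_component i u \<in> tensor_relations (N i) M" using ker i by blast
      show "(\<Sum>j\<in>J. frag_of (\<delta> j i, \<epsilon> j)) \<in> tensor_relations (N i) M"
        using frag.subspace_diff[OF R 2 1] by (simp only: diff_diff_eq2 add_diff_cancel_left')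
    qed
    have "\<delta> j = \<one>\<^bsub>?P\<^esub>" if j: "j \<in> J" for j
    proof (rule extensionalityI[of _ I])
      show "\<delta> j \<in> extensional I" using \<delta>[of j] by (simp add: PiE_def)
    qed (use triv[OF _ j] in auto)
    note R = subspace_tensor_relations(1)[OF P.is_group M.is_group]
    have "frag_of (\<delta> j, \<epsilon> j) \<in> tensor_relations ?P M" if "j \<in> J" for j
      unfolding \<open>\<And>j. j \<in> J \<Longrightarrow> \<delta> j = \<one>\<^bsub>?P\<^esub>\<close>[OF that]
      by (rule tensor_one_left[OF P M.is_group J(2)[OF that]])
    then have "(\<Sum>j\<in>J. frag_of (\<delta> j, \<epsilon> j)) \<in> tensor_relations ?P M" by (rule frag.subspace_sum[OF R])
    from frag.subspace_add[OF R u\<delta> this] show "u \<in> tensor_relations ?P M" by (simp only: diff_add_cancel)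
  qed
qed

theorem corollary6p12:
  fixes M :: "('m, 'x) monoid_scheme"
  assumes "comm_group M"
    and "infinite (UNIV :: 'i set)" and "infinite (UNIV :: 'n set)"
  shows "sharp_Mittag_Leffler TYPE('i) TYPE('n) M \<longleftrightarrow>
    aleph1_free (M Mod torsion_subgroup M)"
  using Mittag_Leffler_imp_aleph1_free[OF assms] aleph1_free_imp_Mittag_Leffler[OF assms(1)] by blast

end
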